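(* Let $k\ge1$ be a fixed integer. For sufficiently large real $x$, let $D_k^*=\{d_1^*,\dots,d_k^*\}$ (with $d_1^*<\dots<d_k^*$) be a $k$-tuple prime difference champion for the primes $\le x$, and let $d^*$ be the greatest common divisor of $d_1^*,\dots,d_k^*$. Then, as $x\to\infty$, $$\sum_{\substack{p\le 2\log x\\ p\nmid d^*}}\frac1p\le \log k!+k\log 2+\log\big(2(k+1)^2\big)+o(1)$$ and $$\sum_{\substack{p\le 2\log x\\ p\nmid \Delta_{\{0\}\cup D_k^*}}}\frac1p\le \frac1k\log k!+\log 2+\frac1k\log\big(2(k+1)^2\big)+o(1),$$ where the sums run over primes $p$.
   Context: For a set $D_k=\{d_1,\dots,d_k\}$ of $k$ distinct integers with $d_1<d_2<\dots<d_k$ and a real $x$, define $$G_k(x,D_k)=\#\{p\le x-d_k:\ p \text{ prime and } p+d_i \text{ is prime for all } 1\le i\le k\}.$$ A set $D_k^*$ is a $k$-tuple prime difference champion for the primes $\le x$ if $G_k(x,D_k^* )=\max_{D_k}G_k(x,D_k)$, the maximum over all sets $D_k$ of $k$ distinct integers. For such a set, $\Delta_{\{0\}\cup D_k}=\prod_{0\le j<i\le k}(d_i-d_j)$ with the convention $d_0=0$. *)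

theory Defs
  imports Complex_Main "HOL-Library.Landau_Symbols" "HOL-Computational_Algebra.Primes"
begin

text \<open>
  A tuple of differences \<open>d\<^sub>1 < \<dots> < d\<^sub>k\<close> is represented by the finite set \<open>D\<close> of its
  entries, so \<open>Max D\<close> is \<open>d\<^sub>k\<close>. Primes of type \<^typ>\<open>int\<close> are positive.
\<close>

definition prime_tuple_count :: "real \<Rightarrow> int set \<Rightarrow> nat" where
  "prime_tuple_count x D =
     card {p :: int. prime p \<and> real_of_int p \<le> x - real_of_int (Max D) \<and> (\<forall>d\<in>D. prime (p + d))}"

text \<open>
  The set \<open>S\<close> is the range of the differences that compete. With \<open>S = UNIV\<close> the maximum
  is over all sets of \<open>k\<close> integers. Then the difference \<open>0\<close> competes as well, so for
  \<open>k = 1\<close> the set \<open>{0}\<close> is always a champion. With \<open>S = {0<..}\<close> only positive differences compete.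
\<close>

definition prime_difference_champion :: "int set \<Rightarrow> nat \<Rightarrow> real \<Rightarrow> int set \<Rightarrow> bool" where
  "prime_difference_champion S k x D \<longleftrightarrow>
     D \<subseteq> S \<and> finite D \<and> card D = k \<and>
     (\<forall>D'. D' \<subseteq> S \<and> finite D' \<and> card D' = k \<longrightarrow> prime_tuple_count x D' \<le> prime_tuple_count x D)"

text \<open>
  The product is taken over indices, not over the elements of \<open>insert 0 D\<close>: if \<open>0 \<in> D\<close>,
  then some \<open>d\<^sub>i - d\<^sub>0\<close> vanishes and the value is \<open>0\<close>.
\<close>

definition Delta0 :: "int set \<Rightarrow> int" where
  "Delta0 D = (let d = (\<lambda>i. (0 # sorted_list_of_set D) ! i) in \<Prod>i\<le>card D. \<Prod>j<i. d i - d j)"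

end

theory Submission
  imports Defs "HOL-Complex_Analysis.Complex_Analysis" "HOL-Number_Theory.Number_Theory"
    "HOL-Real_Asymp.Real_Asymp"
begin

text \<open>
  Put \<open>y = \<eta> ln x\<close> for a small constant \<open>\<eta>\<close>, let \<open>q\<close> be the product of the primes up to \<open>y\<close> and
  let \<open>V\<close> be the product of \<open>1 - 1/p\<close> over these primes. Averaging over windows of terms of arithmetic
  progressions with difference \<open>q\<close>, and using the prime number theorem together with convexity, produces
  differences that are multiples of \<open>q\<close> and whose count is at least about \<open>x / (ln x)^t * V^(1-t)\<close>; here
  \<open>t\<close> is the number of primes in the tuple. A champion does at least as well. On the other hand, Selberg's
  sieve bounds its count by about \<open>2^t t! x / (ln x)^t\<close> times the product of \<open>(1 - \<nu>(p)/p) (1 - 1/p)^(-t)\<close>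
  over \<open>p \<le> y\<close>, where \<open>\<nu>(p)\<close> is the number of residue classes mod \<open>p\<close> that the differences and \<open>0\<close>
  occupy. Comparing the two bounds, the product of \<open>(1 - \<nu>(p)/p) / (1 - 1/p)\<close> over \<open>p \<le> y\<close> is bounded
  from below. Each prime that does not divide the gcd contributes a factor at most \<open>exp(-1/p)\<close> to it, and
  each prime that does not divide the difference product a factor at most \<open>exp(-k/p)\<close>. The primes between
  \<open>y\<close> and \<open>2 ln x\<close> only contribute \<open>o(1)\<close> to the sums.
\<close>

section \<open>Chebyshev's function and the zeta function\<close>

text \<open>Multiples of \<open>q\<close> occupy a single residue class modulo every p \<le> y, the
  most favourable local behaviour, so comparing a champion with them isolates its local loss at
  these primes. Up to constants, y = \<eta> ln x is the largest scale at which \<open>q\<close> is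
  still a small power of x. Without numerical slack the comparison would give the constant t! 2^t,
  where 2^t reflects that the sieve stops near the square root of x. With t \<le> k + 1, the
  constant k! 2^k 2 (k+1)^2 of the theorem exceeds (k+1)! 2^(k+1) by the factor k + 1 \<ge> 2, and
  this 2 pays for the slacks 3/4, 4/3 and 1/12. It does not pay for a Chebyshev bound in place of
  the prime number theorem: a constant lost in the number of primes is raised to the power t, which
  outgrows k + 1. The obstacle is uniformity: a champion depends on x in an unknown way. Primes
  above y are therefore controlled only through their number: those dividing some difference of size
  at most x are O(ln x / ln ln x) many, negligible against y.\<close>

definition chebyshev_psi :: "nat \<Rightarrow> real" where
  "chebyshev_psi N = (\<Sum>n=1..N. mangoldt n)"

lemma chebyshev_psi_Suc: "chebyshev_psi (Suc n) = chebyshev_psi n + mangoldt (Suc n)"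
  by (simp add: chebyshev_psi_def)

lemma chebyshev_psi_nonneg: "chebyshev_psi n \<ge> 0"
  unfolding chebyshev_psi_def by (intro sum_nonneg mangoldt_nonneg)

lemma chebyshev_psi_mono: "m \<le> n \<Longrightarrow> chebyshev_psi m \<le> chebyshev_psi n"
  unfolding chebyshev_psi_def by (intro sum_mono2 mangoldt_nonneg) auto

lemma card_multiples: "d > 0 \<Longrightarrow> card {n\<in>{1..N}. d dvd n} = N div (d::nat)"
proof -
  assume d: "d > 0"
  have "{n\<in>{1..N}. d dvd n} = (\<lambda>k. d * k) ` {1..N div d}"
    using d by (auto simp: image_iff dvd_def less_eq_div_iff_mult_less_eq mult.commute Suc_le_eq)
  thus ?thesis using d by (simp add: card_image inj_on_def)
qed

text \<open>Each \<open>ln n\<close> splits into \<open>mangoldt\<close> over the divisors of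
  \<open>n\<close>, and \<open>d\<close> divides \<open>N div d\<close> of the numbers up to
  \<open>N\<close>: Legendre's formula in logarithmic form.\<close>

lemma ln_fact_eq_sum_mangoldt:
  "ln (fact N :: real) = (\<Sum>d=1..N. mangoldt d * real (N div d))"
proof -
  have "ln (fact N :: real) = (\<Sum>n=1..N. ln (real n))"
    unfolding fact_prod of_nat_prod by (subst ln_prod) auto
  also have "\<dots> = (\<Sum>n=1..N. \<Sum>d | d dvd n. mangoldt d)"
    by (intro sum.cong refl) (subst mangoldt_sum, auto)
  also have "\<dots> = (\<Sum>n=1..N. \<Sum>d=1..N. if d dvd n then mangoldt d else 0)"
  proof (rule sum.cong[OF refl])
    fix n assume n: "n \<in> {1..N}"
    have "(\<Sum>d=1..N. if d dvd n then mangoldt d else (0::real)) = sum mangoldt {d\<in>{1..N}. d dvd n}"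
      by (rule sum.inter_filter[symmetric]) simp
    also have "{d\<in>{1..N}. d dvd n} = {d. d dvd n}"
      using n by (auto dest: dvd_imp_le intro: Suc_leI dvd_pos_nat)
    finally show "(\<Sum>d | d dvd n. mangoldt d) = (\<Sum>d=1..N. if d dvd n then mangoldt d else (0::real))" by simp
  qed
  also have "\<dots> = (\<Sum>d=1..N. \<Sum>n=1..N. if d dvd n then mangoldt d else 0)"
    by (rule sum.swap)
  also have "\<dots> = (\<Sum>d=1..N. mangoldt d * real (card {n\<in>{1..N}. d dvd n}))"
    by (intro sum.cong refl) (simp add: sum.inter_filter[symmetric])
  also have "\<dots> = (\<Sum>d=1..N. mangoldt d * real (N div d))"
    by (intro sum.cong refl) (subst card_multiples, auto)
  finally show ?thesis .
qed

text \<open>In \<open>ln (2 * n choose n)\<close> the coefficient of \<open>mangoldt d\<close> is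
  \<open>2 * n div d - 2 * (n div d)\<close>, never negative and at least 1 for
  \<open>n < d \<le> 2 * n\<close>; the central binomial coefficient is at most 4^n.\<close>

lemma chebyshev_psi_double_diff: "chebyshev_psi (2 * n) - chebyshev_psi n \<le> 2 * real n * ln 2"
proof -
  have "{1..2*n} = {1..n} \<union> {n<..2*n}" by auto
  hence "chebyshev_psi (2 * n) - chebyshev_psi n = (\<Sum>d\<in>{n<..2*n}. mangoldt d)"
    unfolding chebyshev_psi_def by (simp only:) (subst sum.union_disjoint, auto)
  also have "\<dots> \<le> (\<Sum>d\<in>{n<..2*n}. mangoldt d * (real (2 * n div d) - 2 * real (n div d)))"
  proof (intro sum_mono)
    fix d assume d: "d \<in> {n<..2*n}"
    have "2 * n div d \<ge> 1" using d by (simp add: Suc_le_eq div_greater_zero_iff)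
    moreover have "n div d = 0" using d by simp
    ultimately have "1 \<le> real (2 * n div d) - 2 * real (n div d)" by simp
    from mult_left_mono[OF this mangoldt_nonneg[of d]]
    show "mangoldt d \<le> mangoldt d * (real (2 * n div d) - 2 * real (n div d))" by simp
  qed
  also have "\<dots> \<le> (\<Sum>d\<in>{1..2*n}. mangoldt d * (real (2 * n div d) - 2 * real (n div d)))"
  proof (intro sum_mono2)
    fix d assume "d \<in> {1..2*n} - {n<..2*n}"
    have "2 * (n div d) \<le> 2 * n div d"
    proof (cases "d = 0")
      case False
      have "n div d * d \<le> n" by simp
      hence "2 * (n div d) * d \<le> 2 * n" by (simp add: mult.assoc)
      thus ?thesis using False by (subst less_eq_div_iff_mult_less_eq) auto
    qed auto
    hence "2 * real (n div d) \<le> real (2 * n div d)"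
      by (metis of_nat_le_iff of_nat_mult of_nat_numeral)
    thus "0 \<le> mangoldt d * (real (2 * n div d) - 2 * real (n div d))"
      using mangoldt_nonneg by simp
  qed auto
  also have "\<dots> = ln (fact (2 * n)) - 2 * (\<Sum>d=1..2*n. mangoldt d * real (n div d))"
    unfolding ln_fact_eq_sum_mangoldt by (simp add: sum_subtractf sum_distrib_left algebra_simps)
  also have "(\<Sum>d=1..2*n. mangoldt d * real (n div d)) = ln (fact n)"
    unfolding ln_fact_eq_sum_mangoldt by (intro sum.mono_neutral_right) auto
  also have "ln (fact (2 * n)) - 2 * ln (fact n :: real) = ln (real (2 * n choose n))"
    by (simp add: binomial_fact ln_div ln_mult)
  also have "\<dots> \<le> ln (2 ^ (2 * n))"
  proof (subst ln_le_cancel_iff)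
    have "(2 * n choose n) \<le> 2 ^ (2 * n)" by (rule binomial_le_pow2)
    thus "real (2 * n choose n) \<le> 2 ^ (2 * n)" by (metis of_nat_le_iff of_nat_numeral of_nat_power)
  qed auto
  finally show ?thesis by (simp add: ln_realpow)
qed

text \<open>Halving induction. The constant is dictated by the odd case
  \<open>n = 2 * m + 1\<close>, where \<open>4 * m\<close> for the half, \<open>2 * m\<close> for
  the doubling step and \<open>ln n \<le> n - 1 = 2 * m\<close> add up to
  \<open>8 * m\<close>.\<close>

lemma chebyshev_psi_le: "chebyshev_psi n \<le> 4 * real n"
proof (induction n rule: less_induct)
  case (less n)
  show ?case
  proof (cases "n = 0")
    case True thus ?thesis by (simp add: chebyshev_psi_def)
  next
    case n: False
    show ?thesis
    proof (cases "even n")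
      case True
      then obtain m where m: "n = 2 * m" by blast
      have "chebyshev_psi m \<le> 4 * real m" using n m by (intro less) auto
      moreover have "2 * real m * ln 2 \<le> 2 * real m * 1" using ln_2_less_1 by (intro mult_left_mono) auto
      ultimately show ?thesis using chebyshev_psi_double_diff[of m] m by simp
    next
      case False
      then obtain m where m: "n = Suc (2 * m)" by (metis oddE Suc_eq_plus1)
      have 1: "chebyshev_psi m \<le> 4 * real m" using n m by (intro less) auto
      have 2: "2 * real m * ln 2 \<le> 2 * real m * 1" using ln_2_less_1 by (intro mult_left_mono) auto
      have "mangoldt n \<le> ln (real n)" using n by (intro mangoldt_le) auto
      also have "\<dots> \<le> real n - 1" using n by (intro ln_le_minus_one) auto
      finally show ?thesis using chebyshev_psi_double_diff[of m] 1 2 chebyshev_psi_Suc[of "2*m"] m by simp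
    qed
  qed
qed

text \<open>
  For \<open>Re s > 1\<close> the second half of the term telescopes, so that \<open>(s - 1) \<zeta>(s)\<close> is \<open>1\<close> plus the sum of
  these terms over \<open>n \<ge> 1\<close>. The sum converges in the half-plane \<open>Re s > 0\<close>, which gives the continuation.
\<close>
definition zterm :: "nat \<Rightarrow> complex \<Rightarrow> complex" where
  "zterm n s = (s - 1) * of_nat n powr (-s) + of_nat (Suc n) powr (1 - s) - of_nat n powr (1 - s)"

text \<open>\<open>zterm n s\<close> is the increment over [n, n+1] of a function with derivative
  \<open>(s - 1) * (n powr (-s) - x powr (-s))\<close>, and this derivative is itself a difference.
  Two mean value bounds thus gain a full factor 1/n over the single terms, which moves the
  half-plane of convergence to the left by one.\<close>

lemma norm_zterm_le:
  assumes n: "n \<ge> 1" and s: "Re s \<ge> -1"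
  shows "norm (zterm n s) \<le> norm (s - 1) * norm s * real n powr (- 1 - Re s)"
proof -
  have eq1: "- 1 - Re s = - Re s - 1" by simp
  define S where "S = closed_segment (of_nat n :: complex) (of_nat (Suc n))"
  have S: "\<exists>t. x = of_real t \<and> real n \<le> t \<and> t \<le> real n + 1" if "x \<in> S" for x
  proof -
    from that obtain u where u: "0 \<le> u" "u \<le> 1" "x = (1 - u) *\<^sub>R of_nat n + u *\<^sub>R of_nat (Suc n)"
      by (auto simp: S_def closed_segment_def)
    hence "x = of_real (real n + u)" by (simp add: scaleR_conv_of_real algebra_simps)
    thus ?thesis using u by (intro exI[of _ "real n + u"]) auto
  qed
  have nS: "of_nat n \<in> S" "of_nat (Suc n) \<in> S" by (auto simp: S_def)
  have nonpos: "x \<notin> \<real>\<^sub>\<le>\<^sub>0" if "x \<in> S" for x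
    using S[OF that] n by auto
  have d1: "norm (x powr (-s) - of_nat n powr (-s)) \<le> (norm s * real n powr (- 1 - Re s)) * norm (x - of_nat n)" if x: "x \<in> S" for x
  proof (rule field_differentiable_bound[where S = S and f' = "\<lambda>x. - s * x powr (- s - 1)"])
    show "convex S" by (simp add: S_def)
    fix z assume z: "z \<in> S"
    show "((\<lambda>x. x powr (-s)) has_field_derivative - s * z powr (- s - 1)) (at z within S)"
      using nonpos[OF z] by (auto intro!: derivative_eq_intros)
    obtain t where t: "z = of_real t" "real n \<le> t" using S[OF z] by auto
    have "norm (z powr (-s-1)) = t powr (-Re s - 1)"
      using t n by (subst norm_powr_real_powr) auto
    also have "\<dots> \<le> real n powr (- Re s - 1)" using t n s by (intro powr_mono2') auto
    finally have "norm (z powr (-s-1)) \<le> real n powr (- 1 - Re s)" by (simp only: eq1)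
    thus "norm (- s * z powr (- s - 1)) \<le> norm s * real n powr (- 1 - Re s)"
      by (simp add: norm_mult mult_left_mono)
  qed (use x nS in auto)
  define f where "f = (\<lambda>x::complex. x powr (1 - s) + (s - 1) * of_nat n powr (-s) * x)"
  have "norm (f (of_nat (Suc n)) - f (of_nat n)) \<le> (norm (s - 1) * (norm s * real n powr (- 1 - Re s))) * norm (of_nat (Suc n) - of_nat n :: complex)"
  proof (rule field_differentiable_bound[where S = S and f' = "\<lambda>x. (s - 1) * (of_nat n powr (-s) - x powr (-s))"])
    show "convex S" by (simp add: S_def)
    fix z assume z: "z \<in> S"
    show "(f has_field_derivative (s - 1) * (of_nat n powr (-s) - z powr (-s))) (at z within S)"
      unfolding f_def using nonpos[OF z] by (auto intro!: derivative_eq_intros simp: algebra_simps)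
    have "norm (z - of_nat n) \<le> 1"
    proof -
      obtain t where t: "z = of_real t" "real n \<le> t" "t \<le> real n + 1" using S[OF z] by auto
      have "z - of_nat n = of_real (t - real n)" using t by simp
      thus ?thesis using t by (simp only: norm_of_real)
    qed
    hence "(norm s * real n powr (- 1 - Re s)) * norm (z - of_nat n) \<le> (norm s * real n powr (- 1 - Re s)) * 1"
      by (intro mult_left_mono) auto
    with d1[OF z] show "norm ((s - 1) * (of_nat n powr (-s) - z powr (-s))) \<le> norm (s - 1) * (norm s * real n powr (- 1 - Re s))"
      by (simp add: norm_mult norm_minus_commute mult_left_mono)
  qed (use nS in auto)
  also have "f (of_nat (Suc n)) - f (of_nat n) = zterm n s"
    by (simp add: f_def zterm_def algebra_simps)
  finally show ?thesis by (simp add: mult.assoc)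
qed

section \<open>Holomorphic functions defined by locally dominated series\<close>

lemma summable_series_holomorphic:
  fixes f :: "nat \<Rightarrow> complex \<Rightarrow> complex"
  assumes S: "open S" and f: "\<And>n. f n holomorphic_on S"
    and bd: "\<And>x. x \<in> S \<Longrightarrow> \<exists>d>0. \<exists>h::nat \<Rightarrow> real. summable h \<and> (\<forall>n. \<forall>y\<in>ball x d \<inter> S. norm (f n y) \<le> h n)"
  obtains g where "g holomorphic_on S" "\<And>x. x \<in> S \<Longrightarrow> (\<lambda>n. f n x) sums g x"
    "\<And>x. x \<in> S \<Longrightarrow> (\<lambda>n. deriv (f n) x) sums deriv g x"
proof -
  have "\<exists>g g'. \<forall>x \<in> S. ((\<lambda>n. f n x) sums g x) \<and> ((\<lambda>n. deriv (f n) x) sums g' x) \<and> (g has_field_derivative g' x) (at x)"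
  proof (rule series_and_derivative_comparison_local[OF S])
    show "(f n has_field_derivative deriv (f n) x) (at x)" if "x \<in> S" for n x
      using holomorphic_derivI[OF f S that] .
    show "\<exists>d h. 0 < d \<and> summable h \<and> (\<forall>\<^sub>F n in sequentially. \<forall>y\<in>ball x d \<inter> S. norm (f n y) \<le> h n)" if "x \<in> S" for x
      using bd[OF that] by (auto intro!: always_eventually)
  qed
  then obtain g g' where g: "\<And>x. x \<in> S \<Longrightarrow> (\<lambda>n. f n x) sums g x" "\<And>x. x \<in> S \<Longrightarrow> (\<lambda>n. deriv (f n) x) sums g' x"
     "\<And>x. x \<in> S \<Longrightarrow> (g has_field_derivative g' x) (at x)" by blast
  have "g holomorphic_on S" using g(3) S by (auto simp: holomorphic_on_open)
  moreover have "deriv g x = g' x" if "x \<in> S" for x using g(3)[OF that] by (rule DERIV_imp_deriv)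
  ultimately show ?thesis using g that by metis
qed

text \<open>Used with constant coefficients (\<open>m = 0\<close>) to continue zeta, and with
  \<open>chebyshev_psi\<close> (\<open>m = 1\<close>) for the correction term in an Abel summation.
  Growth n^m of the coefficients shifts the half-plane by exactly \<open>m\<close>.\<close>

lemma zterm_series:
  assumes c: "\<And>n. n \<ge> 1 \<Longrightarrow> norm (c n) \<le> C * real n powr m" and m: "m \<ge> 0"
  obtains g where "g holomorphic_on {s. Re s > m}" "\<And>s. Re s > m \<Longrightarrow> (\<lambda>n. c (Suc n) * zterm (Suc n) s) sums g s"
proof -
  have C: "C \<ge> 0" using c[of 1] by (simp add: order_trans[OF norm_ge_zero])
  have "\<exists>g. g holomorphic_on {s. Re s > m} \<and> (\<forall>s\<in>{s. Re s > m}. (\<lambda>n. c (Suc n) * zterm (Suc n) s) sums g s)"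
  proof (rule summable_series_holomorphic[of "{s. Re s > m}" "\<lambda>n s. c (Suc n) * zterm (Suc n) s"])
    show "open {s. Re s > m}" by (rule open_halfspace_Re_gt)
    show "(\<lambda>s. c (Suc n) * zterm (Suc n) s) holomorphic_on {s. Re s > m}" for n
      unfolding zterm_def by (intro holomorphic_intros)
    fix x assume x: "x \<in> {s. Re s > m}"
    define d where "d = (Re x - m) / 2"
    define B where "B = (norm x + d + 1) * (norm x + d)"
    define h where "h = (\<lambda>n. C * B * real (Suc n) powr (-1 - d))"
    have d: "d > 0" using x by (auto simp: d_def)
    have "summable (\<lambda>n. real n powr (-1-d))" using d by (subst summable_real_powr_iff) auto
    hence "summable h" unfolding h_def by (intro summable_mult) (subst summable_Suc_iff)
    moreover have "norm (c (Suc n) * zterm (Suc n) y) \<le> h n" if y: "y \<in> ball x d" "Re y > m" for y n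
    proof -
      have "norm (y - x) \<le> d" using y by (simp add: dist_norm norm_minus_commute)
      hence y': "norm y \<le> norm x + d" using norm_triangle_sub[of y x] by linarith
      have y'': "norm (y - 1) \<le> norm x + d + 1" using y' norm_triangle_ineq4[of y 1] by simp
      have "\<bar>Re (x - y)\<bar> < d" using y abs_Re_le_cmod[of "x - y"] by (simp add: dist_norm)
      hence "Re x - Re y < d" by simp
      moreover have "Re x = m + 2 * d" by (simp add: d_def field_simps)
      ultimately have y3: "Re y \<ge> m + d" by linarith
      have "norm (zterm (Suc n) y) \<le> norm (y - 1) * norm y * real (Suc n) powr (- 1 - Re y)"
        using y m by (intro norm_zterm_le) auto
      also have "\<dots> \<le> B * real (Suc n) powr (-1 - (m + d))"
        unfolding B_def using y' y'' y3 d by (intro mult_mono powr_mono) auto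
      finally have "norm (c (Suc n) * zterm (Suc n) y) \<le> (C * real (Suc n) powr m) * (B * real (Suc n) powr (-1 - (m + d)))"
        unfolding norm_mult using C c[of "Suc n"] by (intro mult_mono) auto
      also have "\<dots> = C * B * (real (Suc n) powr m * real (Suc n) powr (-1 - (m + d)))" by (simp only: mult_ac)
      also have "\<dots> = h n"
        unfolding h_def powr_add[symmetric] by (simp add: algebra_simps)
      finally show ?thesis .
    qed
    ultimately show "\<exists>d>0. \<exists>h::nat \<Rightarrow> real. summable h \<and> (\<forall>n. \<forall>y\<in>ball x d \<inter> {s. m < Re s}. norm (c (Suc n) * zterm (Suc n) y) \<le> h n)"
      using d by (intro exI[of _ d] conjI exI[of _ h]) auto
  qed blast
  thus ?thesis using that by blast
qed

lemma dirichlet_series_holomorphic: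
  fixes c :: "nat \<Rightarrow> real"
  assumes c: "\<And>m. m > 0 \<Longrightarrow> \<exists>C. \<forall>n\<ge>1. \<bar>c n\<bar> \<le> C * real n powr m"
  obtains g where "g holomorphic_on {s. Re s > 1}"
    "\<And>s. Re s > 1 \<Longrightarrow> (\<lambda>n. of_real (c n) * of_nat n powr (-s)) sums g s"
    "\<And>s. Re s > 1 \<Longrightarrow> (\<lambda>n. - of_real (c n * ln (real n)) * of_nat n powr (-s)) sums deriv g s"
    "\<And>s. Re s > 1 \<Longrightarrow> summable (\<lambda>n. norm (of_real (c n) * of_nat n powr (-s) :: complex))"
proof -
  have bd: "\<exists>d>0. \<exists>h::nat \<Rightarrow> real. summable h \<and> (\<forall>n. \<forall>y\<in>ball x d \<inter> {s. Re s > 1}. norm (of_real (c n) * of_nat n powr (-y) :: complex) \<le> h n)"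
    if x: "x \<in> {s. Re s > 1}" for x
  proof -
    \<comment> \<open>One third of the distance to the boundary is lost by moving within the ball,
      one third to the growth of \<open>c\<close>, and the last third keeps the exponent of the
      majorant below -1.\<close>
    define d where "d = (Re x - 1) / 3"
    have d: "d > 0" using x by (auto simp: d_def)
    obtain C where C: "\<And>n. n \<ge> 1 \<Longrightarrow> \<bar>c n\<bar> \<le> C * real n powr d" using c[OF d] by blast
    have C0: "C \<ge> 0" using C[of 1] by (simp add: order_trans[OF abs_ge_zero])
    define h where "h = (\<lambda>n. C * real n powr (-1 - d))"
    have "summable (\<lambda>n. real n powr (-1-d))" using d by (subst summable_real_powr_iff) auto
    hence "summable h" unfolding h_def by (intro summable_mult)
    moreover have "norm (of_real (c n) * of_nat n powr (-y) :: complex) \<le> h n" if y: "y \<in> ball x d" "Re y > 1" for y n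
    proof (cases "n = 0")
      case False
      have "\<bar>Re (x - y)\<bar> < d" using y abs_Re_le_cmod[of "x - y"] by (simp add: dist_norm)
      hence "Re x - Re y < d" by simp
      moreover have "Re x = 1 + 3 * d" by (simp add: d_def field_simps)
      ultimately have y3: "Re y \<ge> 1 + 2 * d" by linarith
      have "norm (of_real (c n) * of_nat n powr (-y) :: complex) = \<bar>c n\<bar> * real n powr (- Re y)"
        by (simp add: norm_mult norm_powr_real_powr)
      also have "\<dots> \<le> (C * real n powr d) * real n powr (-1 - 2 * d)"
        using C C0 y3 False by (intro mult_mono powr_mono) auto
      also have "\<dots> = C * (real n powr d * real n powr (-1 - 2 * d))" by (simp only: mult_ac)
      also have "\<dots> = h n" unfolding h_def powr_add[symmetric] by (rule arg_cong[where f = "\<lambda>t. C * real n powr t"]) simp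
      finally show ?thesis .
    qed (auto simp: h_def)
    ultimately show ?thesis using d by (intro exI[of _ d] conjI exI[of _ h]) auto
  qed
  have hol: "(\<lambda>s. of_real (c n) * of_nat n powr (-s) :: complex) holomorphic_on {s. Re s > 1}" for n
    by (intro holomorphic_intros)
  have der: "deriv (\<lambda>s. of_real (c n) * of_nat n powr (-s)) s = - of_real (c n * ln (real n)) * of_nat n powr (-s)" for n and s :: complex
  proof (cases "n = 0")
    case False
    have "((\<lambda>s. of_real (c n) * of_nat n powr (-s)) has_field_derivative - of_real (c n * ln (real n)) * of_nat n powr (-s)) (at s)"
    proof -
      have eq: "of_nat n powr (-s) = exp (- s * of_real (ln (real n)))" for s :: complex
        using False by (auto simp: powr_def Ln_of_nat)
      show ?thesis
        unfolding eq by (auto intro!: derivative_eq_intros simp: mult_ac)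
    qed
    thus ?thesis by (rule DERIV_imp_deriv)
  qed auto
  obtain g where g: "g holomorphic_on {s. Re s > 1}"
    "\<And>s. s \<in> {s. Re s > 1} \<Longrightarrow> (\<lambda>n. of_real (c n) * of_nat n powr (-s)) sums g s"
    "\<And>s. s \<in> {s. Re s > 1} \<Longrightarrow> (\<lambda>n. deriv (\<lambda>s. of_real (c n) * of_nat n powr (-s)) s) sums deriv g s"
    using summable_series_holomorphic[OF open_halfspace_Re_gt hol bd] by blast
  have "summable (\<lambda>n. norm (of_real (c n) * of_nat n powr (-s) :: complex))" if "Re s > 1" for s
  proof -
    have s: "s \<in> {s. Re s > 1}" using that by simp
    obtain d and h :: "nat \<Rightarrow> real" where "d > 0" "summable h" "\<forall>n. \<forall>y\<in>ball s d \<inter> {s. Re s > 1}. norm (of_real (c n) * of_nat n powr (-y) :: complex) \<le> h n"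
      using bd[OF s] by blast
    thus ?thesis using that by (intro summable_comparison_test[OF _ \<open>summable h\<close>]) auto
  qed
  thus ?thesis using that[of g] g unfolding der by simp
qed

lemma ln_le_powr: "m > 0 \<Longrightarrow> \<bar>ln (real n)\<bar> \<le> 1 / m * real n powr m"
  using ln_powr_bound[of "real n" m] by (cases "n = 0") auto

text \<open>The Dirichlet convolution of \<open>mangoldt\<close> with 1 is \<open>ln\<close>;
  absolute convergence of both series permits regrouping the double series by the product of the
  indices.\<close>

lemma dirichlet_product_mangoldt:
  fixes s :: complex
  assumes "summable (\<lambda>n. norm (of_real (mangoldt n) * of_nat n powr (-s) :: complex))" "(\<lambda>n. of_real (mangoldt n) * of_nat n powr (-s)) sums A"
    and "summable (\<lambda>n. norm (of_nat n powr (-s) :: complex))" "(\<lambda>n. of_nat n powr (-s)) sums B"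
  shows "(\<lambda>n. of_real (ln (real n)) * of_nat n powr (-s)) sums (A * B)"
proof -
  define f where "f = (\<lambda>n. of_real (mangoldt n) * of_nat n powr (-s) :: complex)"
  define g where "g = (\<lambda>n. of_nat n powr (-s) :: complex)"
  have fs: "(f has_sum A) UNIV" unfolding f_def by (rule norm_summable_imp_has_sum[OF assms(1,2)])
  have gs: "(g has_sum B) UNIV" unfolding g_def by (rule norm_summable_imp_has_sum[OF assms(3,4)])
  have "(\<lambda>x. norm (f x)) summable_on UNIV" "(\<lambda>x. norm (g x)) summable_on UNIV"
    unfolding f_def g_def using norm_summable_imp_summable_on[of "\<lambda>n. norm (of_real (mangoldt n) * of_nat n powr (-s) :: complex)"] 
      norm_summable_imp_summable_on[of "\<lambda>n. norm (of_nat n powr (-s) :: complex)"] assms by auto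
  hence "(\<lambda>z. norm (case z of (x, y) \<Rightarrow> f x * g y)) summable_on UNIV \<times> UNIV"
    by (subst Infinite_Sum.abs_summable_on_Sigma_iff)
       (auto simp: norm_mult infsum_cmult_right' abs_mult infsum_nonneg intro!: summable_on_cmult_left summable_on_cmult_right)
  hence sm: "(\<lambda>(x, y). f x * g y) summable_on UNIV \<times> UNIV"
    by (rule Infinite_Sum.abs_summable_summable)
  then obtain T where T: "((\<lambda>(x, y). f x * g y) has_sum T) (UNIV \<times> UNIV)"
    by (auto simp: summable_on_def)
  have "((\<lambda>x. f x * B) has_sum T) UNIV"
    by (rule has_sum_SigmaD[OF T]) (auto intro!: has_sum_cmult_right gs)
  moreover have "((\<lambda>x. f x * B) has_sum A * B) UNIV" by (intro has_sum_cmult_left fs)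
  ultimately have "T = A * B" by (rule has_sum_unique)
  \<comment> \<open>Index 0 contributes nothing because \<open>0 powr w = 0\<close>; it has to go
    before the reindexing divides by an index.\<close>
  have "((\<lambda>(x, y). f x * g y) has_sum T) ({1..} \<times> {1..})"
    using T by (rule has_sum_cong_neutral[THEN iffD1, rotated -1]) (auto simp: f_def g_def)
  also have "?this \<longleftrightarrow> ((\<lambda>(n, d). f d * g (n div d)) has_sum T) (Sigma {1..} (\<lambda>n. {d. d dvd n}))"
    by (rule has_sum_reindex_bij_witness[where i = "\<lambda>(n, d). (d, n div d)" and j = "\<lambda>(a, b). (a * b, a)"])
       (auto simp: Suc_le_eq dvd_div_eq_0_iff intro: Nat.gr0I)
  finally have "((\<lambda>n. of_real (ln (real n)) * g n) has_sum T) {1..}"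
  proof (rule has_sum_SigmaD)
    fix n :: nat assume n: "n \<in> {1..}"
    have "(\<Sum>d | d dvd n. f d * g (n div d)) = (\<Sum>d | d dvd n. of_real (mangoldt d) * g n)"
    proof (rule sum.cong[OF refl])
      fix d assume "d \<in> {d. d dvd n}"
      then obtain m where m: "n = d * m" by auto
      hence "d > 0" "m > 0" using n by (auto intro: Nat.gr0I)
      hence "of_nat n powr (-s) = of_nat d powr (-s) * (of_nat m powr (-s) :: complex)"
        using m powr_times_real[of "of_nat d" "of_nat m" "-s"] by simp
      thus "f d * g (n div d) = of_real (mangoldt d) * g n"
        using m \<open>d > 0\<close> by (simp add: f_def g_def)
    qed
    also have "\<dots> = of_real (\<Sum>d | d dvd n. mangoldt d) * g n"
      by (simp add: sum_distrib_right)
    also have "\<dots> = of_real (ln (real n)) * g n" using n by (subst mangoldt_sum) auto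
    finally show "((\<lambda>d. case (n, d) of (n, d) \<Rightarrow> f d * g (n div d)) has_sum of_real (ln (real n)) * g n) {d. d dvd n}"
      using n by (intro has_sum_finiteI) auto
  qed
  hence "((\<lambda>n. of_real (ln (real n)) * g n) has_sum T) UNIV"
    by (rule has_sum_cong_neutral[THEN iffD1, rotated -1]) (auto simp: Suc_le_eq)
  thus ?thesis using has_sum_imp_sums \<open>T = A * B\<close> unfolding g_def by blast
qed

section \<open>Newman's Tauberian theorem\<close>

text \<open>Cauchy's integral formula without winding numbers. Subtracting \<open>h 0\<close> leaves
  a removable singularity, and \<open>1 / w\<close> is integrated by \<open>Ln w\<close> on the
  right and by \<open>Ln (- w)\<close> on the left half-plane; each half yields
  \<open>\<i> * pi\<close>.\<close>

lemma cauchy_integral_two_half_paths: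
  fixes h :: "complex \<Rightarrow> complex"
  assumes V: "open V" "convex V" "0 \<in> V" and h: "h holomorphic_on V" and R: "R > 0"
    and p1: "valid_path p1" "path_image p1 \<subseteq> V" "path_image p1 \<subseteq> {w. Re w \<ge> 0} - {0}"
      "pathstart p1 = - (\<i> * of_real R)" "pathfinish p1 = \<i> * of_real R"
    and p2: "valid_path p2" "path_image p2 \<subseteq> V" "path_image p2 \<subseteq> {w. Re w \<le> 0} - {0}"
      "pathstart p2 = \<i> * of_real R" "pathfinish p2 = - (\<i> * of_real R)"
  shows "contour_integral p1 (\<lambda>w. h w / w) + contour_integral p2 (\<lambda>w. h w / w) = 2 * of_real pi * \<i> * h 0"
proof -
  define k where "k = (\<lambda>w. if w = 0 then deriv h 0 else (h w - h 0) / (w - 0))"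
  have k: "k holomorphic_on V"
    unfolding k_def by (rule pole_lemma_open[OF h V(1)])
  have val: "valid_path (p1 +++ p2)"
    using p1 p2 by (intro valid_path_join) auto
  have "(k has_contour_integral 0) (p1 +++ p2)"
    using p1 p2 val by (intro Cauchy_theorem_convex_simple[OF k V(2)])
      (auto simp: path_image_join)
  hence k0: "contour_integral (p1 +++ p2) k = 0"
    by (rule contour_integral_unique)
  have hol: "(\<lambda>w. h w / w) holomorphic_on V - {0}" "(\<lambda>w. h 0 / w) holomorphic_on V - {0}"
    by (intro holomorphic_intros holomorphic_on_subset[OF h]; auto)+
  have ci: "(\<lambda>w. h w / w) contour_integrable_on p" "(\<lambda>w. h 0 / w) contour_integrable_on p"
    if "p = p1 \<or> p = p2" for p
    using that p1 p2 V(1)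
    by (intro contour_integrable_holomorphic_simple[OF hol(1)] contour_integrable_holomorphic_simple[OF hol(2)]; force)+
  have kp: "contour_integral p k = contour_integral p (\<lambda>w. h w / w) - contour_integral p (\<lambda>w. h 0 / w)"
    if "p = p1 \<or> p = p2" for p
  proof -
    have "contour_integral p k = contour_integral p (\<lambda>w. h w / w - h 0 / w)"
      using that p1(3) p2(3) by (intro contour_integral_eq) (auto simp: k_def diff_divide_distrib)
    also have "\<dots> = contour_integral p (\<lambda>w. h w / w) - contour_integral p (\<lambda>w. h 0 / w)"
      using ci[OF that] by (rule contour_integral_diff)
    finally show ?thesis .
  qed
  have kint: "k contour_integrable_on p1" "k contour_integrable_on p2"
    using p1 p2 V(1) by (intro contour_integrable_holomorphic_simple[OF k]; force)+
  have LnR: "Ln (\<i> * of_real R) = of_real (ln R) + \<i> * of_real (pi/2)"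
            "Ln (- (\<i> * of_real R)) = of_real (ln R) - \<i> * of_real (pi/2)"
    using R Ln_times_of_real[of R "\<i>"] Ln_times_of_real[of R "-\<i>"] Ln_of_real[OF R]
    by (auto simp: mult.commute)
  have "((\<lambda>w. h 0 * inverse w) has_contour_integral (h 0 * Ln (pathfinish p1) - h 0 * Ln (pathstart p1))) p1"
  proof (rule contour_integral_primitive[where S = "{w. Re w \<ge> 0} - {0}"])
    fix x :: complex assume x: "x \<in> {w. 0 \<le> Re w} - {0}"
    have "x \<notin> \<real>\<^sub>\<le>\<^sub>0"
      using x by (auto simp: complex_nonpos_Reals_iff complex_eq_iff)
    thus "((\<lambda>x. h 0 * Ln x) has_field_derivative h 0 * inverse x) (at x within {w. 0 \<le> Re w} - {0})"
      by (auto intro!: derivative_eq_intros)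
  qed (use p1 in auto)
  hence 1: "contour_integral p1 (\<lambda>w. h 0 / w) = h 0 * (\<i> * of_real pi)"
    by (subst contour_integral_unique[where i = "h 0 * Ln (pathfinish p1) - h 0 * Ln (pathstart p1)"])
       (auto simp: p1 LnR field_simps)
  have "((\<lambda>w. h 0 * inverse w) has_contour_integral (h 0 * Ln (- pathfinish p2) - h 0 * Ln (- pathstart p2))) p2"
  proof (rule contour_integral_primitive[where S = "{w. Re w \<le> 0} - {0}"])
    fix x :: complex assume x: "x \<in> {w. Re w \<le> 0} - {0}"
    have "- x \<notin> \<real>\<^sub>\<le>\<^sub>0"
      using x by (auto simp: complex_nonpos_Reals_iff complex_eq_iff)
    thus "((\<lambda>x. h 0 * Ln (- x)) has_field_derivative h 0 * inverse x) (at x within {w. Re w \<le> 0} - {0})"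
      using x by (auto intro!: derivative_eq_intros simp: field_simps)
  qed (use p2 in auto)
  hence 2: "contour_integral p2 (\<lambda>w. h 0 / w) = h 0 * (\<i> * of_real pi)"
    by (subst contour_integral_unique[where i = "h 0 * Ln (- pathfinish p2) - h 0 * Ln (- pathstart p2)"])
       (auto simp: p2 LnR field_simps)
  show ?thesis
    using k0 kp[of p1] kp[of p2] 1 2 p1 p2 kint
    by (simp add: algebra_simps)
qed

text \<open>Comparison with the integral of x^(s-1). For \<open>s \<ge> 1\<close> the integrand
  increases and the separate last summand covers the overshoot; for \<open>s < 1\<close> it
  decreases, and every summand lies below the integral over the preceding unit interval.\<close>

lemma sum_powr_le:
  fixes s :: real
  assumes "s > 0"
  shows "(\<Sum>n=1..N. real n powr (s - 1)) \<le> real N powr s / s + real N powr (s - 1)"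
proof (cases "s \<ge> 1")
  case True
  have "(\<Sum>n=1..N. real n powr (s - 1)) \<le> real N powr s / s + real N powr (s - 1)" if "N \<ge> 1"
    using that
  proof (induction N rule: dec_induct)
    case base
    then show ?case using assms by simp
  next
    case (step N)
    have "real N powr (s - 1) \<le> (real (Suc N) powr s - real N powr s) / s"
    proof -
      have "\<exists>z>real N. z < real (Suc N) \<and> real (Suc N) powr s - real N powr s = (real (Suc N) - real N) * (s * z powr (s - 1))"
        using step(1) by (intro MVT2) (auto intro!: derivative_eq_intros)
      then obtain z where z: "z > real N" "z < real (Suc N)" 
        "real (Suc N) powr s - real N powr s = (real (Suc N) - real N) * (s * z powr (s - 1))"
        by blast
      have "real N powr (s - 1) \<le> z powr (s - 1)"
        using z True by (intro powr_mono2) auto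
      thus ?thesis using z assms by (simp add: field_simps)
    qed
    thus ?case using step.IH
      by (simp add: diff_divide_distrib)
  qed
  thus ?thesis
    by (cases "N = 0") auto
next
  case False
  have "(\<Sum>n=1..N. real n powr (s - 1)) \<le> real N powr s / s"
  proof (induction N)
    case 0
    then show ?case using assms by simp
  next
    case (Suc N)
    have "real (Suc N) powr (s - 1) \<le> (real (Suc N) powr s - real N powr s) / s"
    proof (cases "N = 0")
      case True
      thus ?thesis using assms False by (simp add: field_simps)
    next
      case N: False
      have "\<exists>z>real N. z < real (Suc N) \<and> real (Suc N) powr s - real N powr s = (real (Suc N) - real N) * (s * z powr (s - 1))"
        using N by (intro MVT2) (auto intro!: derivative_eq_intros)
      then obtain z where z: "z > real N" "z < real (Suc N)" 
        "real (Suc N) powr s - real N powr s = (real (Suc N) - real N) * (s * z powr (s - 1))"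
        by blast
      have "real (Suc N) powr (s - 1) \<le> z powr (s - 1)"
        using z False N by (intro powr_mono2') auto
      thus ?thesis using z assms by (simp add: field_simps)
    qed
    thus ?case using Suc.IH
      by (simp add: diff_divide_distrib)
  qed
  moreover have "real N powr (s - 1) \<ge> 0" by simp
  ultimately show ?thesis by linarith
qed

lemma sum_powr_tail_le:
  fixes s :: real
  assumes "s > 0" "N \<ge> 1"
  shows "(\<Sum>n=Suc N..M. real n powr (-1 - s)) \<le> real N powr (-s) / s"
proof -
  have "(\<Sum>n=Suc N..M. real n powr (-1 - s)) \<le> (real N powr (-s) - real M powr (-s)) / s" if "N \<le> M"
    using that
  proof (induction M rule: dec_induct)
    case (step M)
    have "real (Suc M) powr (-1-s) \<le> (real M powr (-s) - real (Suc M) powr (-s)) / s"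
    proof -
      have "\<exists>z>real M. z < real (Suc M) \<and> real (Suc M) powr (-s) - real M powr (-s) = (real (Suc M) - real M) * ((-s) * z powr (-s - 1))"
        using step(1) assms by (intro MVT2) (auto intro!: derivative_eq_intros)
      then obtain z where z: "z > real M" "z < real (Suc M)" 
        "real (Suc M) powr (-s) - real M powr (-s) = (real (Suc M) - real M) * ((-s) * z powr (-s - 1))"
        by blast
      have "real (Suc M) powr (-s-1) \<le> z powr (-s-1)"
        using z assms step by (intro powr_mono2') auto
      hence "s * real (Suc M) powr (-s-1) \<le> s * z powr (-s-1)"
        using assms by (intro mult_left_mono) auto
      hence "s * real (Suc M) powr (-s-1) \<le> real M powr (-s) - real (Suc M) powr (-s)"
        using z(3) by simp
      moreover have "-1-s = -s-1" by simp
      ultimately show ?thesis using assms by (simp only:) (simp add: pos_le_divide_eq mult.commute)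
    qed
    thus ?case using step
      by (simp add: diff_divide_distrib)
  qed auto
  moreover have "(real N powr (-s) - real M powr (-s)) / s \<le> real N powr (-s) / s"
    using assms by (simp add: divide_right_mono)
  ultimately show ?thesis
    using assms by (cases "N \<le> M") force+
qed

text \<open>
  Newman's contour argument: on the circle \<open>|w| = R\<close> the kernel \<open>N^w (1/w + w/R\<^sup>2)\<close> has modulus
  \<open>2 N^(Re w) |Re w| / R\<^sup>2\<close>, and the factor \<open>|Re w|\<close> compensates the singularity of the bounds for the
  partial sums and the tails.
\<close>
theorem newman_tauberian:
  fixes a :: "nat \<Rightarrow> complex"
  assumes C: "\<And>n. norm (a n) \<le> C"
    and U: "open U" "{w. Re w \<ge> 0} \<subseteq> U" and G: "G holomorphic_on U"
    and sums: "\<And>w. Re w > 0 \<Longrightarrow> (\<lambda>n. a n * of_nat n powr (-1 - w)) sums G w"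
  shows "(\<lambda>N. \<Sum>n=1..N. a n / of_nat n) \<longlonglongrightarrow> G 0"
proof -
  have C0: "C \<ge> 0" using C[of 0] norm_ge_zero order_trans by blast
  define Sn where "Sn = (\<lambda>N w. \<Sum>n=1..N. a n * of_nat n powr (-1 - w))"
  have Sn0: "Sn N 0 = (\<Sum>n=1..N. a n / of_nat n)" for N
    unfolding Sn_def by (intro sum.cong) (auto simp: powr_minus field_simps)
  have Sn_diff: "Sn M w - Sn N w = (\<Sum>n=Suc N..M. a n * of_nat n powr (-1 - w))" if "N \<le> M" for M N w
  proof -
    have "{1..M} = {1..N} \<union> {Suc N..M}" using that by auto
    hence "Sn M w = Sn N w + (\<Sum>n=Suc N..M. a n * of_nat n powr (-1 - w))"
      unfolding Sn_def by (simp only:) (rule sum.union_disjoint, auto)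
    thus ?thesis by simp
  qed
  have nrm: "norm (a n * of_nat n powr (-1 - w)) \<le> C * real n powr (-1 - Re w)" for n w
    using C[of n] by (cases "n = 0") (auto simp: norm_mult norm_powr_real_powr intro!: mult_right_mono)
  have tail: "norm (G w - Sn N w) \<le> C * (real N powr (- Re w) / Re w)" if "Re w > 0" "N \<ge> 1" for w N
  proof -
    have "(\<lambda>M. \<Sum>n<M. a n * of_nat n powr (-1 - w)) \<longlonglongrightarrow> G w"
      using sums[OF that(1)] by (simp add: sums_def)
    hence "(\<lambda>M. \<Sum>n<Suc M. a n * of_nat n powr (-1 - w)) \<longlonglongrightarrow> G w"
      by (rule LIMSEQ_Suc)
    moreover have "(\<Sum>n<Suc M. a n * of_nat n powr (-1 - w)) = Sn M w" for M
      unfolding Sn_def by (intro sum.mono_neutral_right) auto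
    ultimately have "(\<lambda>M. Sn M w - Sn N w) \<longlonglongrightarrow> G w - Sn N w"
      by (intro tendsto_intros) simp
    moreover have "norm (Sn M w - Sn N w) \<le> C * (real N powr (- Re w) / Re w)" if "M \<ge> N" for M
    proof -
      have "norm (Sn M w - Sn N w) \<le> (\<Sum>n=Suc N..M. C * real n powr (-1 - Re w))"
        unfolding Sn_diff[OF that] using nrm by (intro sum_norm_le) auto
      also have "\<dots> \<le> C * (real N powr (- Re w) / Re w)"
        unfolding sum_distrib_left[symmetric]
        using sum_powr_tail_le[OF \<open>Re w > 0\<close> \<open>N \<ge> 1\<close>] C0 by (intro mult_left_mono) auto
      finally show ?thesis .
    qed
    ultimately show ?thesis
      by (intro Lim_norm_ubound[where f = "\<lambda>M. Sn M w - Sn N w" and net = sequentially])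
         (auto simp: eventually_sequentially)
  qed
  have head: "norm (Sn N w) \<le> C * (real N powr s / s + real N powr (s - 1))" if "s > 0" "s = - Re w" for w N s
  proof -
    have eq: "-1 - Re w = s - 1" using that by simp
    have "norm (Sn N w) \<le> (\<Sum>n=1..N. C * real n powr (s - 1))"
      unfolding Sn_def using nrm[of _ w] unfolding eq by (intro sum_norm_le)
    also have "\<dots> \<le> C * (real N powr s / s + real N powr (s - 1))"
      unfolding sum_distrib_left[symmetric] using sum_powr_le[OF that(1), of N] C0 by (intro mult_left_mono) auto
    finally show ?thesis .
  qed
  have Sn_hol: "Sn N holomorphic_on UNIV" for N
    unfolding Sn_def by (intro holomorphic_intros) auto
  show ?thesis
    unfolding Sn0[symmetric]
  proof (rule LIMSEQ_I)
    fix e :: real assume e: "e > 0"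
    \<comment> \<open>After division by \<open>2 * pi\<close> the two semicircles together
      contribute at most \<open>2 * C / R\<close>, up to a term that vanishes as N grows; this
      choice makes that \<open>e / 4\<close>.\<close>
    define R where "R = max 1 (8 * C / e)"
    have R: "R \<ge> 1" "2 * C / R \<le> e / 4"
      using e C0 by (auto simp: R_def max_def field_simps)
    define seg where "seg = closed_segment (- (\<i> * of_real (R+1))) (\<i> * of_real (R+1))"
    have seg: "\<i> * of_real t \<in> seg" if "\<bar>t\<bar> \<le> R + 1" for t
    proof -
      define u where "u = (t+R+1)/(2*(R+1))"
      have u: "u \<ge> 0" "u \<le> 1" "2 * (R + 1) * u = t + R + 1"
        using that R by (auto simp: u_def field_simps)
      have "t = - ((1 - u) * (R + 1)) + u * (R + 1)" using u(3) by (simp add: algebra_simps)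
      hence "\<i> * complex_of_real t = (1 - u) *\<^sub>R (- (\<i> * of_real (R+1))) + u *\<^sub>R (\<i> * of_real (R+1))"
        by (simp add: complex_eq_iff)
      thus ?thesis using u unfolding seg_def closed_segment_def by blast
    qed
    have "seg \<subseteq> {w. Re w = 0}"
      by (auto simp: seg_def closed_segment_def)
    hence "seg \<subseteq> U" using U by force
    \<comment> \<open>By compactness one width works along the whole segment. The segment reaches
      beyond +-iR, so that the open convex set \<open>V\<close> below contains the contour including
      its corners.\<close>
    then obtain d1 where d1: "d1 > 0" "(\<Union>x\<in>seg. ball x d1) \<subseteq> U"
      using compact_subset_open_imp_ball_epsilon_subset[of seg U] U(1) by (auto simp: seg_def)
    define V where "V = {w. - min d1 1 < Re w} \<inter> {w. Im w < R + 1} \<inter> {w. - (R + 1) < Im w}"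
    have V: "open V" "convex V" "0 \<in> V"
      unfolding V_def using d1(1) R
      by (auto intro!: open_Int convex_Int open_halfspace_Re_gt open_halfspace_Im_lt open_halfspace_Im_gt
            convex_halfspace_Re_gt convex_halfspace_Im_lt convex_halfspace_Im_gt)
    have "V \<subseteq> U"
    proof
      fix w assume w: "w \<in> V"
      show "w \<in> U"
      proof (cases "Re w \<ge> 0")
        case False
        have "dist (\<i> * of_real (Im w)) w < d1"
          using w False by (auto simp: V_def dist_norm complex_norm cmod_def)
        moreover have "\<i> * of_real (Im w) \<in> seg" using w by (intro seg) (auto simp: V_def)
        ultimately have "w \<in> (\<Union>x\<in>seg. ball x d1)" by (intro UN_I[of "\<i> * of_real (Im w)"]) auto
        thus ?thesis using d1(2) by blast
      qed (use U in auto)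
    qed
    define d0 where "d0 = min d1 1 / 2"
    have d0: "d0 > 0" "d0 < min d1 1" using d1 by (auto simp: d0_def)
    define rect where "rect = cbox (Complex (-d0) (-R)) (Complex 0 R)"
    have rect: "w \<in> rect \<longleftrightarrow> -d0 \<le> Re w \<and> Re w \<le> 0 \<and> -R \<le> Im w \<and> Im w \<le> R" for w
      by (auto simp: rect_def cbox_complex_eq in_cbox_complex_iff)
    have rectV: "rect \<subseteq> V" using d0 R by (auto simp: rect V_def)
    have "compact (G ` rect)"
      using holomorphic_on_imp_continuous_on[OF G] rectV \<open>V \<subseteq> U\<close>
      by (intro compact_continuous_image) (auto simp: rect_def intro: continuous_on_subset)
    then obtain M where M: "M > 0" "\<And>w. w \<in> rect \<Longrightarrow> norm (G w) \<le> M"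
      using compact_imp_bounded bounded_pos by (metis imageI)
    \<comment> \<open>The two horizontal sides contribute \<open>8 * M * d / R\<close> in total,
      hence at most \<open>2 * M * d / R \<le> e / 4\<close> after division by
      \<open>2 * pi\<close>, as \<open>8 \<le> 4 * pi\<close>. The vertical side decays with N
      because it lies strictly to the left of the axis.\<close>
    define d where "d = min d0 (R * e / (8 * M))"
    have d: "d > 0" "d \<le> d0" "M * d / R \<le> e / 8"
      using d0 e M R by (auto simp: d_def min_def field_simps)
    have "(\<lambda>N. C / real N + 2 * M * R * real N powr (-d) / d) \<longlonglongrightarrow> 0 + 2 * M * R * 0 / d"
      by (intro tendsto_intros tendsto_neg_powr filterlim_real_sequentially d
            tendsto_divide_0[OF tendsto_const] filterlim_at_top_imp_at_infinity) (use d in auto)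
    hence ev: "eventually (\<lambda>N. C / real N + 2 * M * R * real N powr (-d) / d < e / 2) sequentially"
      by (rule order_tendstoD) (use e in auto)
    have "eventually (\<lambda>N. norm (Sn N 0 - G 0) < e) sequentially"
      using ev eventually_ge_at_top[of 1]
    proof eventually_elim
      case (elim N)
      define P where "P = (\<lambda>w::complex. of_nat N powr w)"
      have P0: "P 0 = 1" using elim by (simp add: P_def)
      have normP: "norm (P w) = real N powr Re w" for w
        unfolding P_def using elim by (subst norm_powr_real_powr) auto
      define k where "k = (\<lambda>w::complex. 1 + w\<^sup>2 / of_real (R\<^sup>2))"
      have k0: "k 0 = 1" by (simp add: k_def)
      have kbd: "norm (k w / w) = 2 * \<bar>Re w\<bar> / R\<^sup>2" if "norm w = R" for w
      proof -
        have "w \<noteq> 0" using that R by auto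
        have "of_real (R\<^sup>2) = w * cnj w"
          using that complex_norm_square by metis
        hence "k w = (w + cnj w) * w / of_real (R\<^sup>2)"
          using \<open>w \<noteq> 0\<close> by (simp add: k_def divide_simps power2_eq_square ring_distribs)
        hence "k w / w = of_real (2 * Re w) / of_real (R\<^sup>2)"
          using \<open>w \<noteq> 0\<close> complex_add_cnj[of w] by simp
        hence "norm (k w / w) = \<bar>2 * Re w\<bar> / \<bar>R\<^sup>2\<bar>"
          by (simp only: norm_divide norm_of_real)
        thus ?thesis by (simp add: abs_mult)
      qed
      have hols: "P holomorphic_on X" "k holomorphic_on X" for X
        unfolding P_def k_def using R by (auto intro!: holomorphic_intros)
      define A where "A = part_circlepath 0 R (-pi/2) (pi/2)"
      define B where "B = part_circlepath 0 R (pi/2) (3*pi/2)"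
      define L where "L = linepath (\<i> * of_real R) (Complex (-d) R) +++ 
          (linepath (Complex (-d) R) (Complex (-d) (-R)) +++ linepath (Complex (-d) (-R)) (- (\<i> * of_real R)))"
      have cisR: "cis (pi / 2) = \<i>" "cis (- (pi/2)) = - \<i>" "cis (3 * pi / 2) = - \<i>"
      proof -
        show "cis (pi / 2) = \<i>" "cis (- (pi/2)) = - \<i>" by (auto simp: complex_eq_iff)
        have "cis (3 * pi / 2) = cis (pi + pi/2)" by (simp add: field_simps)
        also have "\<dots> = - \<i>" by (subst cis_mult[symmetric]) (auto simp: complex_eq_iff)
        finally show "cis (3 * pi / 2) = - \<i>" .
      qed
      have ends: "pathstart A = - (\<i> * of_real R)" "pathfinish A = \<i> * of_real R"
           "pathstart B = \<i> * of_real R" "pathfinish B = - (\<i> * of_real R)"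
           "pathstart L = \<i> * of_real R" "pathfinish L = - (\<i> * of_real R)"
        using cisR by (auto simp: A_def B_def L_def cis_conv_exp mult.commute)
      have valid: "valid_path A" "valid_path B" "valid_path L"
        by (auto simp: A_def B_def L_def intro!: valid_path_join)
      have A_im: "norm w = R \<and> Re w \<ge> 0" if "w \<in> path_image A" for w
      proof -
        have seg_eq: "closed_segment (-pi/2) (pi/2) = {-pi/2..pi/2}"
          using pi_gt_zero by (simp add: closed_segment_eq_real_ivl)
        have "w \<in> (\<lambda>t. 0 + of_real R * cis t) ` {-pi/2..pi/2}"
          using that unfolding A_def path_image_part_circlepath' seg_eq .
        then obtain t where t: "t \<in> {-pi/2..pi/2}" "w = of_real R * cis t"
          unfolding add_0 by blast
        have "cos t \<ge> 0" using t(1) by (intro cos_ge_zero) auto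
        moreover have "norm w = R" "Re w = R * cos t" using t(2) R by (simp_all add: norm_mult)
        ultimately show ?thesis using R by simp
      qed
      have B_im: "norm w = R \<and> Re w \<le> 0" if "w \<in> path_image B" for w
      proof -
        have seg_eq: "closed_segment (pi/2) (3*pi/2) = {pi/2..3*pi/2}"
          using pi_gt_zero by (simp add: closed_segment_eq_real_ivl)
        have "w \<in> (\<lambda>t. 0 + of_real R * cis t) ` {pi/2..3*pi/2}"
          using that unfolding B_def path_image_part_circlepath' seg_eq .
        then obtain t where t: "t \<in> {pi/2..3*pi/2}" "w = of_real R * cis t"
          unfolding add_0 by blast
        have "cos (t - pi) \<ge> 0" using t by (intro cos_ge_zero) auto
        hence "cos t \<le> 0" by simp
        moreover have "norm w = R" "Re w = R * cos t" using t(2) R by (simp_all add: norm_mult)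
        ultimately show ?thesis using R by (simp add: mult_nonneg_nonpos)
      qed
      define L1 where "L1 = closed_segment (\<i> * of_real R) (Complex (-d) R)"
      define L2 where "L2 = closed_segment (Complex (-d) R) (Complex (-d) (-R))"
      define L3 where "L3 = closed_segment (Complex (-d) (-R)) (- (\<i> * of_real R))"
      have L1: "- d \<le> Re w \<and> Re w \<le> 0 \<and> Im w = R" if wL: "w \<in> L1" for w
      proof -
        obtain u where u: "0 \<le> u" "u \<le> 1" "w = (1 - u) *\<^sub>R (\<i> * of_real R) + u *\<^sub>R Complex (-d) R"
          using wL by (auto simp: L1_def closed_segment_def)
        have "u * d \<le> 1 * d" using u d by (intro mult_right_mono) auto
        moreover have "Re w = - (u * d)" "Im w = R" unfolding u(3) by (simp_all add: left_diff_distrib)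
        ultimately show ?thesis using u d by simp
      qed
      have L3: "- d \<le> Re w \<and> Re w \<le> 0 \<and> Im w = - R" if wL: "w \<in> L3" for w
      proof -
        obtain u where u: "0 \<le> u" "u \<le> 1" "w = (1 - u) *\<^sub>R Complex (-d) (-R) + u *\<^sub>R (- (\<i> * of_real R))"
          using wL by (auto simp: L3_def closed_segment_def)
        have "u * d \<le> 1 * d" using u d by (intro mult_right_mono) auto
        moreover have "Re w = u * d - d" "Im w = - R" unfolding u(3) by (simp_all add: left_diff_distrib)
        ultimately show ?thesis using u d by simp
      qed
      have L2: "Re w = - d \<and> \<bar>Im w\<bar> \<le> R" if wL: "w \<in> L2" for w
      proof -
        obtain u where u: "0 \<le> u" "u \<le> 1" "w = (1 - u) *\<^sub>R Complex (-d) R + u *\<^sub>R Complex (-d) (-R)"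
          using wL by (auto simp: L2_def closed_segment_def)
        have "u * R \<le> 1 * R" "u * R \<ge> 0" using u R by (auto intro: mult_right_mono)
        moreover have "Re w = - d" "Im w = R - 2 * (u * R)" unfolding u(3) by (simp_all add: left_diff_distrib)
        ultimately show ?thesis using R by (intro conjI) linarith+
      qed
      have L_im: "path_image L = L1 \<union> (L2 \<union> L3)"
        by (simp add: L_def path_image_join L1_def L2_def L3_def)
      have L_rect: "w \<in> rect \<and> w \<noteq> 0 \<and> Re w \<le> 0" if "w \<in> path_image L" for w
        using that L1[of w] L2[of w] L3[of w] d R unfolding L_im rect by force
      define hG where "hG = (\<lambda>w. G w * P w * k w)"
      define hS where "hS = (\<lambda>w. Sn N w * P w * k w)"
      have hGhol: "hG holomorphic_on V"
        unfolding hG_def using G \<open>V \<subseteq> U\<close> by (intro holomorphic_intros hols) (auto intro: holomorphic_on_subset)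
      have hShol: "hS holomorphic_on X" for X
        unfolding hS_def using Sn_hol by (intro holomorphic_intros hols) (auto intro: holomorphic_on_subset)
      have AV: "path_image A \<subseteq> V"
      proof
        fix w assume "w \<in> path_image A"
        thus "w \<in> V" using A_im[of w] abs_Im_le_cmod[of w] d1 by (auto simp: V_def)
      qed
      have LV: "path_image L \<subseteq> V" using L_rect rectV by auto
      \<comment> \<open>\<open>G\<close> is only known in a thin strip left of the axis, so its path
        closes along the rectangle \<open>L\<close>. The partial sums are entire and may close along
        the semicircle \<open>B\<close>, where \<open>head\<close> bounds them.\<close>
      have c1: "contour_integral A (\<lambda>w. hG w / w) + contour_integral L (\<lambda>w. hG w / w) = 2 * of_real pi * \<i> * hG 0"
        by (rule cauchy_integral_two_half_paths[OF V hGhol _ valid(1) AV _ ends(1,2) valid(3) LV _ ends(5,6)])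
           (use R A_im L_rect in force)+
      have c2: "contour_integral A (\<lambda>w. hS w / w) + contour_integral B (\<lambda>w. hS w / w) = 2 * of_real pi * \<i> * hS 0"
        by (rule cauchy_integral_two_half_paths[OF open_UNIV convex_UNIV _ hShol _ valid(1) _ _ ends(1,2) valid(2) _ _ ends(3,4)])
           (use R A_im B_im in force)+
      have holq: "(\<lambda>w. hG w / w) holomorphic_on V - {0}" "(\<lambda>w. hS w / w) holomorphic_on UNIV - {0}"
        by (intro holomorphic_intros holomorphic_on_subset[OF hGhol] holomorphic_on_subset[OF hShol]; auto)+
      have iA: "(\<lambda>w. hG w / w) contour_integrable_on A" "(\<lambda>w. hS w / w) contour_integrable_on A"
        using valid(1) AV A_im R V
        by (intro contour_integrable_holomorphic_simple[OF holq(1)] contour_integrable_holomorphic_simple[OF holq(2)]; force)+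
      have iB: "(\<lambda>w. hS w / w) contour_integrable_on B"
        using valid(2) B_im R
        by (intro contour_integrable_holomorphic_simple[OF holq(2)]; force)
      \<comment> \<open>At these two points \<open>Re w = 0\<close> and the bounds
        \<open>tail\<close> and \<open>head\<close> degenerate; the estimate on arcs tolerates
        finitely many exceptions.\<close>
      define K where "K = {\<i> * of_real R, - (\<i> * of_real R)}"
      have Re0: "Re w \<noteq> 0" if "norm w = R" "w \<notin> K" for w
      proof
        assume "Re w = 0"
        hence "w = \<i> * of_real (Im w)" "\<bar>Im w\<bar> = R" using that by (auto simp: complex_eq_iff cmod_def)
        hence "w \<in> K" unfolding K_def by (metis abs_if insertCI minus_equation_iff mult_minus_right of_real_minus)
        thus False using that by blast
      qed
      have NN: "real N powr x > 0" for x using elim by simp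
      have bA: "norm (contour_integral A (\<lambda>w. hG w / w) - contour_integral A (\<lambda>w. hS w / w)) \<le> (2 * C / R\<^sup>2) * R * (pi/2 - (-pi/2))"
      proof (subst contour_integral_diff[OF iA, symmetric], unfold A_def,
             rule contour_integral_bound_part_circlepath_strong[where k = K])
        show "(\<lambda>w. hG w / w - hS w / w) contour_integrable_on part_circlepath 0 R (- pi / 2) (pi / 2)"
          using contour_integrable_diff[OF iA] by (simp add: A_def)
        fix w assume w: "w \<in> path_image (part_circlepath 0 R (- pi / 2) (pi / 2)) - K"
        hence w': "norm w = R" "Re w > 0"
          using A_im[of w] Re0[of w] by (auto simp: A_def)
        have "norm (hG w / w - hS w / w) = norm (G w - Sn N w) * norm (P w) * norm (k w / w)"
          unfolding norm_mult[symmetric] hG_def hS_def by (intro arg_cong[of _ _ norm]) (simp add: diff_divide_distrib left_diff_distrib)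
        also have "\<dots> \<le> (C * (real N powr (- Re w) / Re w)) * real N powr Re w * (2 * \<bar>Re w\<bar> / R\<^sup>2)"
          unfolding normP kbd[OF w'(1)] using tail[OF w'(2) elim(2)] by (intro mult_right_mono) auto
        also have "\<dots> = 2 * C / R\<^sup>2"
        proof -
          have XY: "real N powr (- Re w) = inverse (real N powr Re w)" by (simp add: powr_minus)
          show ?thesis unfolding XY using w' NN[of "Re w"] by (simp add: field_simps)
        qed
        finally show "norm (hG w / w - hS w / w) \<le> 2 * C / R\<^sup>2" .
      qed (use R C0 in \<open>auto simp: K_def\<close>)
      have bB: "norm (contour_integral B (\<lambda>w. hS w / w)) \<le> (2 * C / R\<^sup>2 + 2 * C / (R * N)) * R * (3*pi/2 - pi/2)"
      proof (unfold B_def, rule contour_integral_bound_part_circlepath_strong[where k = K])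
        show "(\<lambda>w. hS w / w) contour_integrable_on part_circlepath 0 R (pi / 2) (3 * pi / 2)"
          using iB by (simp add: B_def)
        fix w assume w: "w \<in> path_image (part_circlepath 0 R (pi / 2) (3 * pi / 2)) - K"
        hence w': "norm w = R" "- Re w > 0"
          using B_im[of w] Re0[of w] by (auto simp: B_def)
        define s where "s = - Re w"
        have s: "s > 0" "s \<le> R" using w' abs_Re_le_cmod[of w] by (auto simp: s_def)
        have "norm (hS w / w) = norm (Sn N w) * norm (P w) * norm (k w / w)"
          unfolding norm_mult[symmetric] hS_def by (intro arg_cong[of _ _ norm]) (simp add: field_simps)
        also have "\<dots> \<le> (C * (real N powr s / s + real N powr (s - 1))) * real N powr (-s) * (2 * s / R\<^sup>2)"
        proof -
          have "norm (P w) = real N powr (-s)" "norm (k w / w) = 2 * s / R\<^sup>2"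
            using s by (simp_all only: normP kbd[OF w'(1)]) (simp_all add: s_def)
          thus ?thesis using head[OF s(1) s_def, of N] s(1) by (simp only:) (intro mult_right_mono, auto)
        qed
        also have "\<dots> = 2 * C / R\<^sup>2 + 2 * C * s / (N * R\<^sup>2)"
        proof -
          have XY: "real N powr (-s) = inverse (real N powr s)" by (simp add: powr_minus)
          have ZZ: "real N powr (s - 1) = real N powr s / real N" using elim by (simp add: powr_diff)
          show ?thesis unfolding XY ZZ using s NN[of s] elim R by (simp add: field_simps)
        qed
        also have "2 * C * s / (N * R\<^sup>2) \<le> 2 * C * R / (N * R\<^sup>2)"
          using s C0 by (intro divide_right_mono mult_left_mono) auto
        also have "2 * C * R / (N * R\<^sup>2) = 2 * C / (R * N)"
          using R by (simp add: power2_eq_square)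
        finally show "norm (hS w / w) \<le> 2 * C / R\<^sup>2 + 2 * C / (R * N)" by simp
      qed (use R C0 in \<open>auto simp: K_def\<close>)
      have kL: "norm (k w) \<le> 4" if "w \<in> rect" for w
      proof -
        have "norm w \<le> \<bar>Re w\<bar> + \<bar>Im w\<bar>" by (rule cmod_le)
        also have "\<dots> \<le> 3/2 * R" using that d0 R by (auto simp: rect d0_def)
        finally have "(norm w)\<^sup>2 \<le> (3/2 * R)\<^sup>2" by (intro power_mono) auto
        hence "(norm w)\<^sup>2 \<le> 9/4 * R\<^sup>2" by (simp add: power_mult_distrib power2_eq_square)
        also have "\<dots> \<le> 3 * R\<^sup>2" by (intro mult_right_mono) auto
        finally have "(norm w)\<^sup>2 / R\<^sup>2 \<le> 3"
          using R by (simp add: divide_le_eq)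
        moreover have "norm (k w) \<le> 1 + norm (w\<^sup>2 / of_real (R\<^sup>2))"
          unfolding k_def by (rule order_trans[OF norm_triangle_ineq]) simp
        moreover have "norm (w\<^sup>2 / of_real (R\<^sup>2)) = (norm w)\<^sup>2 / R\<^sup>2"
          using R by (simp add: norm_divide norm_power norm_mult power2_eq_square)
        ultimately show ?thesis by simp
      qed
      \<comment> \<open>\<open>b\<close> is the coordinate that keeps w away from 0:
        \<open>R\<close> on the horizontal sides, \<open>d\<close> on the vertical one.\<close>
      have hGL: "norm (hG w / w) \<le> M * real N powr (Re w) * 4 / \<bar>b\<bar>"
        if "w \<in> rect" "b \<noteq> 0" "\<bar>b\<bar> \<le> norm w" for w b
      proof -
        have "norm (hG w / w) = norm (G w) * real N powr (Re w) * norm (k w) / norm w"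
          by (simp add: hG_def norm_mult norm_divide normP)
        also have "\<dots> \<le> M * real N powr (Re w) * 4 / \<bar>b\<bar>"
          using M kL that by (intro frac_le mult_mono) auto
        finally show ?thesis .
      qed
      have iL: "(\<lambda>w. hG w / w) contour_integrable_on linepath u v" if "closed_segment u v \<subseteq> path_image L" for u v
        using that LV L_rect V(1)
        by (intro contour_integrable_holomorphic_simple[OF holq(1)]) auto
      have iL': "(\<lambda>w. hG w / w) contour_integrable_on linepath (\<i> * of_real R) (Complex (-d) R)"
          "(\<lambda>w. hG w / w) contour_integrable_on linepath (Complex (-d) R) (Complex (-d) (-R))"
          "(\<lambda>w. hG w / w) contour_integrable_on linepath (Complex (-d) (-R)) (- (\<i> * of_real R))"
        by (rule iL; unfold L_im L1_def L2_def L3_def; blast)+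
      have "contour_integral L (\<lambda>w. hG w / w) =
         contour_integral (linepath (\<i> * of_real R) (Complex (-d) R)) (\<lambda>w. hG w / w) +
         (contour_integral (linepath (Complex (-d) R) (Complex (-d) (-R))) (\<lambda>w. hG w / w) +
          contour_integral (linepath (Complex (-d) (-R)) (- (\<i> * of_real R))) (\<lambda>w. hG w / w))"
        unfolding L_def using iL' by (subst contour_integral_join contour_integral_join; auto intro!: contour_integrable_joinI valid_path_join)+
      moreover have "norm (contour_integral (linepath (\<i> * of_real R) (Complex (-d) R)) (\<lambda>w. hG w / w))
                        \<le> (4 * M / R) * norm (Complex (-d) R - \<i> * of_real R)"
      proof (rule contour_integral_bound_linepath[OF iL'(1)])
        fix w assume w: "w \<in> closed_segment (\<i> * of_real R) (Complex (-d) R)"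
        hence w': "w \<in> rect" "\<bar>R\<bar> \<le> norm w" "Re w \<le> 0"
          using L1[of w] L_rect[of w] abs_Im_le_cmod[of w] L_im by (auto simp: L1_def)
        have "norm (hG w / w) \<le> M * real N powr (Re w) * 4 / \<bar>R\<bar>"
          using w' R by (intro hGL) auto
        also have "\<dots> \<le> M * 1 * 4 / \<bar>R\<bar>"
          using w'(3) elim(2) M powr_mono[of "Re w" 0 "real N"] by (intro divide_right_mono mult_right_mono mult_left_mono) auto
        finally show "norm (hG w / w) \<le> 4 * M / R" using R by (simp add: mult.commute)
      qed (use M R in auto)
      moreover have "norm (contour_integral (linepath (Complex (-d) (-R)) (- (\<i> * of_real R))) (\<lambda>w. hG w / w))
                        \<le> (4 * M / R) * norm (- (\<i> * of_real R) - Complex (-d) (-R))"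
      proof (rule contour_integral_bound_linepath[OF iL'(3)])
        fix w assume w: "w \<in> closed_segment (Complex (-d) (-R)) (- (\<i> * of_real R))"
        hence w': "w \<in> rect" "\<bar>R\<bar> \<le> norm w" "Re w \<le> 0"
          using L3[of w] L_rect[of w] abs_Im_le_cmod[of w] L_im R by (auto simp: L3_def)
        have "norm (hG w / w) \<le> M * real N powr (Re w) * 4 / \<bar>R\<bar>"
          using w' R by (intro hGL) auto
        also have "\<dots> \<le> M * 1 * 4 / \<bar>R\<bar>"
          using w'(3) elim(2) M powr_mono[of "Re w" 0 "real N"] by (intro divide_right_mono mult_right_mono mult_left_mono) auto
        finally show "norm (hG w / w) \<le> 4 * M / R" using R by (simp add: mult.commute)
      qed (use M R in auto)
      moreover have "norm (contour_integral (linepath (Complex (-d) R) (Complex (-d) (-R))) (\<lambda>w. hG w / w))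
                        \<le> (M * real N powr (-d) * 4 / d) * norm (Complex (-d) (-R) - Complex (-d) R)"
      proof (rule contour_integral_bound_linepath[OF iL'(2)])
        fix w assume w: "w \<in> closed_segment (Complex (-d) R) (Complex (-d) (-R))"
        hence w': "w \<in> rect" "Re w = - d"
          using L2[of w] L_rect[of w] L_im by (auto simp: L2_def)
        have "norm (hG w / w) \<le> M * real N powr (Re w) * 4 / \<bar>d\<bar>"
          using w' d abs_Re_le_cmod[of w] by (intro hGL) auto
        thus "norm (hG w / w) \<le> M * real N powr (-d) * 4 / d" using w' d by simp
      qed (use M R d in auto)
      moreover have "norm (Complex (-d) R - \<i> * of_real R) = d" "norm (- (\<i> * of_real R) - Complex (-d) (-R)) = d"
          "norm (Complex (-d) (-R) - Complex (-d) R) = 2 * R"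
        using d R by (auto simp: cmod_def real_sqrt_mult)
      ultimately have bL: "norm (contour_integral L (\<lambda>w. hG w / w)) \<le> (4 * M / R) * d + (4 * M / R) * d + (M * real N powr (-d) * 4 / d) * (2 * R)"
        by (smt (verit, ccfv_SIG) norm_triangle_ineq)
      have e1: "2 * of_real pi * \<i> * (G 0 - Sn N 0) = (contour_integral A (\<lambda>w. hG w / w) - contour_integral A (\<lambda>w. hS w / w))
           + contour_integral L (\<lambda>w. hG w / w) - contour_integral B (\<lambda>w. hS w / w)"
        using c1 c2 by (simp add: hG_def hS_def P0 k0 algebra_simps)
      have e2: "norm (2 * of_real pi * \<i> * (G 0 - Sn N 0)) = 2 * pi * norm (G 0 - Sn N 0)"
        by (simp add: norm_mult)
      have tri: "norm (x + y - z) \<le> norm x + norm y + norm z" for x y z :: complex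
        by (rule order_trans[OF norm_triangle_ineq4]) (simp add: norm_triangle_ineq)
      have "2 * pi * norm (G 0 - Sn N 0) \<le> norm (contour_integral A (\<lambda>w. hG w / w) - contour_integral A (\<lambda>w. hS w / w))
           + norm (contour_integral L (\<lambda>w. hG w / w)) + norm (contour_integral B (\<lambda>w. hS w / w))"
        unfolding e2[symmetric] e1 by (rule tri)
      also have "\<dots> \<le> (2 * C / R\<^sup>2) * R * (pi/2 - (-pi/2)) + ((4 * M / R) * d + (4 * M / R) * d + (M * real N powr (-d) * 4 / d) * (2 * R))
            + (2 * C / R\<^sup>2 + 2 * C / (R * N)) * R * (3*pi/2 - pi/2)"
        using bA bB bL by linarith
      also have "\<dots> = 2 * pi * (2 * C / R + C / real N) + 8 * (M * d / R + M * R * real N powr (-d) / d)"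
        using R elim by (simp add: field_simps power2_eq_square)
      also have "\<dots> \<le> 2 * pi * (2 * C / R + C / real N) + (4 * pi) * (M * d / R + M * R * real N powr (-d) / d)"
        using pi_gt3 M R d by (intro add_left_mono mult_right_mono) auto
      also have "\<dots> = 2 * pi * (2 * C / R + 2 * (M * d / R) + (C / real N + 2 * M * R * real N powr (-d) / d))"
        by (simp add: algebra_simps)
      also have "\<dots> < 2 * pi * e"
      proof (rule mult_strict_left_mono)
        show "2 * C / R + 2 * (M * d / R) + (C / real N + 2 * M * R * real N powr (-d) / d) < e"
          using elim(1) R(2) d(3) by linarith
      qed simp
      finally show ?case by (simp add: norm_minus_commute)
    qed
    thus "\<exists>N0. \<forall>N\<ge>N0. norm (Sn N 0 - G 0) < e"
      by (auto simp: eventually_sequentially)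
  qed
qed

section \<open>The prime number theorem\<close>

definition zeta_reg :: "complex \<Rightarrow> complex" where
  "zeta_reg s = 1 + (\<Sum>n. zterm (Suc n) s)"

lemma zeta_reg_holomorphic: "zeta_reg holomorphic_on {s. Re s > 0}"
  and zeta_reg_sums: "Re s > 0 \<Longrightarrow> (\<lambda>n. zterm (Suc n) s) sums (zeta_reg s - 1)"
proof -
  obtain g where g: "g holomorphic_on {s. Re s > 0}" "\<And>s. Re s > 0 \<Longrightarrow> (\<lambda>n. 1 * zterm (Suc n) s) sums g s"
    by (rule zterm_series[of "\<lambda>_. 1" 1 0]) auto
  have eq: "zeta_reg s = 1 + g s" if "Re s > 0" for s
    using sums_unique[OF g(2)[OF that]] by (simp add: zeta_reg_def)
  show "zeta_reg holomorphic_on {s. Re s > 0}"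
    by (rule holomorphic_transform[where f = "\<lambda>s. 1 + g s"]) (auto intro!: holomorphic_intros g(1) simp: eq)
  show "(\<lambda>n. zterm (Suc n) s) sums (zeta_reg s - 1)" if "Re s > 0"
    using g(2)[OF that] eq[OF that] by simp
qed

lemma zeta_reg_1 [simp]: "zeta_reg 1 = 1"
  by (simp add: zeta_reg_def zterm_def del: of_nat_Suc)

definition zeta_series :: "complex \<Rightarrow> complex" where
  "zeta_series s = (\<Sum>n. of_nat n powr (-s))"

definition mangoldt_series :: "complex \<Rightarrow> complex" where
  "mangoldt_series s = (\<Sum>n. of_real (mangoldt n) * of_nat n powr (-s))"

lemma zeta_series:
  shows zeta_series_holomorphic: "zeta_series holomorphic_on {s. Re s > 1}"
    and zeta_series_sums: "Re s > 1 \<Longrightarrow> (\<lambda>n. of_nat n powr (-s)) sums zeta_series s"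
    and zeta_series_deriv_sums: "Re s > 1 \<Longrightarrow> (\<lambda>n. - of_real (ln (real n)) * of_nat n powr (-s)) sums deriv zeta_series s"
    and zeta_series_summable: "Re s > 1 \<Longrightarrow> summable (\<lambda>n. norm (of_nat n powr (-s) :: complex))"
proof -
  have ex: "\<exists>C. \<forall>n\<ge>1. \<bar>1 :: real\<bar> \<le> C * real n powr m" if "m > 0" for m
    using that by (intro exI[of _ 1]) (auto simp: ge_one_powr_ge_zero)
  obtain g where g: "g holomorphic_on {s. Re s > 1}"
    "\<And>s. Re s > 1 \<Longrightarrow> (\<lambda>n. of_real 1 * of_nat n powr (-s)) sums g s"
    "\<And>s. Re s > 1 \<Longrightarrow> (\<lambda>n. - of_real (1 * ln (real n)) * of_nat n powr (-s)) sums deriv g s"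
    "\<And>s. Re s > 1 \<Longrightarrow> summable (\<lambda>n. norm (of_real 1 * of_nat n powr (-s) :: complex))"
    by (rule dirichlet_series_holomorphic[of "\<lambda>_. 1"]) (use ex in auto)
  have eq: "zeta_series s = g s" if "Re s > 1" for s
    using sums_unique[OF g(2)[OF that]] by (simp add: zeta_series_def)
  have eq': "deriv zeta_series s = deriv g s" if "Re s > 1" for s
  proof (rule deriv_cong_ev[OF _ refl])
    show "\<forall>\<^sub>F x in nhds s. zeta_series x = g x"
      using eventually_nhds_in_open[OF open_halfspace_Re_gt[of 1], of s] that eq
      by (auto elim!: eventually_mono)
  qed
  show "zeta_series holomorphic_on {s. Re s > 1}"
    by (rule holomorphic_transform[OF g(1)]) (auto simp: eq)
  show "Re s > 1 \<Longrightarrow> (\<lambda>n. of_nat n powr (-s)) sums zeta_series s" using g(2) eq by simp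
  show "Re s > 1 \<Longrightarrow> (\<lambda>n. - of_real (ln (real n)) * of_nat n powr (-s)) sums deriv zeta_series s"
    using g(3) eq' by simp
  show "Re s > 1 \<Longrightarrow> summable (\<lambda>n. norm (of_nat n powr (-s) :: complex))" using g(4) by simp
qed

lemma
  shows mangoldt_series_holomorphic: "mangoldt_series holomorphic_on {s. Re s > 1}"
    and mangoldt_series_sums: "Re s > 1 \<Longrightarrow> (\<lambda>n. of_real (mangoldt n) * of_nat n powr (-s)) sums mangoldt_series s"
    and mangoldt_series_summable: "Re s > 1 \<Longrightarrow> summable (\<lambda>n. norm (of_real (mangoldt n) * of_nat n powr (-s) :: complex))"
proof -
  have ex: "\<exists>C. \<forall>n\<ge>1. \<bar>mangoldt n :: real\<bar> \<le> C * real n powr m" if "m > 0" for m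
  proof (intro exI[of _ "1/m"] allI impI)
    fix n :: nat assume "n \<ge> 1"
    hence "mangoldt n \<le> ln (real n)" by (intro mangoldt_le) auto
    also have "\<dots> \<le> 1 / m * real n powr m" using ln_le_powr[OF that, of n] by simp
    finally show "\<bar>mangoldt n :: real\<bar> \<le> 1 / m * real n powr m" by simp
  qed
  obtain g where g: "g holomorphic_on {s. Re s > 1}"
    "\<And>s. Re s > 1 \<Longrightarrow> (\<lambda>n. of_real (mangoldt n) * of_nat n powr (-s)) sums g s"
    "\<And>s. Re s > 1 \<Longrightarrow> summable (\<lambda>n. norm (of_real (mangoldt n) * of_nat n powr (-s) :: complex))"
    by (rule dirichlet_series_holomorphic[of "\<lambda>n. mangoldt n"]) (use ex in auto)
  have eq: "mangoldt_series s = g s" if "Re s > 1" for s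
    using sums_unique[OF g(2)[OF that]] by (simp add: mangoldt_series_def)
  show "mangoldt_series holomorphic_on {s. Re s > 1}"
    by (rule holomorphic_transform[OF g(1)]) (auto simp: eq)
  show "Re s > 1 \<Longrightarrow> (\<lambda>n. of_real (mangoldt n) * of_nat n powr (-s)) sums mangoldt_series s" using g(2) eq by simp
  show "Re s > 1 \<Longrightarrow> summable (\<lambda>n. norm (of_real (mangoldt n) * of_nat n powr (-s) :: complex))" using g(3) by simp
qed

lemma mangoldt_series_mult_zeta1: "Re s > 1 \<Longrightarrow> mangoldt_series s * zeta_series s = - deriv zeta_series s"
proof -
  assume s: "Re s > 1"
  have "(\<lambda>n. of_real (ln (real n)) * of_nat n powr (-s)) sums (mangoldt_series s * zeta_series s)"
    by (rule dirichlet_product_mangoldt[OF mangoldt_series_summable mangoldt_series_sums zeta_series_summable zeta_series_sums]) (use s in auto)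
  moreover have "(\<lambda>n. - (- of_real (ln (real n)) * of_nat n powr (-s))) sums (- deriv zeta_series s)"
    using zeta_series_deriv_sums[OF s] by (rule sums_minus)
  ultimately show ?thesis by (simp add: sums_unique2)
qed

lemma of_nat_powr_tendsto_0:
  assumes "Re s < 0"
  shows "(\<lambda>n. of_nat (Suc n) powr s :: complex) \<longlonglongrightarrow> 0"
proof (rule tendsto_norm_zero_cancel)
  have "(\<lambda>n. real (Suc n) powr Re s) \<longlonglongrightarrow> 0"
    using assms by (intro tendsto_neg_powr filterlim_compose[OF filterlim_real_sequentially filterlim_Suc])
  thus "(\<lambda>n. norm (of_nat (Suc n) powr s :: complex)) \<longlonglongrightarrow> 0"
    by (simp add: norm_powr_real_powr del: of_nat_Suc)
qed

lemma zeta_reg_eq: 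
  assumes s: "Re s > 1"
  shows "zeta_reg s = (s - 1) * zeta_series s"
proof -
  have "(\<lambda>n. of_nat (Suc n) powr (-s)) sums zeta_series s"
    using zeta_series_sums[OF s] by (subst sums_Suc_iff) simp
  hence "(\<lambda>n. (s - 1) * of_nat (Suc n) powr (-s)) sums ((s - 1) * zeta_series s)"
    by (rule sums_mult)
  moreover have "(\<lambda>n. of_nat (Suc (Suc n)) powr (1 - s) - of_nat (Suc n) powr (1 - s)) sums (0 - of_nat (Suc 0) powr (1 - s) :: complex)"
    by (rule telescope_sums[OF of_nat_powr_tendsto_0]) (use s in auto)
  ultimately have "(\<lambda>n. (s - 1) * of_nat (Suc n) powr (-s) + (of_nat (Suc (Suc n)) powr (1 - s) - of_nat (Suc n) powr (1 - s))) sums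
      ((s - 1) * zeta_series s + (0 - of_nat (Suc 0) powr (1 - s)))" by (rule sums_add)
  hence "(\<lambda>n. zterm (Suc n) s) sums ((s - 1) * zeta_series s - 1)"
    by (simp add: zterm_def algebra_simps)
  thus ?thesis using zeta_reg_sums[of s] s by (auto dest: sums_unique2)
qed

text \<open>The logarithmic derivative in product form: dividing by \<open>zeta_reg s\<close> would
  presuppose the non-vanishing that is deduced from this identity.\<close>

lemma zeta_reg_deriv:
  assumes s: "Re s > 1"
  shows "deriv zeta_reg s = zeta_reg s * (1 / (s - 1) - mangoldt_series s)"
proof -
  have ne: "s \<noteq> 1" using s by auto
  have "(zeta_series has_field_derivative deriv zeta_series s) (at s)"
    using holomorphic_derivI[OF zeta_series_holomorphic open_halfspace_Re_gt] s by auto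
  hence "((\<lambda>s. (s - 1) * zeta_series s) has_field_derivative zeta_series s + (s - 1) * deriv zeta_series s) (at s)"
    by (auto intro!: derivative_eq_intros)
  hence "(zeta_reg has_field_derivative zeta_series s + (s - 1) * deriv zeta_series s) (at s)"
    by (rule has_field_derivative_transform_within_open[OF _ open_halfspace_Re_gt[of 1]]) (use s zeta_reg_eq in auto)
  hence "deriv zeta_reg s = zeta_series s + (s - 1) * deriv zeta_series s" by (rule DERIV_imp_deriv)
  also have "deriv zeta_series s = - (mangoldt_series s * zeta_series s)" using mangoldt_series_mult_zeta1[OF s] by simp
  finally have "deriv zeta_reg s = zeta_series s - (s - 1) * zeta_series s * mangoldt_series s" by (simp add: algebra_simps)
  moreover have "(s - 1) * zeta_series s * (1 / (s - 1)) = zeta_series s" using ne by simp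
  ultimately show ?thesis unfolding zeta_reg_eq[OF s] right_diff_distrib by simp
qed

section \<open>Non-vanishing of the zeta function for Re s \<ge> 1\<close>

lemma logderiv_order:
  fixes f :: "complex \<Rightarrow> complex"
  assumes f: "f holomorphic_on S" "open S" "connected S" "\<xi> \<in> S" "z \<in> S" "f z \<noteq> 0"
  obtains n :: nat where "((\<lambda>w. (w - \<xi>) * deriv f w / f w) \<longlongrightarrow> of_nat n) (at \<xi>)" "f \<xi> = 0 \<longleftrightarrow> n > 0"
    "eventually (\<lambda>w. f w \<noteq> 0) (at \<xi>)"
proof (cases "f \<xi> = 0")
  case False
  have cont: "isCont f \<xi>" "isCont (deriv f) \<xi>"
    using f holomorphic_deriv[OF f(1,2)] by (auto simp: continuous_on_eq_continuous_at dest!: holomorphic_on_imp_continuous_on)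
  have "((\<lambda>w. (w - \<xi>) * deriv f w / f w) \<longlongrightarrow> (\<xi> - \<xi>) * deriv f \<xi> / f \<xi>) (at \<xi>)"
    using cont False unfolding isCont_def by (intro tendsto_intros) auto
  moreover have "eventually (\<lambda>w. f w \<noteq> 0) (at \<xi>)"
    using cont(1) False unfolding isCont_def by (rule tendsto_imp_eventually_ne)
  ultimately show ?thesis using that[of 0] False by simp
next
  case True
  \<comment> \<open>The point \<open>z\<close> with \<open>f z \<noteq> 0\<close> guarantees that
    the zero has a finite order; \<open>n\<close> is this order, the residue of the logarithmic
    derivative.\<close>
  have nc: "\<not> f constant_on S" using True f(4-6) by (metis constant_on_def)
  obtain g r n where g: "0 < n"  "0 < r"  "ball \<xi> r \<subseteq> S"
            "g holomorphic_on ball \<xi> r"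
            "\<And>w. w \<in> ball \<xi> r \<Longrightarrow> f w = (w - \<xi>)^n * g w"
            "\<And>w. w \<in> ball \<xi> r \<Longrightarrow> g w \<noteq> 0"
    using holomorphic_factor_zero_nonconstant[OF f(1-4) True nc] by metis
  have cont: "isCont g \<xi>" "isCont (deriv g) \<xi>"
    using g(2,4) holomorphic_deriv[OF g(4) open_ball] by (auto simp: continuous_on_eq_continuous_at dest!: holomorphic_on_imp_continuous_on)
  have ev: "eventually (\<lambda>w. w \<in> ball \<xi> r - {\<xi>}) (at \<xi>)"
    using g(2) by (intro eventually_at_in_open) auto
  have "eventually (\<lambda>w. of_nat n + (w - \<xi>) * deriv g w / g w = (w - \<xi>) * deriv f w / f w) (at \<xi>)"
    using ev
  proof eventually_elim
    case (elim w)
    have "(g has_field_derivative deriv g w) (at w)"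
      using holomorphic_derivI[OF g(4) open_ball] elim by auto
    hence "((\<lambda>w. (w - \<xi>)^n * g w) has_field_derivative of_nat n * (w - \<xi>)^(n-1) * g w + (w - \<xi>)^n * deriv g w) (at w)"
      by (auto intro!: derivative_eq_intros)
    hence "(f has_field_derivative of_nat n * (w - \<xi>)^(n-1) * g w + (w - \<xi>)^n * deriv g w) (at w)"
      by (rule has_field_derivative_transform_within_open[OF _ open_ball[of \<xi> r]]) (use elim g(5) in auto)
    hence d: "deriv f w = of_nat n * (w - \<xi>)^(n-1) * g w + (w - \<xi>)^n * deriv g w" by (rule DERIV_imp_deriv)
    have "(w - \<xi>) * deriv f w = of_nat n * ((w - \<xi>) * (w - \<xi>)^(n-1)) * g w + (w - \<xi>) * ((w - \<xi>)^n * deriv g w)"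
      unfolding d by (simp add: algebra_simps)
    also have "(w - \<xi>) * (w - \<xi>)^(n-1) = (w - \<xi>)^n" using g(1) by (simp add: power_eq_if)
    finally have "(w - \<xi>) * deriv f w / f w = (of_nat n * (w - \<xi>)^n * g w + (w - \<xi>) * ((w - \<xi>)^n * deriv g w)) / ((w - \<xi>)^n * g w)"
      using elim g(5)[of w] by simp
    also have "\<dots> = of_nat n + (w - \<xi>) * deriv g w / g w"
      using elim g(6)[of w] by (simp add: add_divide_distrib)
    finally show ?case ..
  qed
  moreover have "((\<lambda>w. of_nat n + (w - \<xi>) * deriv g w / g w) \<longlongrightarrow> of_nat n + (\<xi> - \<xi>) * deriv g \<xi> / g \<xi>) (at \<xi>)"
    using cont g(2,6) unfolding isCont_def by (intro tendsto_intros) auto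
  ultimately have "((\<lambda>w. (w - \<xi>) * deriv f w / f w) \<longlongrightarrow> of_nat n + (\<xi> - \<xi>) * deriv g \<xi> / g \<xi>) (at \<xi>)"
    by (rule Lim_transform_eventually[rotated])
  moreover have "eventually (\<lambda>w. f w \<noteq> 0) (at \<xi>)"
    using ev by eventually_elim (use g(5,6) in auto)
  ultimately show ?thesis using that[of n] True g(1) by simp
qed

lemma zeta_reg_order:
  assumes "Re \<xi> > 0"
  obtains n :: nat where "((\<lambda>w. (w - \<xi>) * deriv zeta_reg w / zeta_reg w) \<longlongrightarrow> of_nat n) (at \<xi>)" "zeta_reg \<xi> = 0 \<longleftrightarrow> n > 0"
    "eventually (\<lambda>w. zeta_reg w \<noteq> 0) (at \<xi>)"
  by (rule logderiv_order[OF zeta_reg_holomorphic, of \<xi> 1])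
     (use assms in \<open>auto intro: open_halfspace_Re_gt convex_connected convex_halfspace_Re_gt\<close>)

text \<open>No Euler product: at a zero the logarithmic derivative would have a pole, but by
  \<open>zeta_reg_deriv\<close> it is \<open>1 / (s - 1) - mangoldt_series s\<close>, which is
  continuous there.\<close>

lemma zeta_reg_nonzero_Re_gt_1:
  assumes "Re \<xi> > 1"
  shows "zeta_reg \<xi> \<noteq> 0"
proof
  assume z: "zeta_reg \<xi> = 0"
  obtain n :: nat where n: "((\<lambda>w. (w - \<xi>) * deriv zeta_reg w / zeta_reg w) \<longlongrightarrow> of_nat n) (at \<xi>)" "zeta_reg \<xi> = 0 \<longleftrightarrow> n > 0"
    "eventually (\<lambda>w. zeta_reg w \<noteq> 0) (at \<xi>)"
    using zeta_reg_order[of \<xi>] assms by auto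
  have "isCont mangoldt_series \<xi>"
    using mangoldt_series_holomorphic assms open_halfspace_Re_gt[of 1]
    by (auto simp: continuous_on_eq_continuous_at dest!: holomorphic_on_imp_continuous_on)
  hence "((\<lambda>w. (w - \<xi>) * (1 / (w - 1) - mangoldt_series w)) \<longlongrightarrow> (\<xi> - \<xi>) * (1 / (\<xi> - 1) - mangoldt_series \<xi>)) (at \<xi>)"
    unfolding isCont_def using assms by (intro tendsto_intros) auto
  moreover have "eventually (\<lambda>w. (w - \<xi>) * (1 / (w - 1) - mangoldt_series w) = (w - \<xi>) * deriv zeta_reg w / zeta_reg w) (at \<xi>)"
  proof -
    have "eventually (\<lambda>w. w \<in> {s. Re s > 1}) (at \<xi>)"
      using assms by (intro eventually_at_in_open' open_halfspace_Re_gt) auto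
    with n(3) show ?thesis by eventually_elim (simp add: zeta_reg_deriv)
  qed
  ultimately have "((\<lambda>w. (w - \<xi>) * deriv zeta_reg w / zeta_reg w) \<longlongrightarrow> (\<xi> - \<xi>) * (1 / (\<xi> - 1) - mangoldt_series \<xi>)) (at \<xi>)"
    by (rule Lim_transform_eventually)
  with n(1) have "of_nat n = (\<xi> - \<xi>) * (1 / (\<xi> - 1) - mangoldt_series \<xi>)"
    by (rule LIM_unique)
  with z n(2) show False by simp
qed

text \<open>Uses \<open>3 + 4 cos u + cos 2u \<ge> 0\<close>.\<close>
lemma zeta_reg_nonzero_line:
  assumes t: "t \<noteq> 0"
  shows "zeta_reg (Complex 1 t) \<noteq> 0"
proof
  assume z: "zeta_reg (Complex 1 t) = 0"
  \<comment> \<open>The limit is 1 for the pole of zeta at \<open>u = 0\<close>, minus the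
    multiplicity \<open>n\<close> of a zero of \<open>zeta_reg\<close> at
    \<open>Complex 1 u\<close>.\<close>
  have lim: "\<exists>n::nat. ((\<lambda>x. of_real (x - 1) * mangoldt_series (Complex x u)) \<longlongrightarrow> (if u = 0 then 1 else 0) - of_nat n) (at_right 1)
     \<and> (zeta_reg (Complex 1 u) = 0 \<longleftrightarrow> n > 0)" for u
  proof -
    define \<xi> where "\<xi> = Complex 1 u"
    obtain n :: nat where n: "((\<lambda>w. (w - \<xi>) * deriv zeta_reg w / zeta_reg w) \<longlongrightarrow> of_nat n) (at \<xi>)" "zeta_reg \<xi> = 0 \<longleftrightarrow> n > 0"
      using zeta_reg_order[of \<xi>] by (auto simp: \<xi>_def)
    have flim: "filterlim (\<lambda>x. Complex x u) (at \<xi>) (at_right 1)"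
      unfolding filterlim_at
    proof
      show "((\<lambda>x. Complex x u) \<longlongrightarrow> \<xi>) (at_right 1)"
        unfolding \<xi>_def by (intro tendsto_intros)
      show "\<forall>\<^sub>F x in at_right 1. Complex x u \<in> UNIV \<and> Complex x u \<noteq> \<xi>"
        using eventually_at_right_less[of 1] by eventually_elim (auto simp: \<xi>_def)
    qed
    have 1: "((\<lambda>x. (Complex x u - \<xi>) * deriv zeta_reg (Complex x u) / zeta_reg (Complex x u)) \<longlongrightarrow> of_nat n) (at_right 1)"
      using filterlim_compose[OF n(1) flim] .
    have 2: "((\<lambda>x. of_real (x - 1) / (Complex x u - 1)) \<longlongrightarrow> (if u = 0 then 1 else 0 :: complex)) (at_right 1)"
    proof (cases "u = 0")
      case True
      have "\<forall>\<^sub>F x in at_right 1. of_real (x - 1) / (Complex x u - 1) = (1 :: complex)"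
        using eventually_at_right_less[of 1]
      proof eventually_elim
        case (elim x)
        have "Complex x u - 1 = of_real (x - 1)" using True by (simp add: complex_eq_iff)
        thus ?case using elim by (simp only:) simp
      qed
      hence "((\<lambda>x. of_real (x - 1) / (Complex x u - 1)) \<longlongrightarrow> (1 :: complex)) (at_right 1)"
        by (rule tendsto_eventually)
      thus ?thesis using True by simp
    next
      case False
      have "((\<lambda>x. of_real (x - 1) / (Complex x u - 1)) \<longlongrightarrow> of_real (1 - 1) / (Complex 1 u - 1)) (at_right 1)"
        using False by (intro tendsto_intros) (auto simp: complex_eq_iff)
      thus ?thesis using False by simp
    qed
    have "((\<lambda>x. of_real (x - 1) / (Complex x u - 1) - (Complex x u - \<xi>) * deriv zeta_reg (Complex x u) / zeta_reg (Complex x u))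
        \<longlongrightarrow> (if u = 0 then 1 else 0) - of_nat n) (at_right 1)"
      by (rule tendsto_diff[OF 2 1])
    moreover have "\<forall>\<^sub>F x in at_right 1. of_real (x - 1) / (Complex x u - 1) - (Complex x u - \<xi>) * deriv zeta_reg (Complex x u) / zeta_reg (Complex x u)
        = of_real (x - 1) * mangoldt_series (Complex x u)"
      using eventually_at_right_less[of 1]
    proof eventually_elim
      case (elim x)
      have "Complex x u - \<xi> = of_real (x - 1)" by (simp add: \<xi>_def complex_eq_iff)
      moreover have "deriv zeta_reg (Complex x u) = zeta_reg (Complex x u) * (1 / (Complex x u - 1) - mangoldt_series (Complex x u))"
        using elim by (intro zeta_reg_deriv) auto
      moreover have "zeta_reg (Complex x u) \<noteq> 0" using elim by (intro zeta_reg_nonzero_Re_gt_1) auto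
      ultimately have "(Complex x u - \<xi>) * deriv zeta_reg (Complex x u) / zeta_reg (Complex x u) = of_real (x - 1) * (1 / (Complex x u - 1) - mangoldt_series (Complex x u))"
        by simp
      thus ?case by (simp add: right_diff_distrib)
    qed
    ultimately have "((\<lambda>x. of_real (x - 1) * mangoldt_series (Complex x u)) \<longlongrightarrow> (if u = 0 then 1 else 0) - of_nat n) (at_right 1)"
      by (rule Lim_transform_eventually)
    with n(2) show ?thesis unfolding \<xi>_def by blast
  qed
  obtain n0 n1 n2 :: nat where
    l0: "((\<lambda>x. of_real (x - 1) * mangoldt_series (Complex x 0)) \<longlongrightarrow> 1 - of_nat n0) (at_right 1)" "zeta_reg (Complex 1 0) = 0 \<longleftrightarrow> n0 > 0" and
    l1: "((\<lambda>x. of_real (x - 1) * mangoldt_series (Complex x t)) \<longlongrightarrow> 0 - of_nat n1) (at_right 1)" "zeta_reg (Complex 1 t) = 0 \<longleftrightarrow> n1 > 0" and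
    l2: "((\<lambda>x. of_real (x - 1) * mangoldt_series (Complex x (2*t))) \<longlongrightarrow> 0 - of_nat n2) (at_right 1)"
    using lim[of 0] lim[of t] lim[of "2*t"] t by auto
  have "Complex 1 0 = 1" by (simp add: complex_eq_iff)
  hence n0: "n0 = 0" using l0(2) by simp
  have n1: "n1 > 0" using l1(2) z by simp
  \<comment> \<open>The limit is \<open>3 - 4 * n1 - n2\<close>, negative as soon as
    \<open>n1 \<ge> 1\<close>, whereas for \<open>x > 1\<close> the combined series has nonnegative
    terms only.\<close>
  have "((\<lambda>x. Re (3 * (of_real (x - 1) * mangoldt_series (Complex x 0)) + 4 * (of_real (x - 1) * mangoldt_series (Complex x t)) + of_real (x - 1) * mangoldt_series (Complex x (2*t))))
        \<longlongrightarrow> Re (3 * (1 - of_nat n0) + 4 * (0 - of_nat n1) + (0 - of_nat n2))) (at_right 1)"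
    by (intro tendsto_intros l0 l1 l2)
  moreover have "\<forall>\<^sub>F x in at_right 1. 0 \<le> Re (3 * (of_real (x - 1) * mangoldt_series (Complex x 0)) + 4 * (of_real (x - 1) * mangoldt_series (Complex x t)) + of_real (x - 1) * mangoldt_series (Complex x (2*t)))"
    using eventually_at_right_less[of 1]
  proof eventually_elim
    case (elim x)
    have S: "(\<lambda>n. Re (of_real (mangoldt n) * of_nat n powr (- Complex x u))) sums Re (mangoldt_series (Complex x u))" for u
      using mangoldt_series_sums[of "Complex x u"] elim by (intro sums_Re) auto
    have R: "Re (of_real (mangoldt n) * of_nat n powr (- Complex x u)) = mangoldt n * real n powr (-x) * cos (u * ln (real n))" for n u
    proof (cases "n = 0")
      case False
      have "of_nat n powr (- Complex x u) = exp (Complex (- x * ln (real n)) (- (u * ln (real n))))"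
      proof -
        have "- Complex x u * of_real (ln (real n)) = Complex (- x * ln (real n)) (- (u * ln (real n)))"
          by (simp add: complex_eq_iff)
        thus ?thesis using False by (simp add: powr_def Ln_of_nat)
      qed
      hence "Re (of_nat n powr (- Complex x u)) = exp (- x * ln (real n)) * cos (u * ln (real n))"
        by (simp add: Re_exp)
      thus ?thesis using False by (simp add: powr_def del: of_real_mangoldt) 
    qed auto
    have "(\<lambda>n. 3 * Re (of_real (mangoldt n) * of_nat n powr (- Complex x 0)) + 4 * Re (of_real (mangoldt n) * of_nat n powr (- Complex x t))
        + Re (of_real (mangoldt n) * of_nat n powr (- Complex x (2*t)))) sums
        (3 * Re (mangoldt_series (Complex x 0)) + 4 * Re (mangoldt_series (Complex x t)) + Re (mangoldt_series (Complex x (2*t))))"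
      by (intro sums_add sums_mult S)
    moreover have "0 \<le> 3 * Re (of_real (mangoldt n) * of_nat n powr (- Complex x 0)) + 4 * Re (of_real (mangoldt n) * of_nat n powr (- Complex x t))
        + Re (of_real (mangoldt n) * of_nat n powr (- Complex x (2*t)))" for n
    proof -
      have "0 \<le> mangoldt n * real n powr (-x) * (2 * (1 + cos (t * ln (real n)))\<^sup>2)"
        using mangoldt_nonneg by (intro mult_nonneg_nonneg) auto
      also have "2 * (1 + cos th)\<^sup>2 = 3 + 4 * cos th + cos (2 * th)" for th :: real
        unfolding cos_double_cos by (simp add: power2_eq_square algebra_simps)
      finally show ?thesis unfolding R by (simp add: algebra_simps)
    qed
    ultimately have "0 \<le> 3 * Re (mangoldt_series (Complex x 0)) + 4 * Re (mangoldt_series (Complex x t)) + Re (mangoldt_series (Complex x (2*t)))"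
      by (rule sums_le[OF _ sums_zero, rotated])
    hence "0 \<le> (x - 1) * (3 * Re (mangoldt_series (Complex x 0)) + 4 * Re (mangoldt_series (Complex x t)) + Re (mangoldt_series (Complex x (2*t))))"
      using elim by simp
    thus ?case by (simp add: algebra_simps)
  qed
  ultimately have "0 \<le> Re (3 * (1 - of_nat n0) + 4 * (0 - of_nat n1) + (0 - of_nat n2))"
    by (intro tendsto_lowerbound[where F = "at_right (1::real)"]) auto
  thus False using n0 n1 by simp
qed

lemma zeta_reg_nonzero:
  assumes "Re s \<ge> 1"
  shows "zeta_reg s \<noteq> 0"
proof (cases "Re s > 1")
  case False
  hence s: "s = Complex 1 (Im s)" using assms by (simp add: complex_eq_iff)
  show ?thesis
  proof (cases "Im s = 0")
    case True
    hence "s = 1" using s by (simp add: complex_eq_iff)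
    thus ?thesis by simp
  qed (use zeta_reg_nonzero_line[of "Im s"] s in auto)
qed (use zeta_reg_nonzero_Re_gt_1 in auto)

text \<open>
  The Tauberian theorem needs bounded coefficients. It is applied to \<open>chebyshev_psi n / n - 1\<close> because
  \<open>mangoldt n - 1\<close> is only bounded on average.
\<close>
lemma chebyshev_psi_error_sum_converges:
  "\<exists>L. (\<lambda>N. \<Sum>n=1..N. (chebyshev_psi n - real n) / (real n)\<^sup>2) \<longlonglongrightarrow> L"
proof -
  define a where "a = (\<lambda>n. complex_of_real ((chebyshev_psi n - real n) / real n))"
  have a_bd: "norm (a n) \<le> 4" for n
  proof (cases "n = 0")
    case False
    have "chebyshev_psi n - real n \<le> 4 * real n" "-(4 * real n) \<le> chebyshev_psi n - real n" using chebyshev_psi_le[of n] chebyshev_psi_nonneg[of n] by auto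
    thus ?thesis using False unfolding a_def norm_of_real abs_le_iff by (auto simp: field_simps)
  qed (auto simp: a_def)
  \<comment> \<open>\<open>W (s + 1)\<close> is the effect of replacing Abel's weights
    \<open>n powr (-s) - (n + 1) powr (-s)\<close> by \<open>s * n powr (- s - 1)\<close> in the sum
    over \<open>chebyshev_psi\<close>. It is holomorphic for Re s > 0, hence across the line Re s =
    1.\<close>
  obtain W where W: "W holomorphic_on {s. Re s > 1}" "\<And>s. Re s > 1 \<Longrightarrow> (\<lambda>n. of_real (chebyshev_psi (Suc n)) * zterm (Suc n) s) sums W s"
  proof (rule zterm_series[of "\<lambda>n. of_real (chebyshev_psi n)" 4 1])
    show "norm (complex_of_real (chebyshev_psi n)) \<le> 4 * real n powr 1" if "n \<ge> 1" for n
      using chebyshev_psi_le[of n] chebyshev_psi_nonneg[of n] that by simp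
  qed auto
  define Q where "Q = (\<lambda>s. if s = 1 then deriv zeta_reg 1 else (zeta_reg s - zeta_reg 1) / (s - 1))"
  have Q: "Q holomorphic_on {s. Re s > 0}"
    unfolding Q_def by (rule pole_lemma_open[OF zeta_reg_holomorphic open_halfspace_Re_gt])
  define S where "S = {s. Re s > 0} \<inter> zeta_reg -` (- {0})"
  have S: "open S"
    unfolding S_def using zeta_reg_holomorphic
    by (intro continuous_open_preimage holomorphic_on_imp_continuous_on open_halfspace_Re_gt) auto
  \<comment> \<open>This is \<open>(mangoldt_series s + W (s + 1)) / s - zeta_series s\<close> with
    the poles at 1 cancelled: \<open>1 / ((s - 1) * s) = 1 / (s - 1) - 1 / s\<close>, and
    \<open>zeta_series s = 1 / (s - 1) + Q s\<close>.\<close>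
  define G' where "G' = (\<lambda>s. - Q s - 1 / s - (deriv zeta_reg s / zeta_reg s - W (s + 1)) / s)"
  have G': "G' holomorphic_on S"
  proof -
    have hs: "Q holomorphic_on S" "zeta_reg holomorphic_on S" "deriv zeta_reg holomorphic_on S"
      using Q zeta_reg_holomorphic holomorphic_deriv[OF zeta_reg_holomorphic open_halfspace_Re_gt]
      by (auto simp: S_def intro: holomorphic_on_subset)
    have "W \<circ> (\<lambda>s. s + 1) holomorphic_on S"
      by (rule holomorphic_on_compose_gen[OF _ W(1)]) (auto simp: S_def intro!: holomorphic_intros)
    hence Ws: "(\<lambda>s. W (s + 1)) holomorphic_on S" by (simp add: o_def)
    show ?thesis
      unfolding G'_def
      by (intro holomorphic_on_diff holomorphic_on_minus holomorphic_on_divide holomorphic_on_ident holomorphic_on_const hs Ws)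
         (auto simp: S_def)
  qed
  define U where "U = (\<lambda>w. 1 + w) -` S"
  have U: "open U" unfolding U_def by (intro open_vimage S continuous_intros)
  define G where "G = (\<lambda>w. G' (1 + w))"
  have "G' \<circ> (\<lambda>w. 1 + w) holomorphic_on U"
    by (rule holomorphic_on_compose_gen[OF _ G']) (auto simp: U_def intro!: holomorphic_intros)
  hence G: "G holomorphic_on U" by (simp add: G_def o_def)
  have "{w. Re w \<ge> 0} \<subseteq> U"
    using zeta_reg_nonzero by (auto simp: U_def S_def)
  moreover have "(\<lambda>n. a n * of_nat n powr (-1 - w)) sums G w" if w: "Re w > 0" for w
  proof -
    define s where "s = 1 + w"
    have s: "Re s > 1" "s \<noteq> 0" "s \<noteq> 1" using w by (auto simp: s_def complex_eq_iff)
    have mangoldt_series_eq: "mangoldt_series s = 1 / (s - 1) - deriv zeta_reg s / zeta_reg s"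
      using zeta_reg_deriv[OF s(1)] zeta_reg_nonzero[of s] s by (simp add: field_simps)
    have z_eq: "zeta_series s = zeta_reg s / (s - 1)" using zeta_reg_eq[OF s(1)] s by simp
    \<comment> \<open>Abel summation; the boundary term vanishes because
      \<open>chebyshev_psi n\<close> is O(n) and Re s > 1.\<close>
    have "(\<lambda>n. \<Sum>k<n. of_real (chebyshev_psi (Suc k)) * (of_nat (Suc k) powr (-s) - of_nat (Suc (Suc k)) powr (-s))) \<longlonglongrightarrow> mangoldt_series s"
    proof -
      have eq: "(\<Sum>k<n. of_real (chebyshev_psi (Suc k)) * (of_nat (Suc k) powr (-s) - of_nat (Suc (Suc k)) powr (-s)))
         = (\<Sum>k<Suc n. of_real (mangoldt k) * of_nat k powr (-s)) - of_real (chebyshev_psi n) * of_nat (Suc n) powr (-s)" for n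
        by (induction n) (simp_all add: chebyshev_psi_Suc chebyshev_psi_def[of 0] algebra_simps del: of_nat_Suc)
      have "(\<lambda>n. \<Sum>k<n. of_real (mangoldt k) * of_nat k powr (-s)) \<longlonglongrightarrow> mangoldt_series s"
        using mangoldt_series_sums[OF s(1)] by (simp add: sums_def)
      hence "(\<lambda>n. \<Sum>k<Suc n. of_real (mangoldt k) * of_nat k powr (-s)) \<longlonglongrightarrow> mangoldt_series s"
        by (rule LIMSEQ_Suc)
      moreover have "(\<lambda>n. of_real (chebyshev_psi n) * of_nat (Suc n) powr (-s)) \<longlonglongrightarrow> 0"
      proof (rule Lim_null_comparison)
        show "\<forall>\<^sub>F n in sequentially. norm (of_real (chebyshev_psi n) * of_nat (Suc n) powr (-s)) \<le> 4 * norm (of_nat (Suc n) powr (1-s) :: complex)"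
        proof (intro always_eventually allI)
          fix n
          have "chebyshev_psi n \<le> 4 * real (Suc n)" using chebyshev_psi_le[of n] by simp
          hence "chebyshev_psi n * real (Suc n) powr (- Re s) \<le> 4 * real (Suc n) * real (Suc n) powr (- Re s)"
            by (intro mult_right_mono) auto
          also have "\<dots> = 4 * real (Suc n) powr (1 - Re s)"
            by (simp add: powr_diff powr_minus field_simps del: of_nat_Suc)
          finally show "norm (of_real (chebyshev_psi n) * of_nat (Suc n) powr (-s)) \<le> 4 * norm (of_nat (Suc n) powr (1-s) :: complex)"
            using chebyshev_psi_nonneg[of n] by (simp add: norm_mult norm_powr_real_powr del: of_nat_Suc)
        qed
        have "(\<lambda>n. of_nat (Suc n) powr (1 - s) :: complex) \<longlonglongrightarrow> 0"
          using s by (intro of_nat_powr_tendsto_0) auto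
        from tendsto_mult[OF tendsto_const[of 4] tendsto_norm[OF this]]
        show "(\<lambda>n. 4 * norm (of_nat (Suc n) powr (1-s) :: complex)) \<longlonglongrightarrow> 0" by simp
      qed
      ultimately have "(\<lambda>n. (\<Sum>k<Suc n. of_real (mangoldt k) * of_nat k powr (-s)) - of_real (chebyshev_psi n) * of_nat (Suc n) powr (-s)) \<longlonglongrightarrow> mangoldt_series s - 0"
        by (rule tendsto_diff)
      thus ?thesis unfolding eq by simp
    qed
    hence 1: "(\<lambda>k. of_real (chebyshev_psi (Suc k)) * (of_nat (Suc k) powr (-s) - of_nat (Suc (Suc k)) powr (-s))) sums mangoldt_series s"
      by (simp add: sums_def)
    have 2: "(\<lambda>k. of_real (chebyshev_psi (Suc k)) * zterm (Suc k) (s + 1)) sums W (s + 1)"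
      using s by (intro W(2)) auto
    have 3: "(\<lambda>k. of_nat (Suc k) powr (-s)) sums zeta_series s"
      using zeta_series_sums[OF s(1)] by (subst sums_Suc_iff) simp
    have "(\<lambda>k. (of_real (chebyshev_psi (Suc k)) * (of_nat (Suc k) powr (-s) - of_nat (Suc (Suc k)) powr (-s)) + of_real (chebyshev_psi (Suc k)) * zterm (Suc k) (s + 1)) / s
       - of_nat (Suc k) powr (-s)) sums ((mangoldt_series s + W (s + 1)) / s - zeta_series s)"
      by (intro sums_diff sums_divide sums_add 1 2 3)
    also have "(\<lambda>k. (of_real (chebyshev_psi (Suc k)) * (of_nat (Suc k) powr (-s) - of_nat (Suc (Suc k)) powr (-s)) + of_real (chebyshev_psi (Suc k)) * zterm (Suc k) (s + 1)) / s
       - of_nat (Suc k) powr (-s)) = (\<lambda>k. a (Suc k) * of_nat (Suc k) powr (-1 - w))"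
    proof
      fix k
      define m where "m = Suc k"
      have m: "of_nat m \<noteq> (0::complex)" by (simp add: m_def del: of_nat_Suc)
      have p1: "of_nat m powr (-1 - w) = (of_nat m powr (-s) :: complex)" by (simp add: s_def)
      have p2: "of_nat m powr (-(s + 1)) = (of_nat m powr (-s) / of_nat m :: complex)"
      proof -
        have e: "-(s + 1) = - s - 1" by simp
        show ?thesis unfolding e using m by (simp add: powr_diff)
      qed
      have "of_real (chebyshev_psi m) * (of_nat m powr (-s) - of_nat (Suc m) powr (-s)) + of_real (chebyshev_psi m) * zterm m (s + 1)
         = of_real (chebyshev_psi m) * (s * (of_nat m powr (-s) / of_nat m))"
        unfolding zterm_def p2 by (simp add: algebra_simps del: of_nat_Suc)
      hence "(of_real (chebyshev_psi m) * (of_nat m powr (-s) - of_nat (Suc m) powr (-s)) + of_real (chebyshev_psi m) * zterm m (s + 1)) / s - of_nat m powr (-s)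
         = a m * of_nat m powr (-1 - w)"
        using s m unfolding p1 by (simp add: a_def field_simps)
      thus "(of_real (chebyshev_psi (Suc k)) * (of_nat (Suc k) powr (-s) - of_nat (Suc (Suc k)) powr (-s)) + of_real (chebyshev_psi (Suc k)) * zterm (Suc k) (s + 1)) / s
       - of_nat (Suc k) powr (-s) = a (Suc k) * of_nat (Suc k) powr (-1 - w)"
        by (simp only: m_def)
    qed
    finally have "(\<lambda>n. a n * of_nat n powr (-1 - w)) sums ((mangoldt_series s + W (s + 1)) / s - zeta_series s)"
      by (subst (asm) sums_Suc_iff) simp
    also have "(mangoldt_series s + W (s + 1)) / s - zeta_series s = G w"
    proof -
      have "1 / (s - 1) / s = 1 / (s - 1) - 1 / s" using s by (simp add: field_simps)
      moreover have "Q s = zeta_reg s / (s - 1) - 1 / (s - 1)" using s by (simp add: Q_def diff_divide_distrib)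
      moreover have "G w = G' s" by (simp add: G_def s_def)
      moreover have "(mangoldt_series s + W (s + 1)) / s = 1 / (s - 1) / s - deriv zeta_reg s / zeta_reg s / s + W (s + 1) / s"
        unfolding mangoldt_series_eq by (simp add: add_divide_distrib diff_divide_distrib)
      ultimately show ?thesis
        unfolding z_eq G'_def by (simp add: diff_divide_distrib)
    qed
    finally show ?thesis .
  qed
  ultimately have "(\<lambda>N. \<Sum>n=1..N. a n / of_nat n) \<longlonglongrightarrow> G 0"
    by (intro newman_tauberian[OF a_bd U _ G])
  hence "(\<lambda>N. Re (\<Sum>n=1..N. a n / of_nat n)) \<longlonglongrightarrow> Re (G 0)" by (rule tendsto_Re)
  also have "(\<lambda>N. Re (\<Sum>n=1..N. a n / of_nat n)) = (\<lambda>N. \<Sum>n=1..N. (chebyshev_psi n - real n) / (real n)\<^sup>2)"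
  proof
    fix N
    have "(\<Sum>n=1..N. a n / of_nat n) = of_real (\<Sum>n=1..N. (chebyshev_psi n - real n) / (real n)\<^sup>2)"
      by (simp add: a_def power2_eq_square)
    thus "Re (\<Sum>n=1..N. a n / of_nat n) = (\<Sum>n=1..N. (chebyshev_psi n - real n) / (real n)\<^sup>2)"
      by (simp only: Re_complex_of_real)
  qed
  finally show ?thesis by blast
qed

text \<open>If \<open>chebyshev_psi N < (1 - e) * N\<close>, monotonicity keeps it that small for
  all n \<le> N, so every n between \<open>(1 - e/2) * N\<close> and \<open>N\<close> contributes at
  most \<open>- e / (2 * N)\<close> to the convergent sum. After rounding at least
  \<open>e * N / 4\<close> such n remain, so the sum drops by \<open>e\<^sup>2 / 8\<close>, against
  the Cauchy bound \<open>e\<^sup>2 / 16\<close>.\<close>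

theorem chebyshev_psi_lower_bound:
  assumes e: "0 < e" "e < 1"
  shows "eventually (\<lambda>N. chebyshev_psi N \<ge> (1 - e) * real N) sequentially"
proof -
  define f where "f = (\<lambda>N. \<Sum>n=1..N. (chebyshev_psi n - real n) / (real n)\<^sup>2)"
  have "Cauchy f" using chebyshev_psi_error_sum_converges unfolding f_def by (auto intro: LIMSEQ_imp_Cauchy)
  moreover have "e\<^sup>2 / 16 > 0" using e by simp
  ultimately obtain M where M: "\<And>m n. m \<ge> M \<Longrightarrow> n \<ge> M \<Longrightarrow> \<bar>f m - f n\<bar> < e\<^sup>2 / 16"
    unfolding Cauchy_def dist_real_def by blast
  have "chebyshev_psi N \<ge> (1 - e) * real N" if N: "N \<ge> 2 * M + 2" "real N \<ge> 8 / e" for N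
  proof (rule ccontr)
    assume "\<not> ?thesis"
    hence less: "chebyshev_psi N < (1 - e) * real N" by simp
    define m where "m = nat \<lceil>(1 - e/2) * real N\<rceil>"
    have m: "real m \<ge> (1 - e/2) * real N" "real m < (1 - e/2) * real N + 1"
      using e N by (auto simp: m_def) (smt (verit) mult_nonneg_nonneg of_nat_0_le_iff of_int_ceiling_le_add_one ceiling_correct)+
    have "e * real N \<ge> 8" using N e by (simp add: field_simps)
    hence "real m < real N" using m by (simp add: algebra_simps)
    hence mN: "m < N" by simp
    have "(1 - e/2) * real N \<ge> 1/2 * real N" using e by (intro mult_right_mono) auto
    hence mM: "m \<ge> M" using m N by linarith
    have "f N - f m = (\<Sum>n=Suc m..N. (chebyshev_psi n - real n) / (real n)\<^sup>2)"
    proof -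
      have "{1..N} = {1..m} \<union> {Suc m..N}" using mN by auto
      thus ?thesis unfolding f_def by (simp only:) (subst sum.union_disjoint, auto)
    qed
    also have "\<dots> \<le> (\<Sum>n=Suc m..N. - (e / 2 / real N))"
    proof (rule sum_mono)
      fix n assume n: "n \<in> {Suc m..N}"
      have "chebyshev_psi n \<le> chebyshev_psi N" using n by (intro chebyshev_psi_mono) auto
      moreover have "real n \<ge> real m" using n by auto
      ultimately have "chebyshev_psi n - real n \<le> - (e/2 * real N)" using less m by (simp add: algebra_simps)
      hence "(chebyshev_psi n - real n) / (real n)\<^sup>2 \<le> - (e/2 * real N) / (real n)\<^sup>2" by (intro divide_right_mono) auto
      also have "\<dots> = - ((e/2 * real N) / (real n)\<^sup>2)" by simp
      also have "(e/2 * real N) / (real n)\<^sup>2 \<ge> (e/2 * real N) / (real N)\<^sup>2"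
        using n e by (intro divide_left_mono mult_pos_pos power_mono) auto
      hence "- ((e/2 * real N) / (real n)\<^sup>2) \<le> - ((e/2 * real N) / (real N)\<^sup>2)" by simp
      also have "\<dots> = - (e / 2 / real N)" by (simp add: power2_eq_square)
      finally show "(chebyshev_psi n - real n) / (real n)\<^sup>2 \<le> - (e / 2 / real N)" .
    qed
    also have "\<dots> = - (real (N - m) * (e / 2 / real N))" by simp
    also have "real (N - m) \<ge> e/2 * real N - 1" using m mN by (simp add: algebra_simps of_nat_diff)
    hence "real (N - m) \<ge> e/4 * real N" using \<open>e * real N \<ge> 8\<close> by simp
    hence "real (N - m) * (e / 2 / real N) \<ge> (e/4 * real N) * (e / 2 / real N)"
      using e by (intro mult_right_mono) auto
    hence "- (real (N - m) * (e / 2 / real N)) \<le> - ((e/4 * real N) * (e / 2 / real N))" by simp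
    also have "(e/4 * real N) * (e / 2 / real N) = e\<^sup>2 / 8" using N by (simp add: power2_eq_square)
    finally have "f N - f m \<le> - (e\<^sup>2 / 8)" .
    moreover have "\<bar>f N - f m\<bar> < e\<^sup>2 / 16" using M[of N m] mM N by simp
    moreover have "e\<^sup>2 > 0" using e by simp
    ultimately show False by linarith
  qed
  thus ?thesis
    unfolding eventually_sequentially
    by (intro exI[of _ "max (2 * M + 2) (nat \<lceil>8 / e\<rceil>)"]) (auto simp: nat_le_iff ceiling_le_iff)
qed

section \<open>Selberg's sieve\<close>

lemma prod_one_plus_Pow:
  fixes f :: "'a \<Rightarrow> 'b :: comm_semiring_1"
  assumes "finite A"
  shows "(\<Prod>x\<in>A. 1 + f x) = (\<Sum>B\<in>Pow A. \<Prod>x\<in>B. f x)"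
  using assms
proof (induction A rule: finite_induct)
  case (insert a A)
  have "(\<Sum>B\<in>Pow (insert a A). \<Prod>x\<in>B. f x) = (\<Sum>B\<in>Pow A. \<Prod>x\<in>B. f x) + (\<Sum>B\<in>insert a ` Pow A. \<Prod>x\<in>B. f x)"
    unfolding Pow_insert using insert by (intro sum.union_disjoint) auto
  also have "(\<Sum>B\<in>insert a ` Pow A. \<Prod>x\<in>B. f x) = (\<Sum>B\<in>Pow A. \<Prod>x\<in>insert a B. f x)"
    using insert by (subst sum.reindex) (auto intro!: inj_onI simp: insert_eq_iff)
  also have "\<dots> = (\<Sum>B\<in>Pow A. f a * (\<Prod>x\<in>B. f x))"
    using insert by (intro sum.cong refl prod.insert) (auto intro: finite_subset)
  finally show ?case using insert by (simp add: sum_distrib_left[symmetric] distrib_right)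
qed simp

text \<open>Moebius inversion on a Boolean lattice: with \<open>A = T \<union> B\<close> the sum
  becomes a product of factors 1 - 1 over \<open>U - T\<close>.\<close>

lemma sum_alternating_between:
  assumes "finite U" "T \<subseteq> U"
  shows "(\<Sum>A | T \<subseteq> A \<and> A \<subseteq> U. (-1) ^ card A :: real) = (if T = U then (-1) ^ card T else 0)"
proof -
  have fin: "finite T" using assms finite_subset by blast
  have "(\<Sum>A | T \<subseteq> A \<and> A \<subseteq> U. (-1) ^ card A :: real) = (\<Sum>B\<in>Pow (U - T). (-1) ^ card (T \<union> B))"
    by (rule sum.reindex_bij_witness[where i = "\<lambda>B. T \<union> B" and j = "\<lambda>A. A - T"])
       (use assms in \<open>auto intro!: arg_cong[of _ _ "\<lambda>A. (-1) ^ card A"]\<close>)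
  also have "\<dots> = (\<Sum>B\<in>Pow (U - T). (-1) ^ card T * (\<Prod>x\<in>B. -1))"
  proof (rule sum.cong[OF refl])
    fix B assume "B \<in> Pow (U - T)"
    hence "card (T \<union> B) = card T + card B"
      using assms fin by (intro card_Un_disjoint) (auto intro: finite_subset)
    thus "(-1) ^ card (T \<union> B) = ((-1) ^ card T * (\<Prod>x\<in>B. -1) :: real)" by (simp add: power_add)
  qed
  also have "\<dots> = (-1) ^ card T * (\<Prod>x\<in>U - T. 1 + (-1))"
    using assms by (subst prod_one_plus_Pow) (auto simp: sum_distrib_left)
  also have "\<dots> = (if T = U then (-1) ^ card T else 0)"
    using assms by auto
  finally show ?thesis .
qed

text \<open>The extra 1 for \<open>r = 0\<close> is the number 0, which lies in that class but not
  in \<open>{1..N}\<close>.\<close>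

lemma card_residue_class:
  fixes m r N :: nat
  assumes "r < m"
  shows "card {n\<in>{1..N}. n mod m = r} + (if r = 0 then 1 else 0) = (N + (m - r)) div m"
proof (induction N)
  case 0
  show ?case using assms by auto
next
  case (Suc N)
  have eq: "(Suc (N + (m - r)) mod m = 0) = (Suc N mod m = r)"
  proof -
    have "(Suc (N + (m - r)) mod m = 0) \<longleftrightarrow> [Suc N + (m - r) = 0] (mod m)" by (simp add: cong_def)
    also have "\<dots> \<longleftrightarrow> [Suc N + (m - r) + r = 0 + r] (mod m)" by (rule cong_add_rcancel_nat[symmetric])
    also have "Suc N + (m - r) + r = Suc N + m" using assms by simp
    also have "[Suc N + m = 0 + r] (mod m) \<longleftrightarrow> Suc N mod m = r" using assms by (simp add: cong_def del: add_Suc)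
    finally show ?thesis .
  qed
  have "{n\<in>{1..Suc N}. n mod m = r} = (if Suc N mod m = r then insert (Suc N) {n\<in>{1..N}. n mod m = r} else {n\<in>{1..N}. n mod m = r})"
    by (auto simp: le_Suc_eq)
  hence "card {n\<in>{1..Suc N}. n mod m = r} = card {n\<in>{1..N}. n mod m = r} + (if Suc N mod m = r then 1 else 0)"
    by simp
  moreover have "Suc (N + (m - r)) div m = (N + (m - r)) div m + (if Suc N mod m = r then 1 else 0)"
    unfolding div_Suc eq by simp
  ultimately show ?case using Suc by simp
qed

lemma card_residue_class_approx:
  fixes m r N :: nat
  assumes "r < m"
  shows "\<bar>real (card {n\<in>{1..N}. n mod m = r}) - real N / real m\<bar> \<le> 1"
proof -
  define q where "q = (N + (m - r)) div m"
  have "q * m \<le> N + (m - r)" "N + (m - r) < (q + 1) * m"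
    using assms unfolding q_def by (auto simp: dividend_less_div_times)
  hence "real (q * m) \<le> real (N + (m - r))" "real (N + (m - r)) < real ((q + 1) * m)"
    by (auto simp only: of_nat_le_iff of_nat_less_iff)
  hence q: "real q * real m \<le> real N + real m - real r" "real N - real r < real q * real m"
    using assms by (auto simp: of_nat_diff algebra_simps)
  have m: "real m > 0" "real r < real m" using assms by auto
  have c: "real (card {n\<in>{1..N}. n mod m = r}) = real q - (if r = 0 then 1 else 0)"
    using card_residue_class[OF assms, of N] unfolding q_def by (auto split: if_splits)
  have "real q - 1 \<le> real N / real m - (if r = 0 then 0 else real r / real m)"
    "real N / real m - real r / real m \<le> real q"
    using q m by (auto simp: field_simps)
  moreover have "real r / real m \<le> 1" "real r / real m \<ge> 0" using m by auto
  moreover have "real q \<le> real N / real m + 1 - real r / real m"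
  proof -
    have "real q \<le> (real N + real m - real r) / real m" using q m by (simp add: pos_le_divide_eq)
    also have "\<dots> = real N / real m + 1 - real r / real m" using m by (simp add: add_divide_distrib diff_divide_distrib)
    finally show ?thesis .
  qed
  moreover have "r = 0 \<Longrightarrow> real N / real m - 1 \<le> real q - 1" using q m by (auto simp: field_simps)
  ultimately have "(if r = 0 then 1 else 0) \<le> real q - (real N / real m - 1)"
    "real q - (if r = 0 then 1 else 0) \<le> real N / real m + 1"
    "real N / real m - 1 \<le> real q - (if r = 0 then 1 else 0)"
    by (cases "r = 0"; simp; linarith)+
  thus ?thesis unfolding c by linarith
qed

lemma card_crt:
  fixes Om :: "nat \<Rightarrow> nat set"
  assumes "finite A" "\<And>p. p \<in> A \<Longrightarrow> prime p" "\<And>p. p \<in> A \<Longrightarrow> Om p \<subseteq> {..<p}"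
  shows "card {r\<in>{..<\<Prod>A}. \<forall>p\<in>A. r mod p \<in> Om p} = (\<Prod>p\<in>A. card (Om p))"
  using assms
proof (induction A rule: finite_induct)
  case (insert q A)
  define m where "m = \<Prod>A"
  have m: "m > 0" unfolding m_def using insert by (auto intro!: prod_pos simp: prime_gt_0_nat)
  have q: "prime q" using insert by auto
  have cop: "coprime m q"
    unfolding m_def using insert by (intro prod_coprime_left) (auto intro!: primes_coprime)
  define X where "X = {r\<in>{..<m}. \<forall>p\<in>A. r mod p \<in> Om p}"
  define Y where "Y = {r\<in>{..<m * q}. \<forall>p\<in>insert q A. r mod p \<in> Om p}"
  have mod_mod: "r mod m mod p = r mod p" if "p \<in> A" for r p
  proof -
    have "p dvd m" unfolding m_def using that insert by (intro dvd_prodI) auto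
    thus ?thesis by (rule mod_mod_cancel)
  qed
  have "bij_betw (\<lambda>r. (r mod m, r mod q)) Y (X \<times> Om q)"
  proof (rule bij_betwI')
    fix x y assume xy: "x \<in> Y" "y \<in> Y"
    show "((x mod m, x mod q) = (y mod m, y mod q)) = (x = y)"
    proof
      assume "(x mod m, x mod q) = (y mod m, y mod q)"
      hence "[x = y] (mod m)" "[x = y] (mod q)" by (auto simp: cong_def)
      hence "[x = y] (mod m * q)" using cop by (intro coprime_cong_mult_nat)
      thus "x = y" using xy by (auto simp: Y_def cong_def)
    qed auto
  next
    fix x assume "x \<in> Y"
    thus "(x mod m, x mod q) \<in> X \<times> Om q"
      using m mod_mod by (auto simp: Y_def X_def)
  next
    fix y assume y: "y \<in> X \<times> Om q"
    obtain a b where ab: "y = (a, b)" "a \<in> X" "b \<in> Om q" using y by auto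
    have b: "b < q" using ab insert.prems by auto
    have a: "a < m" using ab by (auto simp: X_def)
    obtain x where x: "x < m * q" "[x = a] (mod m)" "[x = b] (mod q)"
      using binary_chinese_remainder_unique_nat[OF cop, of a b] m q by (auto simp: prime_gt_0_nat)
    hence xm: "x mod m = a" "x mod q = b" using a b by (auto simp: cong_def)
    have "x \<in> Y"
      using x(1) xm ab mod_mod[of _ x] by (auto simp: Y_def X_def)
    thus "\<exists>x\<in>Y. y = (x mod m, x mod q)" using ab xm by auto
  qed
  from bij_betw_same_card[OF this] have "card Y = card X * card (Om q)"
    by (simp add: card_cartesian_product)
  thus ?case using insert by (simp add: X_def Y_def m_def mult.commute)
qed simp

text \<open>By the Chinese remainder theorem the conditions single out
  \<open>\<Prod>p\<in>A. card (Om p)\<close> classes modulo \<open>\<Prod>A\<close>, and each is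
  counted with error at most 1.\<close>

lemma card_sifted_class_approx:
  fixes Om :: "nat \<Rightarrow> nat set"
  assumes A: "finite A" "\<And>p. p \<in> A \<Longrightarrow> prime p" "\<And>p. p \<in> A \<Longrightarrow> Om p \<subseteq> {..<p}"
  shows "\<bar>real (card {n\<in>{1..N}. \<forall>p\<in>A. n mod p \<in> Om p}) - real N * (\<Prod>p\<in>A. real (card (Om p)) / real p)\<bar>
           \<le> (\<Prod>p\<in>A. real (card (Om p)))"
proof -
  define m where "m = \<Prod>A"
  have m: "m > 0" unfolding m_def using A by (auto intro!: prod_pos simp: prime_gt_0_nat)
  define X where "X = {r\<in>{..<m}. \<forall>p\<in>A. r mod p \<in> Om p}"
  have finX: "finite X" by (simp add: X_def)
  have cX: "real (card X) = (\<Prod>p\<in>A. real (card (Om p)))"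
    using card_crt[OF A] unfolding X_def m_def by (metis of_nat_prod)
  have mod_mod: "r mod m mod p = r mod p" if "p \<in> A" for r p
  proof -
    have "p dvd m" unfolding m_def using that A by (intro dvd_prodI) auto
    thus ?thesis by (rule mod_mod_cancel)
  qed
  have "{n\<in>{1..N}. \<forall>p\<in>A. n mod p \<in> Om p} = (\<Union>r\<in>X. {n\<in>{1..N}. n mod m = r})"
    using m mod_mod by (auto simp: X_def)
  hence "card {n\<in>{1..N}. \<forall>p\<in>A. n mod p \<in> Om p} = (\<Sum>r\<in>X. card {n\<in>{1..N}. n mod m = r})"
    using finX by (simp only:) (rule card_UN_disjoint, auto)
  moreover have "real N * (\<Prod>p\<in>A. real (card (Om p)) / real p) = (\<Sum>r\<in>X. real N / real m)"
    by (simp add: cX prod_dividef m_def)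
  ultimately have "\<bar>real (card {n\<in>{1..N}. \<forall>p\<in>A. n mod p \<in> Om p}) - real N * (\<Prod>p\<in>A. real (card (Om p)) / real p)\<bar>
      = \<bar>\<Sum>r\<in>X. (real (card {n\<in>{1..N}. n mod m = r}) - real N / real m)\<bar>"
    by (simp add: sum_subtractf)
  also have "\<dots> \<le> (\<Sum>r\<in>X. 1)"
    by (rule order_trans[OF sum_abs]) (intro sum_mono card_residue_class_approx, auto simp: X_def)
  finally show ?thesis by (simp add: cX)
qed

text \<open>
  Squarefree numbers composed of sieving primes are represented by the sets of their prime factors, so that
  lcm and gcd become union and intersection.
\<close>
locale selberg_sieve =
  fixes P :: "nat set" and Om :: "nat \<Rightarrow> nat set" and z :: real
  assumes finP: "finite P" and primeP: "\<And>p. p \<in> P \<Longrightarrow> prime p"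
    and Om_sub: "\<And>p. p \<in> P \<Longrightarrow> Om p \<subseteq> {..<p}"
    and Om_pos: "\<And>p. p \<in> P \<Longrightarrow> card (Om p) > 0"
    and Om_less: "\<And>p. p \<in> P \<Longrightarrow> card (Om p) < p"
    and z: "z \<ge> 1"
begin

definition "\<D> = {A. A \<subseteq> P \<and> real (\<Prod>A) \<le> z}"
definition "h A = (\<Prod>p\<in>A. real (card (Om p)) / real p)"
definition "g A = (\<Prod>p\<in>A. real (card (Om p)) / (real p - real (card (Om p))))"
definition "L = (\<Sum>A\<in>\<D>. g A)"
text \<open>With y_T the sum of \<open>selberg_weight A * h A\<close> over the members A \<supseteq>
  T of \<open>\<D>\<close>, the quadratic form of the sieve is the sum of y_T^2 /
  \<open>g T\<close>. Under the normalisation \<open>selberg_weight {} = 1\<close> it is minimal for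
  y_T = (-1)^|T| \<open>g T / L\<close>, and Moebius inversion of that choice gives this
  formula.\<close>

definition "selberg_weight A = (-1) ^ card A * (1 / h A) * (\<Sum>T | T \<in> \<D> \<and> A \<subseteq> T. g T) / L"

lemma finD: "finite \<D>"
  unfolding \<D>_def by (rule finite_subset[of _ "Pow P"]) (use finP in auto)

lemma D_subset: "A \<in> \<D> \<Longrightarrow> A \<subseteq> P"
  by (auto simp: \<D>_def)

lemma D_finite: "A \<in> \<D> \<Longrightarrow> finite A"
  using D_subset finP finite_subset by blast

lemma D_down: "A \<in> \<D> \<Longrightarrow> B \<subseteq> A \<Longrightarrow> B \<in> \<D>"
proof -
  assume A: "A \<in> \<D>" "B \<subseteq> A"
  have "\<Prod>B dvd \<Prod>A" using A D_finite by (intro prod_dvd_prod_subset) auto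
  moreover have "\<Prod>A > 0" using A D_subset primeP by (intro prod_pos) (metis prime_gt_0_nat subsetD)
  ultimately have "\<Prod>B \<le> \<Prod>A" by (intro dvd_imp_le)
  hence "real (\<Prod>B) \<le> real (\<Prod>A)" by (simp only: of_nat_le_iff)
  thus ?thesis using A by (auto simp: \<D>_def simp del: of_nat_prod)
qed

lemma empty_D: "{} \<in> \<D>"
  using z by (auto simp: \<D>_def)

lemma h_pos: "A \<subseteq> P \<Longrightarrow> h A > 0"
  unfolding h_def using Om_pos primeP by (intro prod_pos divide_pos_pos) (auto simp: prime_gt_0_nat subset_iff)

lemma g_pos: "A \<subseteq> P \<Longrightarrow> g A > 0"
  unfolding g_def using Om_pos Om_less by (intro prod_pos divide_pos_pos) (auto simp: subset_iff)

lemma L_ge_1: "L \<ge> 1"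
proof -
  have "g {} \<le> L" unfolding L_def
    using finD empty_D by (intro member_le_sum) (auto intro!: less_imp_le[OF g_pos] D_subset)
  thus ?thesis by (simp add: g_def)
qed

lemma inverse_h: "A \<subseteq> P \<Longrightarrow> 1 / h A = (\<Sum>T\<in>Pow A. 1 / g T)"
proof -
  assume A: "A \<subseteq> P"
  have "1 / h A = (\<Prod>p\<in>A. 1 + (real p - real (card (Om p))) / real (card (Om p)))"
    unfolding h_def prod_dividef[symmetric, of "\<lambda>_. 1", simplified]
  proof (rule prod.cong[OF refl])
    fix p assume "p \<in> A"
    thus "1 / (real (card (Om p)) / real p) = 1 + (real p - real (card (Om p))) / real (card (Om p))"
      using A Om_pos[of p] by (auto simp: field_simps)
  qed
  also have "\<dots> = (\<Sum>T\<in>Pow A. \<Prod>p\<in>T. (real p - real (card (Om p))) / real (card (Om p)))"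
    using A finP finite_subset by (intro prod_one_plus_Pow) auto
  also have "\<dots> = (\<Sum>T\<in>Pow A. 1 / g T)"
    by (simp add: g_def prod_dividef)
  finally show ?thesis .
qed

lemma g_over_h: "A \<subseteq> P \<Longrightarrow> (\<Sum>B\<in>Pow A. g B) = g A / h A"
proof -
  assume A: "A \<subseteq> P"
  have "(\<Sum>B\<in>Pow A. g B) = (\<Prod>p\<in>A. 1 + real (card (Om p)) / (real p - real (card (Om p))))"
    unfolding g_def using A finP finite_subset by (intro prod_one_plus_Pow[symmetric]) auto
  also have "\<dots> = (\<Prod>p\<in>A. (real (card (Om p)) / (real p - real (card (Om p)))) / (real (card (Om p)) / real p))"
  proof (rule prod.cong[OF refl])
    fix p assume "p \<in> A"
    hence "0 < card (Om p)" "card (Om p) < p" using A Om_pos[of p] Om_less[of p] by auto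
    thus "1 + real (card (Om p)) / (real p - real (card (Om p))) =
        (real (card (Om p)) / (real p - real (card (Om p)))) / (real (card (Om p)) / real p)"
      by (simp add: field_simps)
  qed
  also have "\<dots> = g A / h A" unfolding g_def h_def by (rule prod_dividef)
  finally show ?thesis .
qed

lemma g_Un: "A \<subseteq> P \<Longrightarrow> B \<subseteq> P \<Longrightarrow> A \<inter> B = {} \<Longrightarrow> g (A \<union> B) = g A * g B"
  unfolding g_def using finP finite_subset by (intro prod.union_disjoint) blast+

text \<open>Up to sign, \<open>L\<close> times the weight is \<open>g A / h A\<close> times the sum
  of \<open>g U\<close> over the U disjoint from A with \<open>A \<union> U \<in> \<D>\<close>. As
  \<open>g A / h A\<close> is the sum of \<open>g B\<close> over \<open>B \<subseteq> A\<close>, the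
  product runs over distinct members \<open>B \<union> U\<close> of \<open>\<D>\<close> and is a
  part of \<open>L\<close>.\<close>

lemma lambda_le_1:
  assumes A: "A \<in> \<D>"
  shows "\<bar>selberg_weight A\<bar> \<le> 1"
proof -
  have AP: "A \<subseteq> P" using A by (rule D_subset)
  define X where "X = {U. U \<inter> A = {} \<and> A \<union> U \<in> \<D>}"
  have XP: "U \<subseteq> P" if "U \<in> X" for U using that D_subset by (auto simp: X_def)
  have finX: "finite X" by (rule finite_subset[of _ "Pow P"]) (use XP finP in auto)
  have "(\<Sum>T | T \<in> \<D> \<and> A \<subseteq> T. g T) = (\<Sum>U\<in>X. g (A \<union> U))"
    by (rule sum.reindex_bij_witness[where i = "\<lambda>U. A \<union> U" and j = "\<lambda>T. T - A"])
       (auto simp: X_def intro!: arg_cong[of _ _ g] simp: Un_absorb1)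
  also have "\<dots> = (\<Sum>U\<in>X. g A * g U)"
    using AP XP by (intro sum.cong refl g_Un) (auto simp: X_def)
  finally have 1: "(\<Sum>T | T \<in> \<D> \<and> A \<subseteq> T. g T) = g A * (\<Sum>U\<in>X. g U)" by (simp add: sum_distrib_left)
  have "g A / h A * (\<Sum>U\<in>X. g U) = (\<Sum>B\<in>Pow A. \<Sum>U\<in>X. g B * g U)"
    unfolding g_over_h[OF AP, symmetric] by (simp add: sum_product)
  also have "\<dots> = (\<Sum>(B, U)\<in>Pow A \<times> X. g B * g U)"
    by (rule sum.cartesian_product)
  also have "\<dots> = (\<Sum>(B, U)\<in>Pow A \<times> X. g (B \<union> U))"
    using AP XP by (intro sum.cong refl) (auto simp: X_def intro!: g_Un[symmetric])
  also have "\<dots> = (\<Sum>T\<in>(\<lambda>(B, U). B \<union> U) ` (Pow A \<times> X). g T)"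
  proof (subst sum.reindex)
    show "inj_on (\<lambda>(B, U). B \<union> U) (Pow A \<times> X)"
      by (auto simp: inj_on_def X_def)
  qed (auto intro!: sum.cong)
  also have "\<dots> \<le> L"
    unfolding L_def
  proof (rule sum_mono2[OF finD])
    show "(\<lambda>(B, U). B \<union> U) ` (Pow A \<times> X) \<subseteq> \<D>"
      by (auto simp: X_def elim!: D_down)
  qed (auto intro!: less_imp_le[OF g_pos] D_subset)
  finally have "g A / h A * (\<Sum>U\<in>X. g U) \<le> L" .
  moreover have "g A / h A * (\<Sum>U\<in>X. g U) \<ge> 0"
    using g_pos[OF AP] h_pos[OF AP] XP by (intro mult_nonneg_nonneg sum_nonneg) (auto intro!: less_imp_le[OF g_pos])
  moreover have "\<bar>selberg_weight A\<bar> = \<bar>g A / h A * (\<Sum>U\<in>X. g U)\<bar> / L"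
    unfolding selberg_weight_def 1 using L_ge_1 by (simp add: abs_mult power_abs)
  moreover have "\<bar>y\<bar> / L \<le> 1" if "0 \<le> y" "y \<le> L" for y using that L_ge_1 by simp
  ultimately show ?thesis by metis
qed

lemma lambda_empty: "selberg_weight {} = 1"
  using L_ge_1 by (simp add: selberg_weight_def h_def L_def)

text \<open>Exchanging the sums leaves an alternating sum over
  \<open>T \<subseteq> A \<subseteq> U\<close>, which vanishes unless \<open>U = T\<close>.\<close>

lemma diagonal:
  assumes T: "T \<in> \<D>"
  shows "(\<Sum>A | A \<in> \<D> \<and> T \<subseteq> A. selberg_weight A * h A) = (-1) ^ card T * g T / L"
proof -
  have "(\<Sum>A | A \<in> \<D> \<and> T \<subseteq> A. selberg_weight A * h A) = (\<Sum>A | A \<in> \<D> \<and> T \<subseteq> A. \<Sum>U | U \<in> \<D> \<and> A \<subseteq> U. (-1) ^ card A * (g U / L))"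
  proof (rule sum.cong[OF refl])
    fix A assume "A \<in> {A \<in> \<D>. T \<subseteq> A}"
    hence "h A > 0" using D_subset h_pos by auto
    thus "selberg_weight A * h A = (\<Sum>U | U \<in> \<D> \<and> A \<subseteq> U. (-1) ^ card A * (g U / L))"
      unfolding selberg_weight_def sum_distrib_left[symmetric] sum_divide_distrib[symmetric] by simp
  qed
  also have "\<dots> = (\<Sum>U | U \<in> \<D> \<and> T \<subseteq> U. \<Sum>A | A \<in> \<D> \<and> T \<subseteq> A \<and> A \<subseteq> U. (-1) ^ card A * (g U / L))"
  proof -
    have "(\<Sum>A | A \<in> \<D> \<and> T \<subseteq> A. \<Sum>U | U \<in> \<D> \<and> A \<subseteq> U. (-1) ^ card A * (g U / L))
      = (\<Sum>U\<in>\<D>. \<Sum>A\<in>{A \<in> {A. A \<in> \<D> \<and> T \<subseteq> A}. A \<subseteq> U}. (-1) ^ card A * (g U / L))"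
      using finD by (intro sum.swap_restrict) auto
    also have "\<dots> = (\<Sum>U | U \<in> \<D> \<and> T \<subseteq> U. \<Sum>A\<in>{A \<in> {A. A \<in> \<D> \<and> T \<subseteq> A}. A \<subseteq> U}. (-1) ^ card A * (g U / L))"
      using finD by (intro sum.mono_neutral_right ballI sum.neutral) auto
    finally show ?thesis by (simp add: conj_ac)
  qed
  also have "\<dots> = (\<Sum>U | U \<in> \<D> \<and> T \<subseteq> U. if T = U then (-1) ^ card T * (g U / L) else 0)"
  proof (rule sum.cong[OF refl])
    fix U assume U: "U \<in> {U \<in> \<D>. T \<subseteq> U}"
    have "{A \<in> \<D>. T \<subseteq> A \<and> A \<subseteq> U} = {A. T \<subseteq> A \<and> A \<subseteq> U}" using U by (auto intro: D_down)
    hence "(\<Sum>A | A \<in> \<D> \<and> T \<subseteq> A \<and> A \<subseteq> U. (-1) ^ card A * (g U / L)) = (\<Sum>A | T \<subseteq> A \<and> A \<subseteq> U. (-1) ^ card A) * (g U / L)"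
      by (simp only: sum_distrib_right)
    also have "\<dots> = (if T = U then (-1) ^ card T * (g U / L) else 0)"
      using U D_finite by (subst sum_alternating_between) auto
    finally show "(\<Sum>A | A \<in> \<D> \<and> T \<subseteq> A \<and> A \<subseteq> U. (-1) ^ card A * (g U / L)) = (if T = U then (-1) ^ card T * (g U / L) else 0)" .
  qed
  also have "\<dots> = (-1) ^ card T * g T / L"
    using T finD by (subst sum.delta') auto
  finally show ?thesis .
qed

text \<open>\<open>h (A \<union> B) = h A * h B / h (A \<inter> B)\<close>, and expanding
  \<open>1 / h (A \<inter> B)\<close> over subsets T by \<open>inverse_h\<close> turns the form into
  a sum of squares, one for each T, which \<open>diagonal\<close> evaluates.\<close>

lemma quadratic_form:
  "(\<Sum>A\<in>\<D>. \<Sum>B\<in>\<D>. selberg_weight A * selberg_weight B * h (A \<union> B)) = 1 / L"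
proof -
  have hU: "h (A \<union> B) = h A * h B * (\<Sum>T | T \<in> \<D> \<and> T \<subseteq> A \<and> T \<subseteq> B. 1 / g T)" if "A \<in> \<D>" "B \<in> \<D>" for A B
  proof -
    have AP: "A \<subseteq> P" "B \<subseteq> P" using that D_subset by auto
    have "h (A \<union> B) * h (A \<inter> B) = h A * h B"
      unfolding h_def using that D_finite by (intro prod.union_inter) auto
    moreover have "h (A \<inter> B) > 0" using AP by (intro h_pos) auto
    ultimately have "h (A \<union> B) = h A * h B * (1 / h (A \<inter> B))" by (simp add: field_simps)
    also have "1 / h (A \<inter> B) = (\<Sum>T\<in>Pow (A \<inter> B). 1 / g T)" using AP by (intro inverse_h) auto
    also have "Pow (A \<inter> B) = {T. T \<in> \<D> \<and> T \<subseteq> A \<and> T \<subseteq> B}" using that by (auto intro: D_down)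
    finally show ?thesis .
  qed
  have "(\<Sum>A\<in>\<D>. \<Sum>B\<in>\<D>. selberg_weight A * selberg_weight B * h (A \<union> B)) =
     (\<Sum>A\<in>\<D>. \<Sum>B\<in>\<D>. \<Sum>T\<in>\<D>. if T \<subseteq> A \<and> T \<subseteq> B then selberg_weight A * h A * (selberg_weight B * h B) / g T else 0)"
    by (intro sum.cong refl) (subst hU, auto simp: sum_distrib_left sum.inter_filter[OF finD] intro!: sum.cong)
  also have "\<dots> = (\<Sum>A\<in>\<D>. \<Sum>T\<in>\<D>. \<Sum>B\<in>\<D>. if T \<subseteq> A \<and> T \<subseteq> B then selberg_weight A * h A * (selberg_weight B * h B) / g T else 0)"
    by (intro sum.cong refl sum.swap)
  also have "\<dots> = (\<Sum>T\<in>\<D>. \<Sum>A\<in>\<D>. \<Sum>B\<in>\<D>. if T \<subseteq> A \<and> T \<subseteq> B then selberg_weight A * h A * (selberg_weight B * h B) / g T else 0)"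
    by (rule sum.swap)
  also have "\<dots> = (\<Sum>T\<in>\<D>. 1 / g T * (\<Sum>A | A \<in> \<D> \<and> T \<subseteq> A. selberg_weight A * h A)\<^sup>2)"
  proof (rule sum.cong[OF refl])
    fix T
    have "1 / g T * (\<Sum>A | A \<in> \<D> \<and> T \<subseteq> A. selberg_weight A * h A)\<^sup>2 = 
      1 / g T * ((\<Sum>A\<in>\<D>. if T \<subseteq> A then selberg_weight A * h A else 0) * (\<Sum>B\<in>\<D>. if T \<subseteq> B then selberg_weight B * h B else 0))"
      unfolding power2_eq_square by (simp add: sum.inter_filter[OF finD])
    also have "\<dots> = (\<Sum>A\<in>\<D>. \<Sum>B\<in>\<D>. if T \<subseteq> A \<and> T \<subseteq> B then selberg_weight A * h A * (selberg_weight B * h B) / g T else 0)"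
      by (subst sum_product, subst sum_distrib_left, subst sum_distrib_left) (intro sum.cong refl, auto)
    finally show "(\<Sum>A\<in>\<D>. \<Sum>B\<in>\<D>. if T \<subseteq> A \<and> T \<subseteq> B then selberg_weight A * h A * (selberg_weight B * h B) / g T else 0)
       = 1 / g T * (\<Sum>A | A \<in> \<D> \<and> T \<subseteq> A. selberg_weight A * h A)\<^sup>2" ..
  qed
  also have "\<dots> = (\<Sum>T\<in>\<D>. g T / L\<^sup>2)"
  proof (rule sum.cong[OF refl])
    fix T assume T: "T \<in> \<D>"
    have "g T > 0" using T D_subset g_pos by auto
    thus "1 / g T * (\<Sum>A | A \<in> \<D> \<and> T \<subseteq> A. selberg_weight A * h A)\<^sup>2 = g T / L\<^sup>2"
      unfolding diagonal[OF T] by (simp add: power_divide power_mult_distrib power2_eq_square)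
  qed
  also have "\<dots> = 1 / L"
    using L_ge_1 unfolding sum_divide_distrib[symmetric] by (simp add: L_def[symmetric] power2_eq_square)
  finally show ?thesis .
qed

text \<open>The indicator of the sifted set is dominated by the square of the sum of the weights of
  those \<open>A\<close> that hit \<open>n\<close>. Expanding yields \<open>quadratic_form\<close>
  as main term; the errors are summed trivially, the weights being at most 1 in modulus.\<close>

theorem selberg_bound:
  assumes K: "\<And>p. p \<in> P \<Longrightarrow> card (Om p) \<le> K"
  shows "real (card {n\<in>{1..N}. \<forall>p\<in>P. n mod p \<notin> Om p}) \<le> real N / L + (\<Sum>A\<in>\<D>. real K ^ card A)\<^sup>2"
proof -
  define hit where "hit A n \<longleftrightarrow> (\<forall>p\<in>A. n mod p \<in> Om p)" for A :: "nat set" and n :: nat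
  define S where "S = {n\<in>{1..N}. \<forall>p\<in>P. n mod p \<notin> Om p}"
  have fS: "finite S" by (simp add: S_def)
  have "real (card S) = (\<Sum>n\<in>S. (\<Sum>A\<in>\<D>. if hit A n then selberg_weight A else 0)\<^sup>2)"
  proof -
    have "(\<Sum>A\<in>\<D>. if hit A n then selberg_weight A else 0) = 1" if n: "n \<in> S" for n
    proof -
      have "hit A n \<longleftrightarrow> A = {}" if "A \<in> \<D>" for A
        using n D_subset[OF that] by (auto simp: hit_def S_def)
      hence "(\<Sum>A\<in>\<D>. if hit A n then selberg_weight A else 0) = (\<Sum>A\<in>\<D>. if A = {} then selberg_weight A else 0)"
        by (intro sum.cong) auto
      thus ?thesis using finD empty_D lambda_empty by (simp add: sum.delta)
    qed
    thus ?thesis by simp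
  qed
  also have "\<dots> \<le> (\<Sum>n\<in>{1..N}. (\<Sum>A\<in>\<D>. if hit A n then selberg_weight A else 0)\<^sup>2)"
    by (intro sum_mono2) (auto simp: S_def)
  also have "\<dots> = (\<Sum>n\<in>{1..N}. \<Sum>A\<in>\<D>. \<Sum>B\<in>\<D>. selberg_weight A * selberg_weight B * (if hit (A \<union> B) n then 1 else 0))"
    unfolding power2_eq_square sum_product by (intro sum.cong refl) (auto simp: hit_def)
  also have "\<dots> = (\<Sum>A\<in>\<D>. \<Sum>n\<in>{1..N}. \<Sum>B\<in>\<D>. selberg_weight A * selberg_weight B * (if hit (A \<union> B) n then 1 else 0))"
    by (rule sum.swap)
  also have "\<dots> = (\<Sum>A\<in>\<D>. \<Sum>B\<in>\<D>. \<Sum>n\<in>{1..N}. selberg_weight A * selberg_weight B * (if hit (A \<union> B) n then 1 else 0))"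
    by (intro sum.cong refl sum.swap)
  also have "\<dots> = (\<Sum>A\<in>\<D>. \<Sum>B\<in>\<D>. selberg_weight A * selberg_weight B * real (card {n\<in>{1..N}. hit (A \<union> B) n}))"
    unfolding sum_distrib_left[symmetric] by (intro sum.cong refl) (simp add: sum.inter_filter[symmetric])
  also have "\<dots> \<le> (\<Sum>A\<in>\<D>. \<Sum>B\<in>\<D>. selberg_weight A * selberg_weight B * (real N * h (A \<union> B)) + real K ^ card A * real K ^ card B)"
  proof (intro sum_mono)
    fix A B assume AB: "A \<in> \<D>" "B \<in> \<D>"
    define c where "c = real (card {n\<in>{1..N}. hit (A \<union> B) n})"
    have ABP: "A \<subseteq> P" "B \<subseteq> P" "finite A" "finite B" using AB D_subset D_finite by auto
    have "\<bar>c - real N * h (A \<union> B)\<bar> \<le> (\<Prod>p\<in>A \<union> B. real (card (Om p)))"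
      unfolding c_def hit_def h_def using ABP primeP Om_sub
      by (intro card_sifted_class_approx) blast+
    \<comment> \<open>Multiplying by the product over the intersection, which is at least 1, makes
      the error bound separate in \<open>A\<close> and \<open>B\<close>.\<close>
    also have "\<dots> \<le> (\<Prod>p\<in>A \<union> B. real (card (Om p))) * (\<Prod>p\<in>A \<inter> B. real (card (Om p)))"
    proof -
      have "(\<Prod>p\<in>A \<inter> B. real (card (Om p))) \<ge> 1"
        using ABP Om_pos by (intro prod_ge_1) (auto simp: subset_iff Suc_le_eq)
      from mult_left_mono[OF this, of "\<Prod>p\<in>A \<union> B. real (card (Om p))"] show ?thesis by (simp add: prod_nonneg)
    qed
    also have "\<dots> = (\<Prod>p\<in>A. real (card (Om p))) * (\<Prod>p\<in>B. real (card (Om p)))"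
      using ABP by (intro prod.union_inter) auto
    also have "\<dots> \<le> (\<Prod>p\<in>A. real K) * (\<Prod>p\<in>B. real K)"
      using ABP K by (intro mult_mono prod_mono) (auto intro!: prod_nonneg)
    finally have bd: "\<bar>c - real N * h (A \<union> B)\<bar> \<le> real K ^ card A * real K ^ card B" by simp
    have "selberg_weight A * selberg_weight B * (c - real N * h (A \<union> B)) \<le> \<bar>selberg_weight A\<bar> * \<bar>selberg_weight B\<bar> * \<bar>c - real N * h (A \<union> B)\<bar>"
      by (metis abs_ge_self abs_mult)
    also have "\<dots> \<le> 1 * 1 * \<bar>c - real N * h (A \<union> B)\<bar>"
      using AB lambda_le_1 by (intro mult_right_mono mult_mono) auto
    also have "\<dots> \<le> real K ^ card A * real K ^ card B" using bd by simp
    finally show "selberg_weight A * selberg_weight B * real (card {n\<in>{1..N}. hit (A \<union> B) n}) \<le> selberg_weight A * selberg_weight B * (real N * h (A \<union> B)) + real K ^ card A * real K ^ card B"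
      unfolding c_def by (simp add: right_diff_distrib)
  qed
  also have "\<dots> = real N * (\<Sum>A\<in>\<D>. \<Sum>B\<in>\<D>. selberg_weight A * selberg_weight B * h (A \<union> B)) + (\<Sum>A\<in>\<D>. real K ^ card A)\<^sup>2"
    unfolding power2_eq_square sum_product by (simp add: sum.distrib sum_distrib_left mult_ac)
  also have "\<dots> = real N / L + (\<Sum>A\<in>\<D>. real K ^ card A)\<^sup>2"
    unfolding quadratic_form by simp
  finally show ?thesis unfolding S_def .
qed

end

section \<open>The density sum of the sieve\<close>

definition rough :: "nat set \<Rightarrow> real \<Rightarrow> nat set" where
  "rough Q w = {m. 1 \<le> m \<and> real m \<le> w \<and> (\<forall>p\<in>Q. \<not> p dvd m)}"

lemma finite_rough [simp]: "finite (rough Q w)"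
proof (rule finite_subset)
  show "rough Q w \<subseteq> {..nat \<lfloor>w\<rfloor>}" by (auto simp: rough_def le_nat_floor)
qed auto

text \<open>
  The sum of \<open>1 / (n\<^sub>1 ... n\<^sub>k)\<close> over the tuples with product at most \<open>w\<close> that have no entry divisible by
  a prime in \<open>Q\<close>.
\<close>
fun harmonic_tuple_sum :: "nat set \<Rightarrow> nat \<Rightarrow> real \<Rightarrow> real" where
  "harmonic_tuple_sum Q 0 w = 1"
| "harmonic_tuple_sum Q (Suc k) w = (\<Sum>m\<in>rough Q w. 1 / real m * harmonic_tuple_sum Q k (w / real m))"

lemma harmonic_tuple_sum_nonneg: "harmonic_tuple_sum Q k w \<ge> 0"
  by (induction k arbitrary: w) (auto intro!: sum_nonneg)

lemma harmonic_tuple_sum_mono: "w \<le> w' \<Longrightarrow> harmonic_tuple_sum Q k w \<le> harmonic_tuple_sum Q k w'"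
proof (induction k arbitrary: w w')
  case (Suc k)
  have "harmonic_tuple_sum Q (Suc k) w \<le> (\<Sum>m\<in>rough Q w. 1 / real m * harmonic_tuple_sum Q k (w' / real m))"
    unfolding harmonic_tuple_sum.simps
    using Suc by (intro sum_mono mult_left_mono) (auto intro!: Suc.IH divide_right_mono)
  also have "\<dots> \<le> harmonic_tuple_sum Q (Suc k) w'"
    unfolding harmonic_tuple_sum.simps
    using Suc.prems by (intro sum_mono2 finite_rough) (auto simp: rough_def intro!: divide_nonneg_nonneg harmonic_tuple_sum_nonneg)
  finally show ?case .
qed simp

lemma power_diff_le:
  fixes a b :: real
  assumes "0 \<le> b" "b \<le> a"
  shows "a ^ Suc k - b ^ Suc k \<le> real (Suc k) * a ^ k * (a - b)"
proof (induction k)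
  case (Suc k)
  have "a ^ Suc (Suc k) - b ^ Suc (Suc k) = a * (a ^ Suc k - b ^ Suc k) + b ^ Suc k * (a - b)"
    by (simp add: algebra_simps)
  also have "\<dots> \<le> a * (real (Suc k) * a ^ k * (a - b)) + a ^ Suc k * (a - b)"
    using assms by (intro add_mono mult_left_mono Suc mult_right_mono power_mono) auto
  also have "\<dots> = real (Suc (Suc k)) * a ^ Suc k * (a - b)"
    by (simp add: algebra_simps)
  finally show ?case .
qed simp

text \<open>Discrete form of the integral of ln(w/t)^k / t from 1 to w: the differences of
  \<open>ln (w / m) ^ Suc k\<close> telescope and are bounded by
  \<open>power_diff_le\<close>.\<close>

lemma sum_ln_power_ge:
  fixes w :: real
  assumes w: "w \<ge> 1"
  shows "ln w ^ Suc k / real (Suc k) \<le> (\<Sum>m\<in>rough {} w. 1 / real m * ln (w / real m) ^ k)"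
proof -
  define M where "M = nat \<lfloor>w\<rfloor>"
  have M: "real M \<le> w" "w < real M + 1" "M \<ge> 1"
    using w unfolding M_def by linarith+
  have R: "rough {} w = {1..M}"
    using M by (auto simp: rough_def)
  \<comment> \<open>The cut-off makes \<open>f\<close> vanish at the first integer beyond
    \<open>w\<close>, where the logarithm is negative, so that nothing is left at the upper end of
    the telescope.\<close>
  define f where "f m = max 0 (ln (w / real m)) ^ Suc k" for m
  have tel: "f 1 - f (Suc M) = (\<Sum>m=1..M. f m - f (Suc m))" for M
    by (induction M) auto
  have "f 1 - f (Suc M) = (\<Sum>m=1..M. f m - f (Suc m))" by (rule tel)
  also have "\<dots> \<le> (\<Sum>m=1..M. real (Suc k) * (1 / real m * ln (w / real m) ^ k))"
  proof (rule sum_mono)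
    fix m assume m: "m \<in> {1..M}"
    hence mw: "real m \<le> w" "real m > 0" using M by auto
    define a where "a = ln (w / real m)"
    define b where "b = max 0 (ln (w / real (Suc m)))"
    have a0: "a \<ge> 0" using mw by (auto simp: a_def)
    have "ln (w / real (Suc m)) \<le> a"
      unfolding a_def using mw w by (subst ln_le_cancel_iff) (auto intro!: divide_left_mono)
    hence ba: "b \<le> a" using a0 by (auto simp: b_def)
    have "a - b \<le> 1 / real m"
    proof -
      have "a - ln (w / real (Suc m)) = ln (1 + 1 / real m)"
      proof -
        have "1 + 1 / real m = real (Suc m) / real m" using mw by (simp add: field_simps)
        thus ?thesis unfolding a_def using mw w by (simp add: ln_div del: of_nat_Suc)
      qed
      also have "\<dots> \<le> 1 / real m" by (intro ln_add_one_self_le_self) auto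
      finally show ?thesis by (auto simp: b_def)
    qed
    have "f m - f (Suc m) = a ^ Suc k - b ^ Suc k"
      using a0 by (simp add: f_def a_def b_def)
    also have "\<dots> \<le> real (Suc k) * a ^ k * (a - b)"
      using ba by (intro power_diff_le) (auto simp: b_def)
    also have "\<dots> \<le> real (Suc k) * a ^ k * (1 / real m)"
      using \<open>a - b \<le> 1 / real m\<close> a0 by (intro mult_left_mono) auto
    finally show "f m - f (Suc m) \<le> real (Suc k) * (1 / real m * ln (w / real m) ^ k)"
      by (simp add: a_def)
  qed
  also have "f (Suc M) = 0" using M w by (simp add: f_def max_def)
  also have "f 1 = ln w ^ Suc k" using w by (simp add: f_def)
  finally show ?thesis unfolding R sum_distrib_left[symmetric]
    by (simp add: divide_le_eq mult.commute del: of_nat_Suc)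
qed

lemma harmonic_tuple_sum_ge_ln_power:
  assumes "w \<ge> 1"
  shows "ln w ^ k / fact k \<le> harmonic_tuple_sum {} k w"
  using assms
proof (induction k arbitrary: w)
  case (Suc k)
  have "ln w ^ Suc k / fact (Suc k) = (ln w ^ Suc k / real (Suc k)) / fact k"
    by (simp add: field_simps)
  also have "\<dots> \<le> (\<Sum>m\<in>rough {} w. 1 / real m * ln (w / real m) ^ k) / fact k"
    using sum_ln_power_ge[OF Suc.prems, of k] by (intro divide_right_mono) auto
  also have "\<dots> = (\<Sum>m\<in>rough {} w. 1 / real m * (ln (w / real m) ^ k / fact k))"
    by (simp add: sum_divide_distrib)
  also have "\<dots> \<le> harmonic_tuple_sum {} (Suc k) w"
    unfolding harmonic_tuple_sum.simps
  proof (intro sum_mono mult_left_mono Suc.IH)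
    fix m assume "m \<in> rough {} w"
    thus "1 \<le> w / real m" by (auto simp: rough_def le_divide_eq)
  qed auto
  finally show ?case .
qed simp

text \<open>Primes are removed one at a time: since \<open>F (p * m) \<le> F m\<close>, the
  multiples of p carry at most the fraction 1/p of the sum.\<close>

lemma rough_sum_remove_primes:
  fixes F :: "nat \<Rightarrow> real"
  assumes Q: "finite Q" "\<And>p. p \<in> Q \<Longrightarrow> prime p"
    and F: "\<And>m. F m \<ge> 0" "\<And>p m. p \<ge> 1 \<Longrightarrow> m \<ge> 1 \<Longrightarrow> F (p * m) \<le> F m"
  shows "(\<Prod>p\<in>Q. 1 - 1 / real p) * (\<Sum>m\<in>rough {} w. 1 / real m * F m) \<le> (\<Sum>m\<in>rough Q w. 1 / real m * F m)"
  using Q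
proof (induction Q rule: finite_induct)
  case (insert p Q)
  define U where "U = (\<Sum>m\<in>rough Q w. 1 / real m * F m)"
  define U' where "U' = (\<Sum>m\<in>rough (insert p Q) w. 1 / real m * F m)"
  have p: "prime p" using insert.prems by simp
  have p': "p > 1" using p by (rule prime_gt_1_nat)
  have "U \<le> U' + (\<Sum>m\<in>{m \<in> rough Q w. p dvd m}. 1 / real m * F m)"
  proof -
    have "U = (\<Sum>m\<in>rough (insert p Q) w \<union> {m \<in> rough Q w. p dvd m}. 1 / real m * F m)"
      unfolding U_def by (rule sum.cong) (auto simp: rough_def)
    also have "\<dots> = U' + (\<Sum>m\<in>{m \<in> rough Q w. p dvd m}. 1 / real m * F m)"
      unfolding U'_def by (rule sum.union_disjoint) (simp, simp, auto simp: rough_def)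
    finally show ?thesis by simp
  qed
  also have "(\<Sum>m\<in>{m \<in> rough Q w. p dvd m}. 1 / real m * F m) \<le> (\<Sum>m\<in>(\<lambda>m. p * m) ` rough Q w. 1 / real m * F m)"
  proof (rule sum_mono2)
    show "{m \<in> rough Q w. p dvd m} \<subseteq> (\<lambda>m. p * m) ` rough Q w"
    proof
      fix m assume m: "m \<in> {m \<in> rough Q w. p dvd m}"
      then obtain n where n: "m = p * n" by auto
      have "n \<ge> 1" using m n by (auto simp: rough_def intro: Nat.gr0I Suc_leI)
      moreover have "n \<le> m" using n p' by simp
      hence "real n \<le> w" using m by (auto simp: rough_def)
      ultimately have "n \<in> rough Q w" using m n by (auto simp: rough_def)
      thus "m \<in> (\<lambda>m. p * m) ` rough Q w" using n by blast
    qed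
  qed (use F in auto)
  also have "(\<Sum>m\<in>(\<lambda>m. p * m) ` rough Q w. 1 / real m * F m) = (\<Sum>m\<in>rough Q w. 1 / real (p * m) * F (p * m))"
    using p' by (subst sum.reindex) (auto simp: inj_on_def)
  also have "\<dots> \<le> (\<Sum>m\<in>rough Q w. 1 / real (p * m) * F m)"
    using F p' by (intro sum_mono mult_left_mono) (auto simp: rough_def)
  also have "\<dots> = 1 / real p * U"
    by (simp add: U_def sum_distrib_left field_simps)
  finally have 1: "(1 - 1 / real p) * U \<le> U'" by (simp add: algebra_simps)
  have "(\<Prod>p\<in>insert p Q. 1 - 1 / real p) * (\<Sum>m\<in>rough {} w. 1 / real m * F m)
     = (1 - 1 / real p) * ((\<Prod>p\<in>Q. 1 - 1 / real p) * (\<Sum>m\<in>rough {} w. 1 / real m * F m))"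
    using insert by simp
  also have "\<dots> \<le> (1 - 1 / real p) * U"
    unfolding U_def using insert p' by (intro mult_left_mono) auto
  also note 1
  finally show ?case by (simp add: U'_def)
qed simp

lemma harmonic_tuple_sum_remove_primes:
  assumes Q: "finite Q" "\<And>p. p \<in> Q \<Longrightarrow> prime p"
  shows "(\<Prod>p\<in>Q. 1 - 1 / real p) ^ k * harmonic_tuple_sum {} k w \<le> harmonic_tuple_sum Q k w"
proof (induction k arbitrary: w)
  case (Suc k)
  define V where "V = (\<Prod>p\<in>Q. 1 - 1 / real p)"
  have V: "V \<ge> 0" unfolding V_def using prime_ge_1_nat[OF Q(2)] by (intro prod_nonneg) (auto simp: divide_le_eq)
  have "V ^ Suc k * harmonic_tuple_sum {} (Suc k) w = V * (\<Sum>m\<in>rough {} w. 1 / real m * (V ^ k * harmonic_tuple_sum {} k (w / real m)))"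
    by (simp add: sum_distrib_left mult_ac)
  also have "\<dots> \<le> V * (\<Sum>m\<in>rough {} w. 1 / real m * harmonic_tuple_sum Q k (w / real m))"
    using V Suc unfolding V_def by (intro mult_left_mono sum_mono) auto
  also have "\<dots> \<le> harmonic_tuple_sum Q (Suc k) w"
    unfolding V_def harmonic_tuple_sum.simps
  proof (rule rough_sum_remove_primes[OF Q])
    fix p m :: nat assume pm: "p \<ge> 1" "m \<ge> 1"
    show "harmonic_tuple_sum Q k (w / real (p * m)) \<le> harmonic_tuple_sum Q k (w / real m)"
    proof (cases "w \<ge> 0")
      case True
      thus ?thesis using pm by (intro harmonic_tuple_sum_mono divide_left_mono) auto
    next
      case False
      hence "rough Q (w / real (p * m)) = {}" "rough Q (w / real m) = {}"
        using pm by (auto simp: rough_def not_le intro: order.strict_trans2[of _ 0] simp: divide_less_0_iff)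
      thus ?thesis by (cases k) auto
    qed
  qed (auto intro: harmonic_tuple_sum_nonneg)
  finally show ?case by (simp add: V_def)
qed simp

text \<open>A divisor of \<open>p * x\<close> divides \<open>x\<close> or is \<open>p\<close> times
  a divisor of \<open>x\<close>, so each prime factor, with multiplicity, costs at most a factor
  \<open>k + 1\<close>.\<close>

lemma sum_divisors_power_Omega_le:
  fixes n k :: nat
  assumes "n > 0"
  shows "(\<Sum>b | b dvd n. real k ^ size (prime_factorization b)) \<le> real (Suc k) ^ size (prime_factorization n)"
  using assms
proof (induction n rule: prime_divisors_induct)
  case (factor p x)
  have x: "x > 0" using factor.prems by auto
  have p: "p > 0" using factor.prems by auto
  have fin: "finite {b. b dvd x}" using x by simp
  have sub: "{b. b dvd p * x} \<subseteq> {b. b dvd x} \<union> (\<lambda>b. p * b) ` {b. b dvd x}"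
  proof
    fix b assume "b \<in> {b. b dvd p * x}"
    hence b: "b dvd p * x" by simp
    show "b \<in> {b. b dvd x} \<union> (\<lambda>b. p * b) ` {b. b dvd x}"
    proof (cases "p dvd b")
      case True
      then obtain c where "b = p * c" by auto
      thus ?thesis using b p by auto
    next
      case False
      hence "coprime p b" using factor.hyps by (simp add: prime_imp_coprime)
      hence "b dvd x" using b by (simp add: coprime_dvd_mult_right_iff coprime_commute)
      thus ?thesis by simp
    qed
  qed
  have "(\<Sum>b | b dvd p * x. real k ^ size (prime_factorization b))
      \<le> (\<Sum>b\<in>{b. b dvd x} \<union> (\<lambda>b. p * b) ` {b. b dvd x}. real k ^ size (prime_factorization b))"
    using sub fin by (intro sum_mono2) auto
  also have "\<dots> \<le> (\<Sum>b | b dvd x. real k ^ size (prime_factorization b)) + (\<Sum>b\<in>(\<lambda>b. p * b) ` {b. b dvd x}. real k ^ size (prime_factorization b))"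
  proof -
    have "(\<Sum>b\<in>X \<union> Y. f b) \<le> (\<Sum>b\<in>X. f b) + (\<Sum>b\<in>Y. f b)"
      if "finite X" "finite Y" "\<And>b. f b \<ge> 0" for X Y :: "nat set" and f :: "nat \<Rightarrow> real"
      using that sum.union_inter[OF that(1,2), of f] sum_nonneg[of "X \<inter> Y" f] by simp
    thus ?thesis using fin by simp
  qed
  also have "(\<Sum>b\<in>(\<lambda>b. p * b) ` {b. b dvd x}. real k ^ size (prime_factorization b)) = (\<Sum>b | b dvd x. real k ^ size (prime_factorization (p * b)))"
    using p by (subst sum.reindex) (auto simp: inj_on_def)
  also have "\<dots> = (\<Sum>b | b dvd x. real k * real k ^ size (prime_factorization b))"
  proof (rule sum.cong[OF refl])
    fix b assume "b \<in> {b. b dvd x}"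
    hence "b \<noteq> 0" using x by auto
    thus "real k ^ size (prime_factorization (p * b)) = real k * real k ^ size (prime_factorization b)"
      using factor.hyps p by (simp add: prime_factorization_mult prime_factorization_prime)
  qed
  also have "(\<Sum>b | b dvd x. real k ^ size (prime_factorization b)) + \<dots> = real (Suc k) * (\<Sum>b | b dvd x. real k ^ size (prime_factorization b))"
    by (simp add: sum_distrib_left[symmetric] algebra_simps)
  also have "\<dots> \<le> real (Suc k) * real (Suc k) ^ size (prime_factorization x)"
    using factor.IH x by (intro mult_left_mono) auto
  also have "\<dots> = real (Suc k) ^ size (prime_factorization (p * x))"
    using factor.hyps x p by (simp add: prime_factorization_mult prime_factorization_prime)
  finally show ?case .
qed auto

text \<open>A number with r prime factors, counted with multiplicity, has at most k^r ordered
  factorisations into k factors. The induction splits off one factor of n and keeps the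
  complementary divisor b.\<close>

lemma harmonic_tuple_sum_le_sum_power_Omega:
  assumes "w \<ge> 1" "\<And>p. p \<in> Q \<Longrightarrow> prime p"
  shows "harmonic_tuple_sum Q k w \<le> (\<Sum>n\<in>rough Q w. real k ^ size (prime_factorization n) / real n)"
  using assms(1)
proof (induction k arbitrary: w)
  case 0
  \<comment> \<open>For \<open>k = 0\<close> the empty tuple corresponds to n = 1, whose term is
    \<open>0 ^ 0 = 1\<close>.\<close>
  have "1 \<in> rough Q w" using 0 assms(2)[of 1] by (auto simp: rough_def)
  hence "0 ^ size (prime_factorization (1::nat)) / real 1 \<le> (\<Sum>n\<in>rough Q w. 0 ^ size (prime_factorization n) / real n)"
    by (rule member_le_sum[where f = "\<lambda>n. 0 ^ size (prime_factorization n) / real n"]) auto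
  thus ?case by simp
next
  case (Suc k)
  have "harmonic_tuple_sum Q (Suc k) w \<le> (\<Sum>m\<in>rough Q w. 1 / real m * (\<Sum>b\<in>rough Q (w / real m). real k ^ size (prime_factorization b) / real b))"
    unfolding harmonic_tuple_sum.simps
  proof (intro sum_mono mult_left_mono Suc.IH)
    fix m assume "m \<in> rough Q w"
    thus "1 \<le> w / real m" by (auto simp: rough_def le_divide_eq)
  qed auto
  also have "\<dots> = (\<Sum>(m, b)\<in>(SIGMA m:rough Q w. rough Q (w / real m)). real k ^ size (prime_factorization b) / (real m * real b))"
    by (subst sum.Sigma[symmetric]) (auto simp: sum_distrib_left)
  also have "\<dots> = (\<Sum>(n, b)\<in>(SIGMA n:rough Q w. {b. b dvd n}). real k ^ size (prime_factorization b) / real n)"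
  proof (rule sum.reindex_bij_witness[where i = "\<lambda>(n, b). (n div b, b)" and j = "\<lambda>(m, b). (m * b, b)"])
    fix x assume "x \<in> (SIGMA m:rough Q w. rough Q (w / real m))"
    then obtain m b where x: "x = (m, b)" "m \<in> rough Q w" "b \<in> rough Q (w / real m)" by auto
    have "real m * real b \<le> w" using x by (auto simp: rough_def field_simps)
    moreover have "\<not> p dvd m * b" if "p \<in> Q" for p
      using x that assms(2) by (auto simp: rough_def prime_dvd_mult_iff)
    moreover have "1 \<le> m * b" using x by (auto simp: rough_def)
    ultimately show "(case x of (m, b) \<Rightarrow> (m * b, b)) \<in> (SIGMA n:rough Q w. {b. b dvd n})"
      using x by (auto simp: rough_def)
    show "(case (case x of (m, b) \<Rightarrow> (m * b, b)) of (n, b) \<Rightarrow> (n div b, b)) = x"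
      using x by (auto simp: rough_def)
    show "(case (case x of (m, b) \<Rightarrow> (m * b, b)) of (n, b) \<Rightarrow> real k ^ size (prime_factorization b) / real n)
        = (case x of (m, b) \<Rightarrow> real k ^ size (prime_factorization b) / (real m * real b))"
      using x by auto
  next
    fix y assume "y \<in> (SIGMA n:rough Q w. {b. b dvd n})"
    then obtain n b where y: "y = (n, b)" "n \<in> rough Q w" "b dvd n" by auto
    then obtain m where m: "n = m * b" by (metis dvdE mult.commute)
    have n: "n \<ge> 1" "real n \<le> w" "\<And>p. p \<in> Q \<Longrightarrow> \<not> p dvd n" using y by (auto simp: rough_def)
    have mb: "m \<ge> 1" "b \<ge> 1" using m n by (auto simp: Suc_le_eq intro: Nat.gr0I)
    have "real m \<le> real m * real b" using mb by simp
    moreover have "real m * real b \<le> w" using n m by simp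
    ultimately have "real m \<le> w" "real b \<le> w / real m" using mb by (linarith, simp add: pos_le_divide_eq mult.commute)
    moreover have "\<And>p. p \<in> Q \<Longrightarrow> \<not> p dvd m \<and> \<not> p dvd b" using n(3) m by (metis dvd_mult dvd_mult2)
    ultimately show "(case y of (n, b) \<Rightarrow> (n div b, b)) \<in> (SIGMA m:rough Q w. rough Q (w / real m))"
      using y m mb by (auto simp: rough_def)
    show "(case (case y of (n, b) \<Rightarrow> (n div b, b)) of (m, b) \<Rightarrow> (m * b, b)) = y"
      using y by auto
  qed
  also have "\<dots> = (\<Sum>n\<in>rough Q w. (\<Sum>b | b dvd n. real k ^ size (prime_factorization b)) / real n)"
  proof -
    have "\<forall>n\<in>rough Q w. finite {b. b dvd n}" by (auto simp: rough_def)
    thus ?thesis by (subst sum.Sigma[symmetric]) (auto simp: sum_divide_distrib)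
  qed
  also have "\<dots> \<le> (\<Sum>n\<in>rough Q w. real (Suc k) ^ size (prime_factorization n) / real n)"
    by (intro sum_mono divide_right_mono sum_divisors_power_Omega_le) (auto simp: rough_def)
  finally show ?case .
qed

text \<open>Letting all exponents range over the positive integers gives for each prime the
  geometric series with ratio and first term k/p, that is k / (p - k).\<close>

lemma sum_fixed_support_le:
  fixes k :: nat
  assumes A: "finite A" "\<And>p. p \<in> A \<Longrightarrow> prime p" "\<And>p. p \<in> A \<Longrightarrow> k < p"
    and X: "finite X" "\<And>n. n \<in> X \<Longrightarrow> n > 0 \<and> prime_factors n = A"
  shows "(\<Sum>n\<in>X. real k ^ size (prime_factorization n) / real n) \<le> (\<Prod>p\<in>A. real k / (real p - real k))"
proof -
  \<comment> \<open>A common bound for all exponents, as 2^e \<le> n forces e < n; it embeds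
    \<open>X\<close> in a finite box of exponent vectors.\<close>
  define E where "E = Max (insert 0 X)"
  define e where "e n = restrict (\<lambda>p. multiplicity p n) A" for n :: nat
  have E: "n \<le> E" if "n \<in> X" for n unfolding E_def using X that by (intro Max_ge) auto
  have val: "n = (\<Prod>p\<in>A. p ^ multiplicity p n)" if "n \<in> X" for n
    using X(2)[OF that] prime_factorization_nat[of n] by auto
  have inj: "inj_on e X"
  proof (rule inj_onI)
    fix m n assume mn: "m \<in> X" "n \<in> X" "e m = e n"
    have "multiplicity p m = multiplicity p n" if "p \<in> A" for p
      using fun_cong[OF mn(3), of p] that by (simp add: e_def)
    thus "m = n" using val[OF mn(1)] val[OF mn(2)] by simp
  qed
  have summand: "real k ^ size (prime_factorization n) / real n = (\<Prod>p\<in>A. (real k / real p) ^ e n p)" if n: "n \<in> X" for n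
  proof -
    have "size (prime_factorization n) = (\<Sum>p\<in>A. multiplicity p n)"
      using X(2)[OF n] A(2) by (auto simp: size_multiset_overloaded_eq count_prime_factorization intro!: sum.cong)
    hence "real k ^ size (prime_factorization n) = (\<Prod>p\<in>A. real k ^ multiplicity p n)"
      by (simp add: power_sum)
    moreover have "real n = (\<Prod>p\<in>A. real p ^ multiplicity p n)"
      by (subst val[OF n]) simp
    ultimately show ?thesis by (simp add: prod_dividef power_divide e_def)
  qed
  have "e ` X \<subseteq> (\<Pi>\<^sub>E p\<in>A. {1..E})"
  proof
    fix f assume "f \<in> e ` X"
    then obtain n where n: "n \<in> X" "f = e n" by auto
    have "multiplicity p n \<in> {1..E}" if p: "p \<in> A" for p
    proof -
      have "p \<in> prime_factors n" using X(2)[OF n(1)] p by simp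
      hence "multiplicity p n \<ge> 1" by (simp add: prime_factors_multiplicity Suc_le_eq)
      moreover have "multiplicity p n \<le> E"
      proof -
        have "multiplicity p n < 2 ^ multiplicity p n" by simp
        also have "\<dots> \<le> p ^ multiplicity p n" using A(2)[OF p] by (intro power_mono) (auto simp: prime_ge_2_nat)
        also have "\<dots> \<le> n" using X(2)[OF n(1)] by (intro dvd_imp_le multiplicity_dvd) auto
        also have "\<dots> \<le> E" using E n by auto
        finally show ?thesis by simp
      qed
      ultimately show ?thesis by simp
    qed
    thus "f \<in> (\<Pi>\<^sub>E p\<in>A. {1..E})" using n by (auto simp: e_def)
  qed
  have "(\<Sum>n\<in>X. real k ^ size (prime_factorization n) / real n) = (\<Sum>f\<in>e ` X. \<Prod>p\<in>A. (real k / real p) ^ f p)"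
    using inj summand by (subst sum.reindex) (auto intro!: sum.cong)
  also have "\<dots> \<le> (\<Sum>f\<in>(\<Pi>\<^sub>E p\<in>A. {1..E}). \<Prod>p\<in>A. (real k / real p) ^ f p)"
    using \<open>e ` X \<subseteq> _\<close> A(1) by (intro sum_mono2) (auto intro!: prod_nonneg finite_PiE)
  also have "\<dots> = (\<Prod>p\<in>A. \<Sum>j=1..E. (real k / real p) ^ j)"
    using A(1) by (subst prod_sum_PiE) auto
  also have "\<dots> \<le> (\<Prod>p\<in>A. real k / (real p - real k))"
  proof (rule prod_mono, intro conjI)
    fix p assume p: "p \<in> A"
    define r where "r = real k / real p"
    have r: "0 \<le> r" "r < 1" using A(3)[OF p] by (auto simp: r_def)
    show "0 \<le> (\<Sum>j=1..E. (real k / real p) ^ j)" by (intro sum_nonneg) auto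
    have "(\<Sum>j=1..E. r ^ j) * (1 - r) = r - r ^ Suc E"
    proof (induction E)
      case (Suc E)
      have "(\<Sum>j=1..Suc E. r ^ j) * (1 - r) = (\<Sum>j=1..E. r ^ j) * (1 - r) + r ^ Suc E * (1 - r)"
        by (simp add: distrib_right)
      also have "\<dots> = r - r ^ Suc (Suc E)" unfolding Suc by (simp add: algebra_simps)
      finally show ?case .
    qed simp
    hence "(\<Sum>j=1..E. r ^ j) * (1 - r) \<le> r" using r by simp
    hence "(\<Sum>j=1..E. r ^ j) \<le> r / (1 - r)" using r by (simp add: pos_le_divide_eq)
    also have "\<dots> = real k / (real p - real k)" using A(3)[OF p] by (simp add: r_def field_simps)
    finally show "(\<Sum>j=1..E. (real k / real p) ^ j) \<le> real k / (real p - real k)" by (simp add: r_def)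
  qed
  finally show ?thesis .
qed

text \<open>The numbers are grouped by their set of prime factors. The right-hand side is the sum of
  Selberg's \<open>g\<close> when every prime of \<open>R\<close> has exactly \<open>k\<close>
  forbidden classes.\<close>

lemma harmonic_tuple_sum_le_squarefree_sum:
  fixes k :: nat
  assumes w: "w \<ge> 1" and Q: "\<And>p. p \<in> Q \<Longrightarrow> prime p"
    and R: "finite R" "\<And>p. prime p \<Longrightarrow> real p \<le> w \<Longrightarrow> p \<notin> Q \<Longrightarrow> p \<in> R"
    "\<And>p. p \<in> R \<Longrightarrow> prime p" "\<And>p. p \<in> R \<Longrightarrow> k < p"
  shows "harmonic_tuple_sum Q k w \<le> (\<Sum>A | A \<subseteq> R \<and> real (\<Prod>A) \<le> w. \<Prod>p\<in>A. real k / (real p - real k))"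
proof -
  define DD where "DD = {A. A \<subseteq> R \<and> real (\<Prod>A) \<le> w}"
  have finDD: "finite DD" by (rule finite_subset[of _ "Pow R"]) (use R in \<open>auto simp: DD_def\<close>)
  have mem: "prime_factors n \<in> DD" if n: "n \<in> rough Q w" for n
  proof -
    have n': "n > 0" "real n \<le> w" "\<And>p. p \<in> Q \<Longrightarrow> \<not> p dvd n" using n by (auto simp: rough_def)
    have "p \<in> R" if "p \<in> prime_factors n" for p
    proof (rule R(2))
      have "p \<le> n" using that n' by (auto intro!: dvd_imp_le simp: prime_factors_dvd)
      thus "real p \<le> w" using n' by simp
    qed (use that n' in \<open>auto simp: prime_factors_dvd\<close>)
    moreover have "\<Prod>(prime_factors n) dvd n"
    proof -
      have "(\<Prod>p\<in>prime_factors n. p) dvd (\<Prod>p\<in>prime_factors n. p ^ multiplicity p n)"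
        by (intro prod_dvd_prod dvd_power) (auto simp: prime_factors_multiplicity)
      thus ?thesis using n' prime_factorization_nat[of n] by simp
    qed
    hence "\<Prod>(prime_factors n) \<le> n" using n' by (intro dvd_imp_le) auto
    hence "real (\<Prod>(prime_factors n)) \<le> w" using n' by (meson of_nat_le_iff order_trans)
    ultimately show ?thesis unfolding DD_def by auto
  qed
  have "harmonic_tuple_sum Q k w \<le> (\<Sum>n\<in>rough Q w. real k ^ size (prime_factorization n) / real n)"
    by (rule harmonic_tuple_sum_le_sum_power_Omega[OF w Q])
  also have "\<dots> = (\<Sum>A\<in>DD. \<Sum>n | n \<in> rough Q w \<and> prime_factors n = A. real k ^ size (prime_factorization n) / real n)"
    using mem finDD by (intro sum.group[symmetric, of _ _ prime_factors, simplified]) auto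
  also have "\<dots> \<le> (\<Sum>A\<in>DD. \<Prod>p\<in>A. real k / (real p - real k))"
  proof (rule sum_mono, rule sum_fixed_support_le)
    fix A assume "A \<in> DD"
    thus "finite A" "\<And>p. p \<in> A \<Longrightarrow> prime p" "\<And>p. p \<in> A \<Longrightarrow> k < p"
      using R finite_subset by (auto simp: DD_def)
    show "finite {n \<in> rough Q w. prime_factors n = A}" by simp
  qed (auto simp: rough_def)
  finally show ?thesis by (simp add: DD_def)
qed

context selberg_sieve
begin

text \<open>Every subset of \<open>P1\<close> fits below \<open>z\<close> together with a set of
  product at most \<open>w\<close>, so \<open>L\<close> contains the full product of two sums. The
  sum over subsets of \<open>P1\<close> is the reciprocal of the product of
  \<open>1 - card (Om p) / p\<close> and cancels it, whatever the sizes of these classes; the sum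
  over \<open>R\<close> is compared with k-fold harmonic sums. \<open>Q\<close> contains the primes
  up to \<open>w\<close> missing from \<open>R\<close>.\<close>

theorem L_lower_bound:
  fixes k :: nat and w :: real
  assumes P1: "P1 \<subseteq> P" and R: "R \<subseteq> P - P1" and cardR: "\<And>p. p \<in> R \<Longrightarrow> card (Om p) = k"
    and Q: "finite Q" "\<And>p. p \<in> Q \<Longrightarrow> prime p" "\<And>p. prime p \<Longrightarrow> real p \<le> w \<Longrightarrow> p \<notin> Q \<Longrightarrow> p \<in> R"
    and w: "w \<ge> 1" "w * real (\<Prod>P1) \<le> z"
  shows "L * (\<Prod>p\<in>P1. 1 - real (card (Om p)) / real p) \<ge> (\<Prod>p\<in>Q. 1 - 1 / real p) ^ k * (ln w ^ k / fact k)"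
proof -
  define DD where "DD = {A. A \<subseteq> R \<and> real (\<Prod>A) \<le> w}"
  have finR: "finite R" using R finP finite_subset by blast
  have finP1: "finite P1" using P1 finP finite_subset by blast
  have finDD: "finite DD" by (rule finite_subset[of _ "Pow R"]) (use finR in \<open>auto simp: DD_def\<close>)
  have k: "k < p" if "p \<in> R" for p using Om_less[of p] cardR[OF that] that R by auto
  have gDD: "g A = (\<Prod>p\<in>A. real k / (real p - real k))" if "A \<in> DD" for A
    unfolding g_def using that cardR by (intro prod.cong) (auto simp: DD_def)
  have pos: "(\<Prod>p\<in>P1. 1 - real (card (Om p)) / real p) > 0"
    using P1 Om_less Om_pos by (intro prod_pos) (force simp: subset_iff)
  have "(\<Prod>p\<in>Q. 1 - 1 / real p) ^ k * (ln w ^ k / fact k) \<le> (\<Prod>p\<in>Q. 1 - 1 / real p) ^ k * harmonic_tuple_sum {} k w"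
    using Q by (intro mult_left_mono harmonic_tuple_sum_ge_ln_power w zero_le_power prod_nonneg) (use prime_ge_1_nat[OF Q(2)] in \<open>auto simp: divide_le_eq\<close>)
  also have "\<dots> \<le> harmonic_tuple_sum Q k w" by (rule harmonic_tuple_sum_remove_primes[OF Q(1,2)])
  also have "\<dots> \<le> (\<Sum>A\<in>DD. g A)"
  proof -
    have "harmonic_tuple_sum Q k w \<le> (\<Sum>A\<in>DD. \<Prod>p\<in>A. real k / (real p - real k))"
      unfolding DD_def using Q R primeP k w finR by (intro harmonic_tuple_sum_le_squarefree_sum) auto
    thus ?thesis using gDD by simp
  qed
  also have "\<dots> = (\<Prod>p\<in>P1. 1 - real (card (Om p)) / real p) * ((\<Sum>B\<in>Pow P1. g B) * (\<Sum>A\<in>DD. g A))"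
  proof -
    have "(\<Prod>p\<in>P1. 1 - real (card (Om p)) / real p) * (\<Sum>B\<in>Pow P1. g B) = 1"
      unfolding g_over_h[OF P1] unfolding g_def h_def prod_dividef[symmetric] prod.distrib[symmetric]
    proof (rule prod.neutral, rule ballI)
      fix p assume "p \<in> P1"
      hence "0 < card (Om p)" "card (Om p) < p" using P1 Om_pos[of p] Om_less[of p] by auto
      thus "(1 - real (card (Om p)) / real p) * (real (card (Om p)) / (real p - real (card (Om p))) / (real (card (Om p)) / real p)) = 1"
        by (simp add: field_simps)
    qed
    thus ?thesis by simp
  qed
  also have "(\<Sum>B\<in>Pow P1. g B) * (\<Sum>A\<in>DD. g A) \<le> L"
  proof -
    have "(\<Sum>B\<in>Pow P1. g B) * (\<Sum>A\<in>DD. g A) = (\<Sum>(B, A)\<in>Pow P1 \<times> DD. g B * g A)"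
      by (simp add: sum_product sum.cartesian_product)
    also have "\<dots> = (\<Sum>(B, A)\<in>Pow P1 \<times> DD. g (B \<union> A))"
      using P1 R by (intro sum.cong refl) (auto simp: DD_def intro!: g_Un[symmetric])
    also have "\<dots> = (\<Sum>T\<in>(\<lambda>(B, A). B \<union> A) ` (Pow P1 \<times> DD). g T)"
    proof (subst sum.reindex)
      show "inj_on (\<lambda>(B, A). B \<union> A) (Pow P1 \<times> DD)"
        by (rule inj_on_inverseI[where g = "\<lambda>T. (T \<inter> P1, T - P1)"]) (use R in \<open>auto simp: DD_def\<close>)
    qed (auto intro!: sum.cong)
    also have "\<dots> \<le> L"
      unfolding L_def
    proof (rule sum_mono2[OF finD])
      show "(\<lambda>(B, A). B \<union> A) ` (Pow P1 \<times> DD) \<subseteq> \<D>"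
      proof
        fix T assume "T \<in> (\<lambda>(B, A). B \<union> A) ` (Pow P1 \<times> DD)"
        then obtain A B where T: "T = B \<union> A" "B \<subseteq> P1" "A \<subseteq> R" "real (\<Prod>A) \<le> w" by (auto simp: DD_def)
        have fin: "finite A" "finite B" using T finR finP1 finite_subset by blast+
        have "\<Prod>T = \<Prod>B * \<Prod>A" unfolding T using fin T R by (intro prod.union_disjoint) auto
        moreover have "\<Prod>B \<le> \<Prod>P1"
        proof (rule dvd_imp_le)
          show "\<Prod>B dvd \<Prod>P1" using T finP1 by (intro prod_dvd_prod_subset) auto
          show "\<Prod>P1 > 0" using P1 primeP by (intro prod_pos) (metis prime_gt_0_nat subsetD)
        qed
        ultimately have "real (\<Prod>T) \<le> real (\<Prod>P1) * real (\<Prod>A)"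
          by (metis mult_right_mono of_nat_0_le_iff of_nat_le_iff of_nat_mult)
        also have "\<dots> \<le> real (\<Prod>P1) * w" using T by (intro mult_left_mono) (auto intro!: prod_nonneg)
        also have "\<dots> \<le> z" using w by (simp add: mult.commute)
        finally show "T \<in> \<D>" using T P1 R unfolding \<D>_def by auto
      qed
    qed (auto intro!: less_imp_le[OF g_pos] D_subset)
    finally show ?thesis .
  qed
  finally show ?thesis using pos by (simp add: mult.commute)
qed

end

section \<open>Primes in windows\<close>

lemma power_ge_tangent:
  fixes t l :: real
  assumes "t \<ge> 0" "l \<ge> 0"
  shows "t ^ Suc k \<ge> l ^ Suc k + real (Suc k) * l ^ k * (t - l)"
proof (induction k)
  case (Suc k)
  have "t ^ Suc (Suc k) \<ge> t * (l ^ Suc k + real (Suc k) * l ^ k * (t - l))"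
    using mult_left_mono[OF Suc assms(1)] by simp
  also have "t * (l ^ Suc k + real (Suc k) * l ^ k * (t - l)) =
      l ^ Suc (Suc k) + real (Suc (Suc k)) * l ^ Suc k * (t - l) + real (Suc k) * l ^ k * (t - l)\<^sup>2"
    by (simp add: power2_eq_square algebra_simps)
  finally show ?case using assms by (smt (verit) mult_nonneg_nonneg of_nat_0_le_iff zero_le_power zero_le_power2)
qed simp

text \<open>A bound linear in \<open>w\<close>, so that after summation over windows only their
  number and total size enter. For \<open>w < Suc k\<close> the tangent at \<open>l\<close> is
  evaluated at a negative argument, where it is at most 0.\<close>

lemma fact_mult_binomial_ge:
  assumes l: "(l::real) \<ge> 0"
  shows "fact (Suc k) * real (w choose Suc k) \<ge> l ^ Suc k + real (Suc k) * l ^ k * (real w - real (Suc k) - l)"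
proof (cases "w \<ge> Suc k")
  case True
  have "(real w - real (Suc k)) ^ Suc k = (\<Prod>i = 0..<Suc k. real w - real (Suc k))" by simp
  also have "\<dots> \<le> (\<Prod>i = 0..<Suc k. real w - real i)"
    using True by (intro prod_mono) auto
  also have "\<dots> = fact (Suc k) * (real w gchoose Suc k)" by (rule gbinomial_mult_fact[symmetric])
  also have "real w gchoose Suc k = real (w choose Suc k)" by (rule binomial_gbinomial[symmetric])
  finally show ?thesis
    using power_ge_tangent[of "real w - real (Suc k)" l k] True l by linarith
next
  case False
  have "real (Suc k) * l ^ k * (real w - real (Suc k) - l) \<le> real (Suc k) * l ^ k * (- l)"
    using False l by (intro mult_left_mono) auto
  also have "\<dots> = - (real (Suc k) * l ^ Suc k)" by simp
  also have "\<dots> \<le> - (1 * l ^ Suc k)" using l by (intro le_imp_neg_le mult_right_mono) auto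
  finally show ?thesis using False by (simp add: binomial_eq_0)
qed

text \<open>
  \<open>W s\<close> collects the terms of \<open>T\<close> among \<open>s, s - q, ..., s - (H - 1) q\<close>. Every element of \<open>T\<close> lies in exactly
  \<open>H\<close> windows, so by convexity the windows contain many \<open>(k + 1)\<close>-subsets, and each shape \<open>J\<close> accounts for at
  most \<open>M\<close> of them.
\<close>
theorem window_bound:
  fixes T A :: "nat set" and M l N' :: real
  assumes A: "finite A" "\<And>p. p \<in> A \<Longrightarrow> prime p"
    and T: "T \<subseteq> {1..X}" "\<And>n p. n \<in> T \<Longrightarrow> p \<in> A \<Longrightarrow> \<not> p dvd n"
    and M: "M \<ge> 0" "\<And>J. J \<subseteq> {..<H} \<Longrightarrow> card J = Suc k \<Longrightarrow> real (card {s. \<forall>j\<in>J. j * \<Prod>A \<le> s \<and> s - j * \<Prod>A \<in> T}) \<le> M"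
    and N': "(\<Prod>p\<in>A. 1 - 1 / real p) * real (X + H * \<Prod>A + \<Prod>A) \<le> N'"
    and l: "l \<ge> 0" "real H * real (card T) = N' * (l + real (Suc k))"
  shows "N' * l ^ Suc k \<le> M * real H ^ Suc k"
proof -
  define q where "q = \<Prod>A"
  have q: "q > 0" unfolding q_def using A by (intro prod_pos) (auto simp: prime_gt_0_nat)
  \<comment> \<open>The terms of a window are all congruent to s modulo \<open>q\<close>, so a
    window that meets \<open>T\<close> starts at an s coprime to \<open>q\<close>. This restriction
    of the starting points is the source of the gain over a trivial average.\<close>
  define S where "S = {s\<in>{1..X + H * q}. \<forall>p\<in>A. s mod p \<in> {1..<p}}"
  define W where "W s = {j\<in>{..<H}. j * q \<le> s \<and> s - j * q \<in> T}" for s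
  have finS: "finite S" by (simp add: S_def)
  have finT: "finite T" using T(1) finite_subset by blast
  have finW: "finite (W s)" for s by (simp add: W_def)
  have shift: "n + j * q \<in> S" if "n \<in> T" "j < H" for n j
  proof -
    have "(n + j * q) mod p \<in> {1..<p}" if p: "p \<in> A" for p
    proof -
      have "p dvd q" unfolding q_def using A p by (intro dvd_prodI) auto
      hence "p dvd j * q" by simp
      hence "\<not> p dvd n + j * q" using T(2)[OF \<open>n \<in> T\<close> p] by (metis dvd_add_left_iff)
      thus ?thesis using prime_gt_0_nat[OF A(2)[OF p]] by (auto simp: mod_eq_0_iff_dvd[symmetric] Suc_le_eq)
    qed
    moreover have "n + j * q \<le> X + H * q" "1 \<le> n + j * q"
      using that T(1) by (auto intro!: add_mono)
    ultimately show ?thesis by (simp add: S_def)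
  qed
  have cardS: "real (card S) \<le> N'"
  proof -
    have "\<bar>real (card S) - real (X + H * q) * (\<Prod>p\<in>A. real (card {1..<p}) / real p)\<bar> \<le> (\<Prod>p\<in>A. real (card {1..<p}))"
      unfolding S_def using A by (intro card_sifted_class_approx) auto
    moreover have "(\<Prod>p\<in>A. real (card {1..<p}) / real p) = (\<Prod>p\<in>A. 1 - 1 / real p)"
    proof (rule prod.cong[OF refl])
      fix p assume "p \<in> A"
      hence "p \<ge> 1" using A(2) prime_ge_1_nat by blast
      thus "real (card {1..<p}) / real p = 1 - 1 / real p" by (simp add: of_nat_diff field_simps)
    qed
    \<comment> \<open>The error of the sieve count is \<open>q\<close> times the product of 1 - 1/p,
      which the last summand \<open>\<Prod>A\<close> in the hypothesis on \<open>N'\<close>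
      absorbs.\<close>
    moreover have "(\<Prod>p\<in>A. real (card {1..<p})) = (\<Prod>p\<in>A. real (card {1..<p}) / real p) * real q"
      unfolding q_def of_nat_prod prod.distrib[symmetric] using A(2)
      by (intro prod.cong refl) (auto dest: prime_gt_0_nat)
    ultimately show ?thesis using N' by (simp add: q_def abs_le_iff algebra_simps)
  qed
  have inc: "(\<Sum>s\<in>S. card (W s)) = H * card T"
  proof -
    have "(\<Sum>s\<in>S. card (W s)) = (\<Sum>s\<in>S. \<Sum>j<H. if j * q \<le> s \<and> s - j * q \<in> T then 1 else 0)"
      unfolding W_def by (simp add: sum.inter_filter[symmetric])
    also have "\<dots> = (\<Sum>j<H. \<Sum>s\<in>S. if j * q \<le> s \<and> s - j * q \<in> T then 1 else 0)"
      by (rule sum.swap)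
    also have "\<dots> = (\<Sum>j<H. card {s\<in>S. j * q \<le> s \<and> s - j * q \<in> T})"
      using finS by (simp add: sum.inter_filter[symmetric])
    also have "\<dots> = (\<Sum>j<H. card T)"
    proof (rule sum.cong[OF refl])
      fix j assume j: "j \<in> {..<H}"
      have "bij_betw (\<lambda>n. n + j * q) T {s\<in>S. j * q \<le> s \<and> s - j * q \<in> T}"
        using shift j by (intro bij_betwI[where g = "\<lambda>s. s - j * q"]) auto
      thus "card {s\<in>S. j * q \<le> s \<and> s - j * q \<in> T} = card T" by (rule bij_betw_same_card[symmetric])
    qed
    finally show ?thesis by simp
  qed
  have "(\<Sum>s\<in>S. card (W s) choose Suc k) = (\<Sum>s\<in>S. card {J. J \<subseteq> W s \<and> card J = Suc k})"
    using finW by (simp add: n_subsets)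
  also have "\<dots> = (\<Sum>s\<in>S. \<Sum>J | J \<subseteq> {..<H} \<and> card J = Suc k. if J \<subseteq> W s then 1 else 0)"
  proof (rule sum.cong[OF refl])
    fix s
    have "{J. J \<subseteq> W s \<and> card J = Suc k} = {J \<in> {J. J \<subseteq> {..<H} \<and> card J = Suc k}. J \<subseteq> W s}"
      by (auto simp: W_def)
    thus "card {J. J \<subseteq> W s \<and> card J = Suc k} = (\<Sum>J | J \<subseteq> {..<H} \<and> card J = Suc k. if J \<subseteq> W s then 1 else 0)"
      by (simp add: sum.inter_filter[symmetric])
  qed
  also have "\<dots> = (\<Sum>J | J \<subseteq> {..<H} \<and> card J = Suc k. \<Sum>s\<in>S. if J \<subseteq> W s then 1 else 0)"
    by (rule sum.swap)
  also have "\<dots> = (\<Sum>J | J \<subseteq> {..<H} \<and> card J = Suc k. card {s\<in>S. J \<subseteq> W s})"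
    using finS by (simp add: sum.inter_filter[symmetric])
  finally have eq: "(\<Sum>s\<in>S. card (W s) choose Suc k) = (\<Sum>J | J \<subseteq> {..<H} \<and> card J = Suc k. card {s\<in>S. J \<subseteq> W s})" .
  have "real (\<Sum>s\<in>S. card (W s) choose Suc k) \<le> (\<Sum>J | J \<subseteq> {..<H} \<and> card J = Suc k. M)"
    unfolding eq of_nat_sum
  proof (rule sum_mono)
    fix J assume J: "J \<in> {J. J \<subseteq> {..<H} \<and> card J = Suc k}"
    hence "J \<noteq> {}" by auto
    then obtain j where j: "j \<in> J" by auto
    have fin: "finite {s. \<forall>j\<in>J. j * q \<le> s \<and> s - j * q \<in> T}"
    proof (rule finite_subset)
      show "{s. \<forall>j\<in>J. j * q \<le> s \<and> s - j * q \<in> T} \<subseteq> (\<lambda>n. n + j * q) ` T"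
        using j by (force simp: image_iff)
    qed (use finT in auto)
    have "card {s\<in>S. J \<subseteq> W s} \<le> card {s. \<forall>j\<in>J. j * q \<le> s \<and> s - j * q \<in> T}"
      using fin by (intro card_mono) (auto simp: W_def)
    thus "real (card {s\<in>S. J \<subseteq> W s}) \<le> M" using M(2)[of J] J by (simp add: q_def)
  qed
  also have "\<dots> = real (H choose Suc k) * M" by (simp add: n_subsets)
  finally have 1: "(\<Sum>s\<in>S. real (card (W s) choose Suc k)) \<le> real (H choose Suc k) * M" by simp
  \<comment> \<open>The constant part of the tangent bound. It is not positive, which is why the
    upper bound \<open>N'\<close> for \<open>card S\<close> can be used in a lower bound.\<close>
  define c where "c = l ^ Suc k - real (Suc k) * l ^ k * (real (Suc k) + l)"
  have "c \<le> 0"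
  proof -
    have "1 * l ^ Suc k \<le> real (Suc k) * l ^ Suc k" using l by (intro mult_right_mono) auto
    moreover have "0 \<le> real (Suc k) * l ^ k * real (Suc k)" using l by (intro mult_nonneg_nonneg) auto
    ultimately show ?thesis unfolding c_def by (simp add: algebra_simps)
  qed
  have "N' * l ^ Suc k = N' * c + real (Suc k) * l ^ k * (N' * (l + real (Suc k)))"
    by (simp add: c_def algebra_simps)
  also have "\<dots> \<le> real (card S) * c + real (Suc k) * l ^ k * (N' * (l + real (Suc k)))"
    using cardS \<open>c \<le> 0\<close> by (intro add_right_mono mult_right_mono_neg)
  also have "N' * (l + real (Suc k)) = (\<Sum>s\<in>S. real (card (W s)))"
    unfolding l(2)[symmetric] using arg_cong[OF inc, of real] by simp
  also have "real (card S) * c + real (Suc k) * l ^ k * (\<Sum>s\<in>S. real (card (W s)))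
     = (\<Sum>s\<in>S. l ^ Suc k + real (Suc k) * l ^ k * (real (card (W s)) - real (Suc k) - l))"
    by (simp add: c_def sum.distrib sum_distrib_left sum_subtractf algebra_simps)
  also have "\<dots> \<le> (\<Sum>s\<in>S. fact (Suc k) * real (card (W s) choose Suc k))"
    using l(1) by (intro sum_mono fact_mult_binomial_ge)
  also have "\<dots> \<le> fact (Suc k) * (real (H choose Suc k) * M)"
    unfolding sum_distrib_left[symmetric] using 1 by (intro mult_left_mono) auto
  also have "\<dots> = real ((H choose Suc k) * fact (Suc k)) * M" by (simp del: fact_Suc)
  also have "\<dots> \<le> real (H ^ Suc k) * M"
    using M(1) binomial_fact_pow[of H "Suc k"] by (intro mult_right_mono) (auto simp only: of_nat_le_iff)
  finally show ?thesis by (simp add: mult.commute)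
qed

section \<open>Elementary estimates for the primes up to y\<close>

definition primes_le :: "real \<Rightarrow> nat set" where
  "primes_le y = {p. prime p \<and> real p \<le> y}"

lemma finite_primes_le [simp]: "finite (primes_le y)"
  by (rule finite_subset[of _ "{..nat \<lfloor>y\<rfloor>}"]) (auto simp: primes_le_def le_nat_floor)

lemma prime_primes_le: "p \<in> primes_le y \<Longrightarrow> prime p"
  by (simp add: primes_le_def)

text \<open>At most ln N / ln p powers of p lie below N, and each contributes ln p, hence at most
  \<open>ln N\<close> per prime.\<close>

lemma chebyshev_psi_le_card_primes:
  assumes "N \<ge> 1"
  shows "chebyshev_psi N \<le> real (card (primes_le (real N))) * ln (real N)"
proof -
  define P where "P = {n\<in>{1..N}. primepow n}"
  have ap: "aprimedivisor n \<in> primes_le (real N)" if "n \<in> P" for n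
  proof -
    have n: "n > 1" using that by (auto simp: P_def primepow_gt_Suc_0)
    have "prime (aprimedivisor n)" using n by (intro prime_aprimedivisor') auto
    moreover have "aprimedivisor n \<le> n" using n by (intro dvd_imp_le aprimedivisor_dvd') auto
    ultimately show ?thesis using that by (auto simp: primes_le_def P_def)
  qed
  have "chebyshev_psi N = (\<Sum>n\<in>P. ln (real (aprimedivisor n)))"
    unfolding chebyshev_psi_def P_def by (subst sum.inter_filter) (auto simp: mangoldt_def intro!: sum.cong)
  also have "\<dots> = (\<Sum>p\<in>primes_le (real N). \<Sum>n | n \<in> P \<and> aprimedivisor n = p. ln (real (aprimedivisor n)))"
    by (rule sum.group[symmetric]) (auto simp: P_def intro: ap[unfolded P_def])
  also have "\<dots> \<le> (\<Sum>p\<in>primes_le (real N). ln (real N))"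
  proof (rule sum_mono)
    fix p assume p: "p \<in> primes_le (real N)"
    hence "prime p" by (simp add: primes_le_def)
    note p' = this prime_gt_1_nat[OF this]
    have lp: "ln (real p) > 0" using p' by auto
    define j where "j = nat \<lfloor>ln (real N) / ln (real p)\<rfloor>"
    have "{n. n \<in> P \<and> aprimedivisor n = p} \<subseteq> (\<lambda>i. p ^ i) ` {1..j}"
    proof
      fix n assume "n \<in> {n. n \<in> P \<and> aprimedivisor n = p}"
      hence n: "primepow n" "1 \<le> n" "n \<le> N" "aprimedivisor n = p" by (auto simp: P_def)
      obtain i where i: "i > 0" "n = p ^ i"
        using primepow_decompose[OF n(1)] n(4) primepow_gt_Suc_0[OF n(1)] by (metis gr0I power_0 less_irrefl One_nat_def)
      have "real i * ln (real p) = ln (real n)" using i p' by (simp add: ln_realpow)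
      also have "\<dots> \<le> ln (real N)" using n by simp
      finally have "real i \<le> ln (real N) / ln (real p)" using lp by (simp add: pos_le_divide_eq)
      hence "i \<le> j" unfolding j_def by (rule le_nat_floor)
      thus "n \<in> (\<lambda>i. p ^ i) ` {1..j}" using i by auto
    qed
    hence "card {n. n \<in> P \<and> aprimedivisor n = p} \<le> card {1..j}"
      by (meson card_image_le card_mono finite_atLeastAtMost finite_imageI order_trans)
    hence "real (card {n. n \<in> P \<and> aprimedivisor n = p}) * ln (real p) \<le> real j * ln (real p)"
      using lp by (intro mult_right_mono) auto
    also have "\<dots> \<le> (ln (real N) / ln (real p)) * ln (real p)"
      using lp assms unfolding j_def by (intro mult_right_mono of_nat_floor divide_nonneg_pos) auto
    also have "\<dots> = ln (real N)" using lp by simp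
    finally show "(\<Sum>n | n \<in> P \<and> aprimedivisor n = p. ln (real (aprimedivisor n))) \<le> ln (real N)"
      by (simp cong: conj_cong)
  qed
  also have "\<dots> = real (card (primes_le (real N))) * ln (real N)" by simp
  finally show ?thesis .
qed

lemma sum_ln_primes_le:
  assumes "y \<ge> 0"
  shows "(\<Sum>p\<in>primes_le y. ln (real p)) \<le> 4 * y"
proof -
  define N where "N = nat \<lfloor>y\<rfloor>"
  have sub: "primes_le y \<subseteq> {1..N}"
    by (auto simp: primes_le_def N_def le_nat_floor dest: prime_ge_1_nat)
  have "(\<Sum>p\<in>primes_le y. ln (real p)) = (\<Sum>p\<in>primes_le y. mangoldt p)"
    by (intro sum.cong refl) (simp add: primes_le_def)
  also have "\<dots> \<le> chebyshev_psi N" unfolding chebyshev_psi_def using sub by (intro sum_mono2 mangoldt_nonneg) auto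
  also have "\<dots> \<le> 4 * real N" by (rule chebyshev_psi_le)
  also have "\<dots> \<le> 4 * y" using assms by (simp add: N_def)
  finally show ?thesis .
qed

lemma primorial_le:
  assumes "y \<ge> 0"
  shows "real (\<Prod>(primes_le y)) \<le> exp (4 * y)"
proof -
  have pos: "real (\<Prod>(primes_le y)) > 0"
    unfolding of_nat_0_less_iff by (rule prod_pos) (auto simp: primes_le_def prime_gt_0_nat)
  have "ln (real (\<Prod>(primes_le y))) = (\<Sum>p\<in>primes_le y. ln (real p))"
    unfolding of_nat_prod by (rule ln_prod) (simp, auto dest!: prime_primes_le intro: prime_gt_0_nat)
  also have "\<dots> \<le> 4 * y" by (rule sum_ln_primes_le[OF assms])
  finally show ?thesis using pos by (metis exp_le_cancel_iff exp_ln)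
qed

definition mertens_prod :: "real \<Rightarrow> real" where
  "mertens_prod y = (\<Prod>p\<in>primes_le y. 1 - 1 / real p)"

lemma mertens_prod_pos: "mertens_prod y > 0"
  unfolding mertens_prod_def by (intro prod_pos) (auto simp: primes_le_def dest: prime_gt_1_nat)

lemma mertens_prod_le_1: "mertens_prod y \<le> 1"
  unfolding mertens_prod_def by (intro prod_le_1) (auto simp: primes_le_def divide_le_eq dest: prime_gt_1_nat)

lemma ex_delta_small:
  fixes f :: "real \<Rightarrow> real"
  assumes "(f \<longlongrightarrow> a) (at_right 0)" "c < a" "b > 0"
  obtains d where "0 < d" "d < b" "f d > c"
proof -
  have "eventually (\<lambda>d. f d > c) (at_right 0)" using assms(1,2) by (rule order_tendstoD)
  moreover have "eventually (\<lambda>d. d \<in> {0<..<b}) (at_right (0::real))"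
    using assms(3) by (rule eventually_at_right_real)
  ultimately have "eventually (\<lambda>d. f d > c \<and> d \<in> {0<..<b}) (at_right 0)" by (rule eventually_conj)
  then obtain d where "f d > c \<and> d \<in> {0<..<b}"
    using eventually_happens' trivial_limit_at_right_real by blast
  thus ?thesis using that by auto
qed

text \<open>\<open>M\<close> is any common bound for the number of occurrences of patterns with
  spacing \<open>q\<close>; \<open>champion_ge_window\<close> supplies the count of a champion. The
  expected number is x V (1 / (V ln x))^(k+1), as primes have density 1 / (V ln x) among the
  integers coprime to \<open>q\<close>. The bound on \<eta> makes \<open>q\<close> at most the
  square root of x.\<close>

theorem eventually_window_lower_bound:
  fixes \<eta> :: real
  assumes eta: "0 < \<eta>" "\<eta> \<le> 1/8"
  shows "\<forall>\<^sub>F x in at_top. \<forall>M\<ge>0.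
     (\<forall>H J. J \<subseteq> {..<H} \<longrightarrow> card J = Suc k \<longrightarrow>
        real (card {s. \<forall>j\<in>J. j * \<Prod>(primes_le (\<eta> * ln x)) \<le> s \<and>
           s - j * \<Prod>(primes_le (\<eta> * ln x)) \<in> primes_le x - primes_le (\<eta> * ln x)}) \<le> M) \<longrightarrow>
     3 / 4 * (x / ln x ^ Suc k) \<le> M * mertens_prod (\<eta> * ln x) ^ k"
proof -
  have "((\<lambda>d. ((1 - d) / (1 + d) - d) ^ Suc k) \<longlongrightarrow> ((1 - 0) / (1 + 0) - 0) ^ Suc k) (at_right (0::real))"
    by (intro tendsto_intros) auto
  then obtain d :: real where d: "0 < d" "d < 1/4" "((1 - d) / (1 + d) - d) ^ Suc k > 3/4"
    using ex_delta_small[of "\<lambda>d. ((1 - d) / (1 + d) - d) ^ Suc k" 1 "3/4" "1/4"] by auto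
  define c where "c = (1 - d) / (1 + d) - d"
  have c: "c > 0" "c ^ Suc k > 3/4"
  proof -
    have "(1 - d) / (1 + d) \<ge> 3/5" using d by (simp add: le_divide_eq)
    thus "c > 0" using d unfolding c_def by linarith
  qed (use d in \<open>simp add: c_def\<close>)
  have ev: "eventually (\<lambda>N. chebyshev_psi N \<ge> (1 - d/4) * real N) sequentially"
    using chebyshev_psi_lower_bound[of "d/4"] d by simp
  have fl: "filterlim (\<lambda>x::real. nat \<lfloor>x\<rfloor>) sequentially at_top"
    by (rule filterlim_compose[OF filterlim_nat_sequentially filterlim_floor_sequentially])
  have e1: "\<forall>\<^sub>F x::real in at_top. chebyshev_psi (nat \<lfloor>x\<rfloor>) \<ge> (1 - d/4) * real (nat \<lfloor>x\<rfloor>)"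
    using eventually_compose_filterlim[OF ev fl] .
  have e2: "\<forall>\<^sub>F x::real in at_top. (1 - d/4) * (x - 1) / ln x - \<eta> * ln x \<ge> (1 - d) * x / ln x"
    using d eta by real_asymp
  have e3: "\<forall>\<^sub>F x::real in at_top. ((ln x)\<^sup>2 + 2) * exp (1/2 * ln x) \<le> d * x"
    using d by real_asymp
  have e4: "\<forall>\<^sub>F x::real in at_top. ln x \<ge> real (Suc k) / d" by real_asymp
  show ?thesis
    using e1 e2 e3 e4 eventually_ge_at_top[of 3]
  proof eventually_elim
    case (elim x)
    define y where "y = \<eta> * ln x"
    define A where "A = primes_le y"
    define q where "q = \<Prod>A"
    define T where "T = primes_le x - A"
    define X where "X = nat \<lfloor>x\<rfloor>"
    \<comment> \<open>The length must exceed every multiple of ln x, so that \<open>Suc k\<close> is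
      negligible against the mean number of primes in a window, while \<open>H * q\<close> stays
      small against x.\<close>
    define H where "H = nat \<lceil>(ln x)\<^sup>2\<rceil>"
    define V where "V = mertens_prod y"
    have V: "V > 0" "V \<le> 1" unfolding V_def by (rule mertens_prod_pos mertens_prod_le_1)+
    have lnx: "ln x > 0" using elim by simp
    have y: "y \<ge> 0" using lnx eta by (simp add: y_def)
    have X: "real X \<le> x" "real X \<ge> x - 1" "X \<ge> 1" using elim unfolding X_def by linarith+
    have H: "real H \<ge> (ln x)\<^sup>2" "real H \<le> (ln x)\<^sup>2 + 1" "real H > 0"
    proof -
      show "real H \<ge> (ln x)\<^sup>2" unfolding H_def by (rule of_nat_ceiling)
      moreover have "(ln x)\<^sup>2 > 0" using lnx by simp
      ultimately show "real H > 0" by linarith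
      show "real H \<le> (ln x)\<^sup>2 + 1" using \<open>(ln x)\<^sup>2 > 0\<close> unfolding H_def by linarith
    qed
    have q: "real q \<le> exp (1/2 * ln x)"
    proof -
      have "real q \<le> exp (4 * y)" unfolding q_def A_def by (rule primorial_le[OF y])
      also have "4 * y \<le> 1/2 * ln x" using eta lnx by (simp add: y_def)
      finally show ?thesis by simp
    qed
    have cardT: "real (card T) \<ge> (1 - d) * x / ln x"
    proof -
      have "(1 - d/4) * (x - 1) \<le> (1 - d/4) * real X" using X d by (intro mult_left_mono) auto
      also have "\<dots> \<le> chebyshev_psi X" using elim by (simp add: X_def)
      also have "\<dots> \<le> real (card (primes_le (real X))) * ln (real X)" using X(3) by (rule chebyshev_psi_le_card_primes)
      also have "\<dots> \<le> real (card (primes_le x)) * ln x"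
        using X elim by (intro mult_mono of_nat_mono card_mono finite_primes_le) (auto simp: primes_le_def)
      finally have 1: "(1 - d/4) * (x - 1) / ln x \<le> real (card (primes_le x))"
        using lnx by (simp add: pos_divide_le_eq)
      have "card A \<le> card {1..nat \<lfloor>y\<rfloor>}"
        unfolding A_def by (intro card_mono) (auto simp: primes_le_def le_nat_floor dest: prime_ge_1_nat)
      hence "card A \<le> nat \<lfloor>y\<rfloor>" by simp
      hence "real (card A) \<le> y" using y by linarith
      moreover have "card (primes_le x) \<le> card (T \<union> A)"
        by (rule card_mono) (auto simp: T_def A_def)
      hence "card (primes_le x) \<le> card T + card A"
        using card_Un_le[of T A] by linarith
      hence "real (card (primes_le x)) \<le> real (card T) + real (card A)" by linarith
      ultimately show ?thesis using 1 elim(2) by (simp add: y_def)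
    qed
    define N' where "N' = (1 + d) * V * x"
    have N'pos: "N' > 0" using V d elim by (simp add: N'_def)
    \<comment> \<open>The mean number of primes per window, computed with \<open>N'\<close> as the
      number of windows, minus the shift \<open>Suc k\<close> of
      \<open>fact_mult_binomial_ge\<close>.\<close>
    define l where "l = real H * real (card T) / N' - real (Suc k)"
    have lb: "l / real H \<ge> c / (V * ln x)"
    proof -
      have "l / real H = real (card T) / N' - real (Suc k) / real H"
        using H by (simp add: l_def diff_divide_distrib)
      moreover have "real (card T) / N' \<ge> ((1 - d) * x / ln x) / N'"
        using cardT N'pos by (intro divide_right_mono) auto
      moreover have "((1 - d) * x / ln x) / N' = (1 - d) / (1 + d) / (V * ln x)"
      proof -
        have "(a * t / u) / (b * v * t) = a / b / (v * u)" if "t \<noteq> 0" for a b t u v :: real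
          using that by (simp add: divide_simps)
        thus ?thesis unfolding N'_def using elim(5) by simp
      qed
      moreover have "real (Suc k) / real H \<le> d / (V * ln x)"
      proof -
        have "real (Suc k) / real H \<le> real (Suc k) / (ln x)\<^sup>2"
          using H lnx by (intro divide_left_mono) auto
        also have "\<dots> \<le> d * ln x / (ln x)\<^sup>2"
          using elim(4) d by (intro divide_right_mono) (auto simp: field_simps)
        also have "\<dots> = d / (1 * ln x)" using lnx by (simp add: power2_eq_square)
        also have "\<dots> \<le> d / (V * ln x)"
          using V lnx d by (intro divide_left_mono mult_right_mono) auto
        finally show ?thesis .
      qed
      ultimately show ?thesis unfolding c_def by (simp add: diff_divide_distrib)
    qed
    have "c / (V * ln x) > 0" using c V lnx by simp
    hence "l / real H > 0" using lb by linarith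
    hence l: "l > 0" using H by (simp add: zero_less_divide_iff)
    show ?case
      unfolding y_def[symmetric] A_def[symmetric] T_def[symmetric] q_def[symmetric] V_def[symmetric]
    proof (intro allI impI)
      fix M :: real
      assume M0: "M \<ge> 0" and M: "\<forall>H J. J \<subseteq> {..<H} \<longrightarrow> card J = Suc k \<longrightarrow> real (card {s. \<forall>j\<in>J. j * q \<le> s \<and> s - j * q \<in> T}) \<le> M"
      have "N' * l ^ Suc k \<le> M * real H ^ Suc k"
      proof (rule window_bound[where A = A and T = T and X = X])
        show "T \<subseteq> {1..X}"
          by (auto simp: T_def primes_le_def X_def le_nat_floor dest: prime_ge_1_nat)
        show "\<not> p dvd n" if "n \<in> T" "p \<in> A" for n p
        proof
          assume "p dvd n"
          hence "p = n" using that primes_dvd_imp_eq by (auto simp: T_def A_def primes_le_def)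
          thus False using that by (auto simp: T_def)
        qed
        show "(\<Prod>p\<in>A. 1 - 1 / real p) * real (X + H * \<Prod>A + \<Prod>A) \<le> N'"
        proof -
          have "real (X + H * q + q) = real X + (real H + 1) * real q" by (simp add: algebra_simps)
          also have "\<dots> \<le> x + ((ln x)\<^sup>2 + 2) * exp (1/2 * ln x)"
          proof (rule add_mono[OF X(1)])
            show "(real H + 1) * real q \<le> ((ln x)\<^sup>2 + 2) * exp (1/2 * ln x)"
              using H q by (intro mult_mono) auto
          qed
          also have "\<dots> \<le> (1 + d) * x" using elim(3) by (simp add: algebra_simps)
          finally have "V * real (X + H * q + q) \<le> V * ((1 + d) * x)"
            using V by (intro mult_left_mono) auto
          thus ?thesis unfolding N'_def V_def mertens_prod_def A_def q_def by (simp add: mult_ac)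
        qed
        show "real (card {s. \<forall>j\<in>J. j * \<Prod>A \<le> s \<and> s - j * \<Prod>A \<in> T}) \<le> M" if "J \<subseteq> {..<H}" "card J = Suc k" for J
          using M that unfolding q_def by blast
        show "real H * real (card T) = N' * (l + real (Suc k))"
          using N'pos by (simp add: l_def)
      qed (use l M0 in \<open>auto simp: A_def prime_primes_le\<close>)
      hence "N' * (l / real H) ^ Suc k \<le> M" using H by (simp add: power_divide pos_divide_le_eq del: power_Suc)
      moreover have "V * x * (c / (V * ln x)) ^ Suc k \<le> N' * (l / real H) ^ Suc k"
        using lb c V lnx d elim by (intro mult_mono power_mono) (auto simp: N'_def)
      ultimately have "V * x * (c / (V * ln x)) ^ Suc k \<le> M" by linarith
      hence "V * x * (c / (V * ln x)) ^ Suc k * V ^ k \<le> M * V ^ k" using V by (intro mult_right_mono) auto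
      also have "V * x * (c / (V * ln x)) ^ Suc k * V ^ k = c ^ Suc k * (x / ln x ^ Suc k)"
        using V lnx by (simp add: power_divide power_mult_distrib field_simps)
      finally have "c ^ Suc k * (x / ln x ^ Suc k) \<le> M * V ^ k" .
      moreover have "3/4 * (x / ln x ^ Suc k) \<le> c ^ Suc k * (x / ln x ^ Suc k)"
        using c lnx elim by (intro mult_right_mono) auto
      ultimately show "3/4 * (x / ln x ^ Suc k) \<le> M * V ^ k" by linarith
    qed
  qed
qed

section \<open>Upper bounds for prime tuples\<close>

definition residue_count :: "int set \<Rightarrow> nat \<Rightarrow> nat" where
  "residue_count H p = card ((\<lambda>h. h mod int p) ` H)"

lemma residue_count_le_card: "finite H \<Longrightarrow> residue_count H p \<le> card H"
  unfolding residue_count_def by (rule card_image_le)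

lemma residue_count_pos: "finite H \<Longrightarrow> H \<noteq> {} \<Longrightarrow> residue_count H p > 0"
  by (auto simp: residue_count_def card_gt_0_iff)

lemma card_image_cong_kernel:
  assumes "\<And>a b. a \<in> H \<Longrightarrow> b \<in> H \<Longrightarrow> f a = f b \<longleftrightarrow> g a = g b"
  shows "card (f ` H) = card (g ` H)"
proof (rule bij_betw_same_card[of "\<lambda>y. g (inv_into H f y)"])
  have *: "g (inv_into H f (f a)) = g a" if "a \<in> H" for a
    using assms[of "inv_into H f (f a)" a] that by (simp add: f_inv_into_f inv_into_into)
  show "bij_betw (\<lambda>y. g (inv_into H f y)) (f ` H) (g ` H)"
    unfolding bij_betw_def inj_on_def using * assms by (auto simp: image_iff)
qed

text \<open>The classes of n for which p divides some n + h - m. As a reflected translate of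
  \<open>H\<close>, the set has the same size for every \<open>m\<close>.\<close>

definition residues_of :: "int \<Rightarrow> int set \<Rightarrow> nat \<Rightarrow> nat set" where
  "residues_of m H p = (\<lambda>h. nat ((m - h) mod int p)) ` H"

lemma card_residues_of:
  assumes "p > 0"
  shows "card (residues_of m H p) = residue_count H p"
  unfolding residues_of_def residue_count_def
proof (rule card_image_cong_kernel)
  fix a b
  have "nat ((m - a) mod int p) = nat ((m - b) mod int p) \<longleftrightarrow> (m - a) mod int p = (m - b) mod int p"
    using assms by (simp add: eq_nat_nat_iff)
  also have "\<dots> \<longleftrightarrow> int p dvd (m - a) - (m - b)" by (rule mod_eq_dvd_iff)
  also have "(m - a) - (m - b) = b - a" by simp
  also have "int p dvd b - a \<longleftrightarrow> b mod int p = a mod int p" by (rule mod_eq_dvd_iff[symmetric])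
  finally show "nat ((m - a) mod int p) = nat ((m - b) mod int p) \<longleftrightarrow> a mod int p = b mod int p" by auto
qed

lemma residues_of_subset: "p > 0 \<Longrightarrow> residues_of m H p \<subseteq> {..<p}"
  by (auto simp: residues_of_def nat_less_iff)

lemma mod_in_residues_of:
  assumes "p > 0"
  shows "n mod p \<in> residues_of m H p \<longleftrightarrow> (\<exists>h\<in>H. int p dvd int n + h - m)"
proof -
  have "n mod p = nat ((m - h) mod int p) \<longleftrightarrow> int p dvd int n + h - m" for h
  proof -
    have "n mod p = nat ((m - h) mod int p) \<longleftrightarrow> int (n mod p) = (m - h) mod int p"
      using assms by auto
    also have "\<dots> \<longleftrightarrow> int n mod int p = (m - h) mod int p" by (simp add: zmod_int)
    also have "\<dots> \<longleftrightarrow> int p dvd int n - (m - h)" by (rule mod_eq_dvd_iff)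
    finally show ?thesis by (simp add: algebra_simps)
  qed
  thus ?thesis by (auto simp: residues_of_def)
qed

section \<open>Scarcity of collisions modulo large primes, and the sieve remainder\<close>

lemma prod_primes_dvd:
  fixes t :: nat
  assumes "finite X" "\<And>p. p \<in> X \<Longrightarrow> prime p \<and> p dvd t"
  shows "\<Prod>X dvd t"
  using assms
proof (induction X rule: finite_induct)
  case (insert p X)
  have "coprime p (\<Prod>X)"
    using insert by (intro prod_coprime_right) (auto intro!: primes_coprime)
  moreover have "p dvd t" "\<Prod>X dvd t" using insert by auto
  ultimately have "p * \<Prod>X dvd t" by (intro divides_mult)
  thus ?case using insert by simp
qed simp

lemma card_large_prime_divisors_le:
  fixes t :: nat
  assumes t: "t > 0" "real t \<le> x" and y: "y > 1"
    and X: "finite X" "\<And>p. p \<in> X \<Longrightarrow> prime p \<and> real p > y \<and> p dvd t"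
  shows "real (card X) \<le> ln x / ln y"
proof -
  have "y ^ card X = (\<Prod>p\<in>X. y)" by simp
  also have "\<dots> \<le> (\<Prod>p\<in>X. real p)" using X y by (intro prod_mono) force
  also have "\<dots> = real (\<Prod>X)" by simp
  also have "\<dots> \<le> real t" using prod_primes_dvd[OF X(1), of t] X(2) t(1) by (intro of_nat_mono dvd_imp_le) auto
  also have "\<dots> \<le> x" by (rule t)
  finally have "ln (y ^ card X) \<le> ln x" using y t by (subst ln_le_cancel_iff) auto
  hence "real (card X) * ln y \<le> ln x" using y by (simp add: ln_realpow)
  thus ?thesis using y by (simp add: pos_le_divide_eq)
qed

text \<open>A prime modulo which two shifts coincide divides one of the differences, and a positive
  integer up to x has at most ln x / ln y prime factors above y.\<close>

lemma card_collision_primes_le: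
  fixes E :: "int set"
  assumes E: "finite E" "\<And>a b. a \<in> E \<Longrightarrow> b \<in> E \<Longrightarrow> real_of_int (a - b) \<le> x" and y: "y > 1" and x: "x \<ge> 1"
    and X: "finite X" "\<And>p. p \<in> X \<Longrightarrow> prime p \<and> real p > y \<and> residue_count E p \<noteq> card E"
  shows "real (card X) \<le> real (card E)^2 * (ln x / ln y)"
proof -
  define Y where "Y = (\<lambda>(a, b). {p \<in> X. a < b \<and> int p dvd b - a})"
  have "X \<subseteq> (\<Union>ab\<in>E \<times> E. Y ab)"
  proof
    fix p assume p: "p \<in> X"
    have "\<not> inj_on (\<lambda>h. h mod int p) E"
      using X(2)[OF p] E(1) by (auto simp: residue_count_def dest: card_image)
    then obtain a b where ab: "a \<in> E" "b \<in> E" "a < b" "a mod int p = b mod int p"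
      unfolding inj_on_def by (metis linorder_neqE)
    have "int p dvd b - a" using ab(4) mod_eq_dvd_iff[of b "int p" a] by simp
    thus "p \<in> (\<Union>ab\<in>E \<times> E. Y ab)" using ab p by (auto simp: Y_def)
  qed
  hence "card X \<le> card (\<Union>ab\<in>E \<times> E. Y ab)"
    using E X(1) by (intro card_mono) (auto simp: Y_def)
  also have "\<dots> \<le> (\<Sum>ab\<in>E \<times> E. card (Y ab))" using E by (intro card_UN_le) auto
  finally have "real (card X) \<le> (\<Sum>ab\<in>E \<times> E. real (card (Y ab)))"
    by (metis of_nat_le_iff of_nat_sum)
  also have "\<dots> \<le> (\<Sum>ab\<in>E \<times> E. ln x / ln y)"
  proof (rule sum_mono)
    fix ab assume "ab \<in> E \<times> E"
    then obtain a b where ab: "ab = (a, b)" "a \<in> E" "b \<in> E" by auto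
    show "real (card (Y ab)) \<le> ln x / ln y"
    proof (cases "a < b")
      case True
      show ?thesis
      proof (rule card_large_prime_divisors_le[of "nat (b - a)"])
        show "real (nat (b - a)) \<le> x" using E(2)[OF ab(3,2)] True by simp
        fix p assume "p \<in> Y ab"
        thus "prime p \<and> y < real p \<and> p dvd nat (b - a)"
          using X(2)[of p] True by (auto simp: Y_def ab int_dvd_int_iff[symmetric])
      qed (use True y X in \<open>auto simp: Y_def ab\<close>)
    qed (use x y in \<open>auto simp: Y_def ab\<close>)
  qed
  also have "\<dots> = real (card E)^2 * (ln x / ln y)"
    by (simp add: card_cartesian_product power2_eq_square)
  finally show ?thesis .
qed

text \<open>Primes p \<ge> K^(1/d) satisfy \<open>K \<le> p powr d\<close>, and the finitely many
  smaller ones make up the constant; so each summand is O(z^d). By unique factorisation at most z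
  sets have product up to z.\<close>

lemma sum_power_card_le:
  fixes z d :: real and K :: nat
  assumes d: "d > 0" and K: "K \<ge> 1"
  shows "\<exists>C\<ge>0. \<forall>z\<ge>1. \<forall>P. finite P \<longrightarrow> (\<forall>p\<in>P. prime p) \<longrightarrow>
     (\<Sum>A | A \<subseteq> P \<and> real (\<Prod>A) \<le> z. real K ^ card A) \<le> C * z powr (1 + d)"
proof -
  define B where "B = primes_le (real K powr (1 / d))"
  define C where "C = real K ^ card B"
  have "(\<Sum>A | A \<subseteq> P \<and> real (\<Prod>A) \<le> z. real K ^ card A) \<le> C * z powr (1 + d)"
    if z: "z \<ge> 1" and P: "finite P" "\<forall>p\<in>P. prime p" for z P
  proof -
    define DD where "DD = {A. A \<subseteq> P \<and> real (\<Prod>A) \<le> z}"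
    have fin: "finite DD" by (rule finite_subset[of _ "Pow P"]) (use P in \<open>auto simp: DD_def\<close>)
    have bd: "real K ^ card A \<le> C * z powr d" if A: "A \<in> DD" for A
    proof -
      have fA: "finite A" using A P finite_subset by (auto simp: DD_def)
      have pA: "prime p" if "p \<in> A" for p using that A P by (auto simp: DD_def)
      have big: "real K \<le> real p powr d" if "p \<in> A - B" for p
      proof -
        have "real K powr (1 / d) \<le> real p" using that pA by (auto simp: B_def primes_le_def)
        hence "(real K powr (1 / d)) powr d \<le> real p powr d" using d by (intro powr_mono2) auto
        thus ?thesis using d K by (simp add: powr_powr)
      qed
      have "card A = card (A \<inter> B) + card (A - B)"
        using fA card_Diff_subset_Int[of A B] card_mono[of A "A \<inter> B"] by auto
      hence "real K ^ card A = real K ^ card (A \<inter> B) * (\<Prod>p\<in>A - B. real K)"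
        by (simp add: power_add)
      also have "\<dots> \<le> C * (\<Prod>p\<in>A - B. real p powr d)"
        unfolding C_def using K big
        by (intro mult_mono power_increasing prod_mono card_mono) (auto simp: B_def intro!: prod_nonneg)
      finally have 1: "real K ^ card A \<le> C * (\<Prod>p\<in>A - B. real p powr d)" .
      have "(\<Prod>p\<in>A - B. real p powr d) \<le> (\<Prod>p\<in>A. real p powr d)"
      proof (rule prod_mono2)
        fix p assume "p \<in> A - (A - B)"
        hence "1 \<le> real p" using pA prime_ge_1_nat[of p] by auto
        thus "1 \<le> real p powr d" using d by (intro ge_one_powr_ge_zero) auto
      qed (use fA in auto)
      also have "(\<Prod>p\<in>A. real p powr d) = real (\<Prod>A) powr d"
        using fA by (simp add: prod_powr_distrib)
      also have "\<dots> \<le> z powr d" using A d by (intro powr_mono2) (auto simp: DD_def intro!: prod_nonneg)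
      finally have "C * (\<Prod>p\<in>A - B. real p powr d) \<le> C * z powr d"
        by (intro mult_left_mono) (auto simp: C_def)
      with 1 show ?thesis by linarith
    qed
    have "real (card DD) \<le> z"
    proof -
      have "inj_on \<Prod> DD"
      proof (rule inj_onI)
        fix A B assume AB: "A \<in> DD" "B \<in> DD" "\<Prod>A = \<Prod>B"
        have sub: "A' \<subseteq> B'" if "A' \<in> DD" "B' \<in> DD" "\<Prod>A' = \<Prod>B'" for A' B'
        proof
          fix p assume p: "p \<in> A'"
          have f: "finite A'" "finite B'" using that P finite_subset by (auto simp: DD_def)
          have pp: "prime p" using p that P by (auto simp: DD_def)
          have "p dvd \<Prod>B'" using p f that(3) dvd_prodI[of A' p id] by auto
          then obtain r where r: "r \<in> B'" "p dvd r" using prime_dvd_prod_iff[OF f(2) pp, of "\<lambda>x. x"] by auto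
          hence "p = r" using pp that P primes_dvd_imp_eq[of p r] by (auto simp: DD_def)
          thus "p \<in> B'" using r by simp
        qed
        show "A = B" using sub[of A B] sub[of B A] AB by auto
      qed
      moreover have "\<Prod> ` DD \<subseteq> {1..nat \<lfloor>z\<rfloor>}"
      proof
        fix n assume "n \<in> \<Prod> ` DD"
        then obtain A where A: "A \<in> DD" "n = \<Prod>A" by auto
        have "n > 0" unfolding A using A(1) P by (intro prod_pos) (metis (no_types, lifting) DD_def mem_Collect_eq prime_gt_0_nat subsetD)
        moreover have "real n \<le> z" using A by (simp add: DD_def)
        ultimately show "n \<in> {1..nat \<lfloor>z\<rfloor>}" by (simp add: le_nat_floor Suc_le_eq)
      qed
      ultimately have "card DD \<le> card {1..nat \<lfloor>z\<rfloor>}" by (intro card_inj_on_le) auto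
      hence "card DD \<le> nat \<lfloor>z\<rfloor>" by simp
      thus ?thesis using z by linarith
    qed
    have "(\<Sum>A\<in>DD. real K ^ card A) \<le> (\<Sum>A\<in>DD. C * z powr d)" by (intro sum_mono bd)
    also have "\<dots> = real (card DD) * (C * z powr d)" by simp
    also have "\<dots> \<le> z * (C * z powr d)" using \<open>real (card DD) \<le> z\<close> by (intro mult_right_mono) (auto simp: C_def)
    also have "\<dots> = C * z powr (1 + d)" using z by (simp add: powr_add)
    finally show ?thesis by (simp add: DD_def)
  qed
  moreover have "C \<ge> 0" by (simp add: C_def)
  ultimately show ?thesis by blast
qed

lemma eventually_powr_mult_ln_le:
  fixes a b c e :: real
  assumes "a < 1" "b > 0" "e > 0"
  shows "\<forall>\<^sub>F x in at_top. c * x powr a * ln x powr b \<le> e * x"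
proof -
  have "((\<lambda>x::real. x powr (- s) * ln x powr b) \<longlongrightarrow> 0) at_top" if "s > 0" for s
    using that assms(2) by real_asymp
  from tendsto_mult[OF tendsto_const[of c] this[of "1 - a"]] assms(1)
  have "((\<lambda>x. c * (x powr (- (1 - a)) * ln x powr b)) \<longlongrightarrow> 0) at_top" by simp
  hence "\<forall>\<^sub>F x in at_top. c * (x powr (- (1 - a)) * ln x powr b) < e"
    using assms(3) by (rule order_tendstoD)
  thus ?thesis
    using eventually_gt_at_top[of 0]
  proof eventually_elim
    case (elim x)
    have "x powr (1 + (a - 1)) = x powr 1 * x powr (a - 1)" by (rule powr_add)
    hence "c * x powr a * ln x powr b = x * (c * (x powr (- (1 - a)) * ln x powr b))"
      using elim(2) by simp
    also have "\<dots> \<le> x * e" using elim by (intro mult_left_mono) auto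
    finally show ?case by (simp add: mult.commute)
  qed
qed

text \<open>
  The primes up to \<open>\<eta> ln x\<close> sieve with all shifts in \<open>H\<close>, the larger ones only with the shifts in \<open>E\<close>. The
  remaining shifts may be much larger than \<open>x\<close> (if a champion consists of negative differences only), and
  then they could coincide modulo too many primes.
\<close>
theorem tuple_count_upper_bound:
  fixes k K :: nat
  assumes k: "k \<ge> 1" and kK: "k \<le> K"
  shows "\<exists>\<eta>. 0 < \<eta> \<and> \<eta> \<le> 1/8 \<and> (\<forall>\<^sub>F x in at_top. \<forall>E H m.
     E \<subseteq> H \<longrightarrow> finite H \<longrightarrow> card E = k \<longrightarrow> card H \<le> K \<longrightarrow>
     (\<forall>a\<in>E. \<forall>b\<in>E. real_of_int (a - b) \<le> x) \<longrightarrow>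
     real (card {n::nat. 1 \<le> n \<and> real n \<le> x \<and> (\<forall>h\<in>H. prime (int n + h - m))})
       \<le> 4/3 * fact k * 2 ^ k * (x / ln x ^ k) * (\<Prod>p\<in>primes_le (\<eta> * ln x). 1 - real (residue_count H p) / real p)
             / mertens_prod (\<eta> * ln x) ^ k + 1/12 * (x / ln x ^ k))"
proof -
  have "((\<lambda>d. ((1 - d) * (1 - 2 * d)) ^ k) \<longlongrightarrow> ((1 - 0) * (1 - 2 * 0)) ^ k) (at_right (0::real))"
    by (intro tendsto_intros)
  hence lim: "((\<lambda>d. ((1 - d) * (1 - 2 * d)) ^ k) \<longlongrightarrow> 1) (at_right (0::real))" by simp
  \<comment> \<open>The factor \<open>1 - d\<close> is the loss through the exceptional primes
    \<open>X\<close>, and \<open>1 - 2 * d\<close> the loss in \<open>ln w\<close> against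
    \<open>ln x / 2\<close>; together they cost the 4/3 of the statement.\<close>
  obtain d :: real where d: "0 < d" "d < 1/4" "((1 - d) * (1 - 2 * d)) ^ k > 3/4"
    by (rule ex_delta_small[OF lim, of "3/4" "1/4"]) simp_all
  \<comment> \<open>Gives \<open>\<Prod>P1 \<le> exp (4 * y) = x powr (d / 2)\<close>, which is
    exactly \<open>z / w\<close> below.\<close>
  define \<eta> where "\<eta> = d / 8"
  have eta: "0 < \<eta>" "\<eta> \<le> 1/8" using d(1,2) by (auto simp: \<eta>_def)
  have K: "K \<ge> 1" using k kK by simp
  from sum_power_card_le[OF d(1) K] obtain C where CC: "C \<ge> 0 \<and> (\<forall>z\<ge>1. \<forall>P. finite P \<longrightarrow> (\<forall>p\<in>P. prime p) \<longrightarrow>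
     (\<Sum>A | A \<subseteq> P \<and> real (\<Prod>A) \<le> z. real K ^ card A) \<le> C * z powr (1 + d))" ..
  note C_bd = conjunct2[OF CC, rule_format]
  have e1: "\<forall>\<^sub>F x::real in at_top. C\<^sup>2 * x powr (1 - d\<^sup>2) * ln x powr real k \<le> 1/24 * x"
    using d(1,2) k by (intro eventually_powr_mult_ln_le) auto
  have e2: "\<forall>\<^sub>F x::real in at_top. real K * x powr ((1 - d) / 2) * ln x powr real k \<le> 1/24 * x"
    using d(1,2) k by (intro eventually_powr_mult_ln_le) auto
  have "filterlim (\<lambda>x::real. ln (\<eta> * ln x)) at_top at_top"
    using eta(1) by real_asymp
  hence e3: "\<forall>\<^sub>F x::real in at_top. ln (\<eta> * ln x) \<ge> real k ^ 2 / (\<eta> * d)"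
    unfolding filterlim_at_top by blast
  have "filterlim (\<lambda>x::real. \<eta> * ln x) at_top at_top"
    using eta(1) by real_asymp
  hence e4: "\<forall>\<^sub>F x::real in at_top. \<eta> * ln x \<ge> real K + 1"
    unfolding filterlim_at_top by blast
  have e5: "\<forall>\<^sub>F x::real in at_top. \<eta> * ln x \<le> x powr ((1 - d) / 2)"
  proof -
    have "\<forall>\<^sub>F x::real in at_top. \<eta> * ln x \<le> x powr c" if "c > 0" for c
      using that eta(1) by real_asymp
    thus ?thesis using d(1,2) by simp
  qed
  have "\<forall>\<^sub>F x in at_top. \<forall>E H m.
     E \<subseteq> H \<longrightarrow> finite H \<longrightarrow> card E = k \<longrightarrow> card H \<le> K \<longrightarrow>
     (\<forall>a\<in>E. \<forall>b\<in>E. real_of_int (a - b) \<le> x) \<longrightarrow>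
     real (card {n::nat. 1 \<le> n \<and> real n \<le> x \<and> (\<forall>h\<in>H. prime (int n + h - m))})
       \<le> 4/3 * fact k * 2 ^ k * (x / ln x ^ k) * (\<Prod>p\<in>primes_le (\<eta> * ln x). 1 - real (residue_count H p) / real p)
             / mertens_prod (\<eta> * ln x) ^ k + 1/12 * (x / ln x ^ k)"
    using e1 e2 e3 e4 e5 eventually_ge_at_top[of 3]
  proof eventually_elim
    case (elim x)
    define y where "y = \<eta> * ln x"
    \<comment> \<open>Just below the square root of x, so that the squared remainder is O(x^(1 -
      d^2)). The factor \<open>2 ^ k\<close> arises here, since \<open>ln w\<close> is about
      \<open>ln x / 2\<close>.\<close>
    define z where "z = x powr ((1 - d) / 2)"
    define w where "w = x powr ((1 - 2 * d) / 2)"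
    define P where "P = primes_le z"
    define P1 where "P1 = primes_le y"
    define V where "V = mertens_prod y"
    have lnx: "ln x > 0" using elim by simp
    have y: "y > 1" "y > real K" using elim(4) K by (auto simp: y_def)
    have yz: "y \<le> z" using elim(5) by (simp add: y_def z_def)
    have P1P: "P1 \<subseteq> P" using yz by (auto simp: P_def P1_def primes_le_def)
    have z1: "z \<ge> 1" using y yz by simp
    have w1: "w \<ge> 1" unfolding w_def using elim d by (intro ge_one_powr_ge_zero) auto
    have wz: "w \<le> z" unfolding w_def z_def using elim d by (intro powr_mono) auto
    have V: "V > 0" "V \<le> 1" unfolding V_def by (rule mertens_prod_pos mertens_prod_le_1)+
    define err where "err = 1/12 * (x / ln x ^ k)"
    have powk: "ln x powr real k = ln x ^ k" using lnx by (simp add: powr_realpow)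
    have err1: "C\<^sup>2 * x powr (1 - d\<^sup>2) \<le> err / 2" and err2: "real K * z \<le> err / 2"
      using elim(1,2) lnx unfolding powk err_def z_def by (simp_all add: field_simps)
    show ?case
      unfolding y_def[symmetric] P1_def[symmetric] V_def[symmetric] err_def[symmetric]
    proof (intro allI impI)
      fix E H :: "int set" and m :: int
      assume EH: "E \<subseteq> H" and finH: "finite H" and cE: "card E = k" and cH: "card H \<le> K"
        and diff: "\<forall>a\<in>E. \<forall>b\<in>E. real_of_int (a - b) \<le> x"
      define cset where "cset = {n::nat. 1 \<le> n \<and> real n \<le> x \<and> (\<forall>h\<in>H. prime (int n + h - m))}"
      have finE: "finite E" using EH finH finite_subset by blast
      have Ene: "E \<noteq> {}" "H \<noteq> {}" using cE k EH by auto
      define PI where "PI = (\<Prod>p\<in>P1. 1 - real (residue_count H p) / real p)"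
      \<comment> \<open>The n for which some shifted value is itself a prime up to \<open>z\<close>:
        the sieve would discard them, and there are at most \<open>K * z\<close>.\<close>
      define small where "small = {n::nat. \<exists>h\<in>H. int n + h - m \<in> int ` {..nat \<lfloor>z\<rfloor>} - {0}}"
      have small_sub: "small \<subseteq> (\<lambda>(h, r). nat (int r - h + m)) ` (H \<times> {1..nat \<lfloor>z\<rfloor>})"
      proof
        fix n assume "n \<in> small"
        then obtain h r where hr: "h \<in> H" "r \<le> nat \<lfloor>z\<rfloor>" "int n + h - m = int r" "int r \<noteq> 0"
          by (auto simp: small_def)
        have "n = nat (int r - h + m)" using hr(3) by linarith
        moreover have "(h, r) \<in> H \<times> {1..nat \<lfloor>z\<rfloor>}" using hr by auto
        ultimately show "n \<in> (\<lambda>(h, r). nat (int r - h + m)) ` (H \<times> {1..nat \<lfloor>z\<rfloor>})" by force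
      qed
      have fin_small: "finite small" by (rule finite_subset[OF small_sub]) (use finH in auto)
      have "card small \<le> card (H \<times> {1..nat \<lfloor>z\<rfloor>})"
        using finH by (intro surj_card_le[OF _ small_sub]) auto
      also have "\<dots> = card H * nat \<lfloor>z\<rfloor>" by (simp add: card_cartesian_product)
      finally have "real (card small) \<le> real (card H * nat \<lfloor>z\<rfloor>)" by (simp only: of_nat_le_iff)
      also have "\<dots> \<le> real K * z" unfolding of_nat_mult using cH z1 by (intro mult_mono of_nat_floor) auto
      finally have card_small: "real (card small) \<le> err / 2" using err2 by simp
      have in_small: "n \<in> small" if n: "n \<in> cset" "p \<in> P" "h \<in> H" "int p dvd int n + h - m" for n p h
      proof -
        have "prime (int n + h - m)" using n by (auto simp: cset_def)
        moreover have "prime (int p)" using n by (auto simp: P_def primes_le_def)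
        ultimately have "int p = int n + h - m" using n(4) primes_dvd_imp_eq by blast
        moreover have "p \<le> nat \<lfloor>z\<rfloor>" "p \<noteq> 0" using n(2) by (auto simp: P_def primes_le_def le_nat_floor prime_gt_0_nat)
        ultimately show ?thesis using n(3) unfolding small_def by force
      qed
      have nuP1: "residue_count H p \<le> p" if "p \<in> P1" for p
      proof -
        have "p > 0" using that by (auto simp: P1_def primes_le_def prime_gt_0_nat)
        hence "card (residues_of 0 H p) \<le> card {..<p}" by (intro card_mono residues_of_subset) auto
        thus ?thesis using card_residues_of[OF \<open>p > 0\<close>] by simp
      qed
      have PI0: "PI \<ge> 0" unfolding PI_def
        using nuP1 by (intro prod_nonneg) (auto simp: divide_le_eq)
      have "real (card cset) \<le> 4/3 * fact k * 2 ^ k * (x / ln x ^ k) * PI / V ^ k + err"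
      \<comment> \<open>If the shifts cover all classes modulo some p \<le> y, the axioms of the
        sieve fail, but then p divides one of the values for every n and \<open>cset\<close> lies in
        \<open>small\<close>.\<close>
      proof (cases "\<exists>p\<in>P1. residue_count H p = p")
        case True
        then obtain p where p: "p \<in> P1" "residue_count H p = p" by auto
        have p0: "p > 0" using p by (auto simp: P1_def primes_le_def prime_gt_0_nat)
        have "residues_of m H p = {..<p}"
          using p p0 by (intro card_subset_eq residues_of_subset) (auto simp: card_residues_of)
        hence "\<exists>h\<in>H. int p dvd int n + h - m" for n
          using mod_in_residues_of[OF p0, of n m H] p0 by simp
        hence "cset \<subseteq> small" using in_small p P1P by blast
        hence "real (card cset) \<le> err / 2"
          using card_mono[OF fin_small] card_small by (meson of_nat_mono order_trans)
        moreover have "4/3 * fact k * 2 ^ k * (x / ln x ^ k) * PI / V ^ k \<ge> 0"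
          using PI0 V lnx elim by (intro divide_nonneg_pos mult_nonneg_nonneg) auto
        moreover have "err \<ge> 0" using lnx elim by (simp add: err_def)
        ultimately show ?thesis by linarith
      next
        case False
        define Om where "Om p = residues_of m (if p \<in> P1 then H else E) p" for p
        have p0: "p > 0" if "p \<in> P" for p using that by (auto simp: P_def primes_le_def prime_gt_0_nat)
        have cOm: "card (Om p) = residue_count (if p \<in> P1 then H else E) p" if "p \<in> P" for p
          unfolding Om_def using p0[OF that] by (rule card_residues_of)
        have nuK: "residue_count H p \<le> K" "residue_count E p \<le> K" for p
          using residue_count_le_card[OF finH, of p] residue_count_le_card[OF finE, of p] cH cE kK by auto
        interpret selberg_sieve P Om z
        proof
          show "finite P" by (simp add: P_def)
          show "prime p" if "p \<in> P" for p using that by (simp add: P_def primes_le_def)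
          show "Om p \<subseteq> {..<p}" if "p \<in> P" for p unfolding Om_def by (rule residues_of_subset[OF p0[OF that]])
          show "card (Om p) > 0" if "p \<in> P" for p
            unfolding cOm[OF that] using residue_count_pos finE finH Ene by auto
          show "card (Om p) < p" if "p \<in> P" for p
          proof (cases "p \<in> P1")
            case True
            thus ?thesis using cOm[OF that] nuP1[OF True] False by auto
          next
            case F: False
            hence "real p > y" using that by (auto simp: P_def P1_def primes_le_def)
            hence "K < p" using y(2) by simp
            thus ?thesis using cOm[OF that] F nuK(2)[of p] by simp
          qed
          show "z \<ge> 1" by (rule z1)
        qed
        define N where "N = nat \<lfloor>x\<rfloor>"
        \<comment> \<open>The large primes modulo which \<open>E\<close> collides. They are given up
          and join \<open>P1\<close> in the set \<open>Q\<close> of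
          \<open>L_lower_bound\<close>.\<close>
        define X where "X = {p \<in> P - P1. residue_count E p \<noteq> k}"
        define R where "R = {p \<in> P - P1. residue_count E p = k}"
        have finX: "finite X" by (simp add: X_def P_def)
        have "cset \<subseteq> {n\<in>{1..N}. \<forall>p\<in>P. n mod p \<notin> Om p} \<union> small"
        proof
          fix n assume n: "n \<in> cset"
          show "n \<in> {n\<in>{1..N}. \<forall>p\<in>P. n mod p \<notin> Om p} \<union> small"
          proof (cases "n \<in> small")
            case ns: False
            have "n mod p \<notin> Om p" if p: "p \<in> P" for p
            proof
              assume "n mod p \<in> Om p"
              then obtain h where "h \<in> H" "int p dvd int n + h - m"
                unfolding Om_def mod_in_residues_of[OF p0[OF p]] using EH by (auto split: if_splits)
              thus False using in_small[OF n p] ns by blast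
            qed
            thus ?thesis using n by (auto simp: cset_def N_def le_nat_floor)
          qed simp
        qed
        hence "card cset \<le> card ({n\<in>{1..N}. \<forall>p\<in>P. n mod p \<notin> Om p} \<union> small)"
          using fin_small by (intro card_mono) auto
        also have "\<dots> \<le> card {n\<in>{1..N}. \<forall>p\<in>P. n mod p \<notin> Om p} + card small" by (rule card_Un_le)
        finally have "real (card cset) \<le> real (card {n\<in>{1..N}. \<forall>p\<in>P. n mod p \<notin> Om p}) + real (card small)"
          by linarith
        also have "\<dots> \<le> (real N / L + (\<Sum>A\<in>\<D>. real K ^ card A)\<^sup>2) + err / 2"
          using nuK cOm by (intro add_mono selberg_bound card_small) auto
        also have "(\<Sum>A\<in>\<D>. real K ^ card A)\<^sup>2 \<le> err / 2"
        proof -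
          have "(\<Sum>A\<in>\<D>. real K ^ card A) \<le> C * z powr (1 + d)"
            unfolding \<D>_def using C_bd[OF z1 finP primeP] by simp
          hence "(\<Sum>A\<in>\<D>. real K ^ card A)\<^sup>2 \<le> (C * z powr (1 + d))\<^sup>2"
            by (intro power_mono sum_nonneg) auto
          also have "\<dots> = C\<^sup>2 * (z powr (1 + d) * z powr (1 + d))" by (simp add: power2_eq_square)
          also have "z powr (1 + d) * z powr (1 + d) = x powr (1 - d\<^sup>2)"
          proof -
            have "(1 - d) / 2 * (1 + d) + (1 - d) / 2 * (1 + d) = (1 - d) * (1 + d)" by simp
            also have "\<dots> = 1 - d\<^sup>2" by (simp add: power2_eq_square algebra_simps)
            finally show ?thesis unfolding z_def powr_powr powr_add[symmetric] by simp
          qed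
          finally show ?thesis using err1 by simp
        qed
        finally have main: "real (card cset) \<le> real N / L + err" by simp
        have Xpr: "prime p \<and> real p > y \<and> residue_count E p \<noteq> card E" if "p \<in> X" for p
          using that cE by (auto simp: X_def P_def P1_def primes_le_def)
        \<comment> \<open>Since y is proportional to ln x, \<open>card X / y\<close> is O(1 / ln y).
          The eventual lower bound on ln y pushes it below \<open>d\<close>, so the product of 1 -
          1/p over \<open>X\<close> is at least \<open>1 - d\<close> by Bernoulli.\<close>
        have "real (card X) \<le> real (card E)^2 * (ln x / ln y)"
          using diff y(1) elim(6) Xpr by (intro card_collision_primes_le finE finX) auto
        hence "real (card X) / y \<le> real k ^ 2 * (ln x / ln y) / y"
          unfolding cE using y by (intro divide_right_mono) auto
        also have "\<dots> \<le> d"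
        proof -
          have xy: "ln x / y = 1 / \<eta>" using lnx eta by (simp add: y_def)
          have "real k ^ 2 * (ln x / ln y) / y = real k ^ 2 * (ln x / y) / ln y" by simp
          also have "\<dots> = real k ^ 2 / \<eta> / ln y" unfolding xy by simp
          finally have "real k ^ 2 * (ln x / ln y) / y = real k ^ 2 / \<eta> / ln y" .
          moreover have "real k ^ 2 / \<eta> \<le> d * ln y" using elim(3) eta d by (simp add: y_def field_simps)
          hence "real k ^ 2 / \<eta> / ln y \<le> d" using y(1) by (subst pos_divide_le_eq) auto
          ultimately show ?thesis by linarith
        qed
        finally have Xd: "real (card X) / y \<le> d" .
        have "1 - d \<le> 1 + real (card X) * (- (1 / y))" using Xd by simp
        also have "\<dots> \<le> (1 + - (1 / y)) ^ card X"
          using y by (intro Bernoulli_inequality) auto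
        also have "\<dots> = (\<Prod>p\<in>X. 1 - 1 / y)" by simp
        also have "\<dots> \<le> (\<Prod>p\<in>X. 1 - 1 / real p)"
        proof (rule prod_mono, intro conjI)
          fix p assume "p \<in> X"
          hence "real p > y" using Xpr by auto
          thus "1 - 1 / y \<le> 1 - 1 / real p" using y by (simp add: frac_le)
        qed (use y in auto)
        finally have X1: "1 - d \<le> (\<Prod>p\<in>X. 1 - 1 / real p)" .
        have VX: "(\<Prod>p\<in>P1 \<union> X. 1 - 1 / real p) \<ge> V * (1 - d)"
        proof -
          have "(\<Prod>p\<in>P1 \<union> X. 1 - 1 / real p) = (\<Prod>p\<in>P1. 1 - 1 / real p) * (\<Prod>p\<in>X. 1 - 1 / real p)"
            using finX by (intro prod.union_disjoint) (auto simp: P1_def X_def)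
          thus ?thesis using X1 V unfolding V_def mertens_prod_def P1_def by simp
        qed
        have Lb: "L * (\<Prod>p\<in>P1. 1 - real (card (Om p)) / real p) \<ge> (\<Prod>p\<in>P1 \<union> X. 1 - 1 / real p) ^ k * (ln w ^ k / fact k)"
        proof (rule L_lower_bound[where R = R])
          show "P1 \<subseteq> P" by (rule P1P)
          show "R \<subseteq> P - P1" by (auto simp: R_def)
          show "card (Om p) = k" if "p \<in> R" for p using that cOm[of p] by (auto simp: R_def)
          show "finite (P1 \<union> X)" using finX by (simp add: P1_def)
          show "prime p" if "p \<in> P1 \<union> X" for p using that by (auto simp: P1_def P_def X_def primes_le_def)
          show "p \<in> R" if "prime p" "real p \<le> w" "p \<notin> P1 \<union> X" for p
            using that wz by (auto simp: R_def X_def P_def primes_le_def)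
          show "1 \<le> w" by (rule w1)
          have "real (\<Prod>P1) \<le> exp (4 * y)" unfolding P1_def using y by (intro primorial_le) auto
          also have "\<dots> = x powr (d / 2)" using elim(6) by (simp add: y_def \<eta>_def powr_def)
          finally have "w * real (\<Prod>P1) \<le> w * x powr (d / 2)" using w1 by (intro mult_left_mono) auto
          also have "\<dots> = z" unfolding w_def z_def powr_add[symmetric] by (simp add: add_divide_distrib[symmetric])
          finally show "w * real (\<Prod>P1) \<le> z" .
        qed
        have PIeq: "(\<Prod>p\<in>P1. 1 - real (card (Om p)) / real p) = PI"
          unfolding PI_def using cOm P1P by (intro prod.cong refl) auto
        have lnw: "ln w = (1 - 2 * d) / 2 * ln x" using elim(6) by (simp add: w_def ln_powr)
        have "(V * (1 - d)) ^ k * (((1 - 2 * d) / 2 * ln x) ^ k / fact k) \<le> L * PI"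
        proof -
          have "(V * (1 - d)) ^ k * (((1 - 2 * d) / 2 * ln x) ^ k / fact k) \<le> (\<Prod>p\<in>P1 \<union> X. 1 - 1 / real p) ^ k * (ln w ^ k / fact k)"
            unfolding lnw using VX V d lnx by (intro mult_right_mono power_mono) auto
          thus ?thesis using Lb unfolding PIeq by linarith
        qed
        also have "(V * (1 - d)) ^ k * (((1 - 2 * d) / 2 * ln x) ^ k / fact k) = ((1 - d) * (1 - 2 * d)) ^ k * (V ^ k * ln x ^ k / (2 ^ k * fact k))"
          by (simp add: power_mult_distrib power_divide)
        finally have LPI: "((1 - d) * (1 - 2 * d)) ^ k * (V ^ k * ln x ^ k / (2 ^ k * fact k)) \<le> L * PI" .
        have Q0: "V ^ k * ln x ^ k / (2 ^ k * fact k) > 0" using V lnx by simp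
        have "3/4 * (V ^ k * ln x ^ k / (2 ^ k * fact k)) \<le> L * PI"
          using LPI mult_right_mono[OF less_imp_le[OF d(3)] less_imp_le[OF Q0]] by linarith
        note Lge = this
        have gen: "1 / l \<le> P * (4/3) / a" if "a > 0" "l > 0" "3/4 * a \<le> l * P" for a l P :: real
          using that by (simp add: field_simps)
        have "1 / L \<le> PI * (4/3) / (V ^ k * ln x ^ k / (2 ^ k * fact k))"
          by (rule gen[OF Q0 _ Lge]) (use L_ge_1 in simp)
        also have "\<dots> = 4/3 * fact k * 2 ^ k * PI / (V ^ k * ln x ^ k)"
          by simp
        finally have "x * (1 / L) \<le> x * (4/3 * fact k * 2 ^ k * PI / (V ^ k * ln x ^ k))"
          using elim(6) by (intro mult_left_mono) auto
        moreover have "real N / L \<le> x * (1 / L)"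
          using L_ge_1 elim(6) by (simp add: N_def divide_right_mono)
        moreover have "x * (4/3 * fact k * 2 ^ k * PI / (V ^ k * ln x ^ k)) = 4/3 * fact k * 2 ^ k * (x / ln x ^ k) * PI / V ^ k"
          by (simp add: mult_ac)
        ultimately show ?thesis using main by linarith
      qed
      thus "real (card {n::nat. 1 \<le> n \<and> real n \<le> x \<and> (\<forall>h\<in>H. prime (int n + h - m))})
          \<le> 4/3 * fact k * 2 ^ k * (x / ln x ^ k) * (\<Prod>p\<in>P1. 1 - real (residue_count H p) / real p) / V ^ k + err"
        unfolding cset_def PI_def .
    qed
  qed
  with eta show ?thesis by (intro exI[of _ \<eta>] conjI)
qed

section \<open>Prime difference champions\<close>

lemma finite_prime_tuple_set:
  "finite {p :: int. prime p \<and> real_of_int p \<le> x - real_of_int (Max D) \<and> (\<forall>d\<in>D. prime (p + d))}"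
proof (rule finite_subset)
  show "{p :: int. prime p \<and> real_of_int p \<le> x - real_of_int (Max D) \<and> (\<forall>d\<in>D. prime (p + d))}
      \<subseteq> {0..\<lfloor>x - real_of_int (Max D)\<rfloor>}"
  proof
    fix p assume "p \<in> {p :: int. prime p \<and> real_of_int p \<le> x - real_of_int (Max D) \<and> (\<forall>d\<in>D. prime (p + d))}"
    hence "p \<ge> 0" "p \<le> \<lfloor>x - real_of_int (Max D)\<rfloor>"
      unfolding le_floor_iff using prime_ge_2_int[of p] by auto
    thus "p \<in> {0..\<lfloor>x - real_of_int (Max D)\<rfloor>}" by simp
  qed
qed auto

text \<open>With \<open>p = s - Max J * q\<close> as the smallest member of the pattern, the others
  are \<open>p + (Max J - j) * q\<close>, so each pattern in \<open>T\<close> is a prime tuple for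
  the reflected differences.\<close>

lemma window_card_le_prime_tuple_count:
  fixes J T :: "nat set" and D :: "int set"
  assumes J: "finite J" "J \<noteq> {}" and q: "q > 0" and T: "T \<subseteq> primes_le x"
    and D: "D \<subseteq> (\<lambda>j. int ((Max J - j) * q)) ` J" "D \<noteq> {}"
  shows "card {s. \<forall>j\<in>J. j * q \<le> s \<and> s - j * q \<in> T} \<le> prime_tuple_count x D"
  unfolding prime_tuple_count_def
proof (rule card_inj_on_le)
  let ?f = "\<lambda>s. int (s - Max J * q)"
  have MJ: "Max J \<in> J" using J by simp
  have finD: "finite D" using D(1) J(1) finite_subset by blast
  show "inj_on ?f {s. \<forall>j\<in>J. j * q \<le> s \<and> s - j * q \<in> T}"
  proof (rule inj_onI)
    fix s t assume st: "s \<in> {s. \<forall>j\<in>J. j * q \<le> s \<and> s - j * q \<in> T}" "t \<in> {s. \<forall>j\<in>J. j * q \<le> s \<and> s - j * q \<in> T}"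
      "?f s = ?f t"
    hence "Max J * q \<le> s" "Max J * q \<le> t" using MJ by auto
    thus "s = t" using st(3) by linarith
  qed
  show "?f ` {s. \<forall>j\<in>J. j * q \<le> s \<and> s - j * q \<in> T} \<subseteq>
      {p. prime p \<and> real_of_int p \<le> x - real_of_int (Max D) \<and> (\<forall>d\<in>D. prime (p + d))}"
  proof
    fix p assume "p \<in> ?f ` {s. \<forall>j\<in>J. j * q \<le> s \<and> s - j * q \<in> T}"
    then obtain s where s: "\<And>j. j \<in> J \<Longrightarrow> j * q \<le> s \<and> s - j * q \<in> T" "p = ?f s" by auto
    have shift: "\<exists>t\<in>T. p + d = int t" if dD: "d \<in> D" for d
    proof -
      obtain j where j: "j \<in> J" "d = int ((Max J - j) * q)" using dD D(1) by blast
      have "j \<le> Max J" using j J by simp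
      hence "(Max J - j) * q + j * q = Max J * q" by (simp add: add_mult_distrib[symmetric])
      moreover have "Max J * q \<le> s" "j * q \<le> s" using s(1) MJ j by auto
      ultimately have "s - Max J * q + (Max J - j) * q = s - j * q" by linarith
      hence "p + d = int (s - j * q)" using s(2) j(2) by (metis of_nat_add)
      thus ?thesis using s(1)[OF j(1)] by blast
    qed
    have "Max D \<in> D" using finD D(2) by simp
    then obtain t where t: "t \<in> T" "p + Max D = int t" using shift by blast
    hence "real_of_int (p + Max D) \<le> x" using T by (auto simp: primes_le_def)
    moreover have "prime p"
    proof -
      have "s - Max J * q \<in> primes_le x" using s(1)[OF MJ] T by blast
      thus ?thesis unfolding s(2) prime_nat_int_transfer by (rule prime_primes_le)
    qed
    moreover have "prime (p + d)" if "d \<in> D" for d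
      using shift[OF that] T by (auto simp: primes_le_def)
    ultimately show "p \<in> {p. prime p \<and> real_of_int p \<le> x - real_of_int (Max D) \<and> (\<forall>d\<in>D. prime (p + d))}"
      by auto
  qed
qed (rule finite_prime_tuple_set)

text \<open>
  With \<open>S = UNIV\<close> the difference \<open>0\<close> may be used, so that a window of only \<open>k\<close> primes already
  yields an admissible competitor.
\<close>
definition tuple_size :: "int set \<Rightarrow> nat \<Rightarrow> nat" where
  "tuple_size S k = (if S = UNIV then k else Suc k)"

lemma champion_ge_window:
  fixes J T :: "nat set"
  assumes S: "S = UNIV \<or> S = {0<..}" and k: "k \<ge> 1"
    and D: "prime_difference_champion S k x D"
    and J: "card J = tuple_size S k" and q: "q > 0" and T: "T \<subseteq> primes_le x"
  shows "card {s. \<forall>j\<in>J. j * q \<le> s \<and> s - j * q \<in> T} \<le> prime_tuple_count x D"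
proof -
  have fJ: "finite J" and neJ: "J \<noteq> {}" using J k by (auto simp: tuple_size_def card_gt_0_iff[symmetric] split: if_splits intro: card_ge_0_finite)
  define I where "I = (\<lambda>j. int ((Max J - j) * q)) ` J"
  have "inj_on (\<lambda>j. int ((Max J - j) * q)) J"
  proof (rule inj_onI)
    fix i j assume ij: "i \<in> J" "j \<in> J" "int ((Max J - i) * q) = int ((Max J - j) * q)"
    hence "i \<le> Max J" "j \<le> Max J" using fJ by auto
    moreover have "Max J - i = Max J - j" using ij(3) q by simp
    ultimately show "i = j" by linarith
  qed
  hence cI: "card I = tuple_size S k" unfolding I_def J[symmetric] by (rule card_image)
  have I0: "0 \<in> I" unfolding I_def using fJ neJ by (intro image_eqI[of _ _ "Max J"]) auto
  have fI: "finite I" using fJ by (simp add: I_def)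
  \<comment> \<open>The reflected pattern always contains 0, from \<open>j = Max J\<close>. It is an
    admissible difference for \<open>S = UNIV\<close>; otherwise it is dropped, so that
    \<open>J\<close> must have \<open>k + 1\<close> elements.\<close>
  define D' where "D' = (if S = UNIV then I else I - {0})"
  have cD': "card D' = k" using cI I0 fI by (auto simp: D'_def tuple_size_def)
  hence "D' \<noteq> {}" using k by auto
  moreover have "D' \<subseteq> (\<lambda>j. int ((Max J - j) * q)) ` J" by (auto simp: D'_def I_def)
  ultimately have 1: "card {s. \<forall>j\<in>J. j * q \<le> s \<and> s - j * q \<in> T} \<le> prime_tuple_count x D'"
    by (intro window_card_le_prime_tuple_count[OF fJ neJ q T])
  have "D' \<subseteq> S"
  proof (cases "S = UNIV")
    case False
    hence "S = {0<..}" using S by simp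
    moreover have "y \<ge> 0" if "y \<in> I" for y using that by (auto simp: I_def)
    ultimately show ?thesis using False by (force simp: D'_def)
  qed auto
  moreover have "finite D'" using fI by (simp add: D'_def)
  ultimately have "prime_tuple_count x D' \<le> prime_tuple_count x D"
    using D cD' by (auto simp: prime_difference_champion_def)
  with 1 show ?thesis by simp
qed

text \<open>With negative differences p itself can exceed x. Then \<open>p + Min D\<close> is
  counted in its place: it is prime and at most \<open>p + Max D \<le> x\<close>. For positive
  differences p already lies below x.\<close>

lemma prime_tuple_count_le_shifted:
  fixes D :: "int set"
  assumes D: "finite D" "D \<noteq> {}" and m: "m = Min D \<or> m = 0 \<and> D \<subseteq> {0<..}"
  shows "prime_tuple_count x D \<le> card {n::nat. 1 \<le> n \<and> real n \<le> x \<and> (\<forall>h\<in>insert 0 D. prime (int n + h - m))}"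
  unfolding prime_tuple_count_def
proof (rule card_inj_on_le)
  let ?C = "{p :: int. prime p \<and> real_of_int p \<le> x - real_of_int (Max D) \<and> (\<forall>d\<in>D. prime (p + d))}"
  have MD: "Min D \<in> D" "Max D \<in> D" using D by auto
  have pm: "p + m \<ge> 2 \<and> real_of_int (p + m) \<le> x" if "p \<in> ?C" for p
    using m
  proof
    assume "m = Min D"
    moreover have "prime (p + Min D)" using that MD by auto
    moreover have "Min D \<le> Max D" using MD D by simp
    ultimately show ?thesis using that by (auto dest: prime_ge_2_int)
  next
    assume "m = 0 \<and> D \<subseteq> {0<..}"
    moreover from this have "Max D > 0" using MD by auto
    ultimately show ?thesis using that by (auto dest: prime_ge_2_int)
  qed
  show "inj_on (\<lambda>p. nat (p + m)) ?C"
  proof (rule inj_onI)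
    fix a b assume "a \<in> ?C" "b \<in> ?C" "nat (a + m) = nat (b + m)"
    thus "a = b" using pm[of a] pm[of b] by linarith
  qed
  show "(\<lambda>p. nat (p + m)) ` ?C \<subseteq> {n::nat. 1 \<le> n \<and> real n \<le> x \<and> (\<forall>h\<in>insert 0 D. prime (int n + h - m))}"
  proof
    fix n assume "n \<in> (\<lambda>p. nat (p + m)) ` ?C"
    then obtain p where p: "p \<in> ?C" "n = nat (p + m)" by auto
    have n: "int n = p + m" using pm[OF p(1)] p(2) by simp
    have "real n = real_of_int (p + m)" by (metis n of_int_of_nat_eq)
    hence "1 \<le> n" "real n \<le> x" using pm[OF p(1)] n by auto
    moreover have "\<forall>h\<in>insert 0 D. prime (int n + h - m)"
    proof -
      have eq: "int n + h - m = p + h" for h using n by simp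
      show ?thesis unfolding eq using p(1) by auto
    qed
    ultimately show "n \<in> {n::nat. 1 \<le> n \<and> real n \<le> x \<and> (\<forall>h\<in>insert 0 D. prime (int n + h - m))}"
      by (intro CollectI conjI)
  qed
  show "finite {n::nat. 1 \<le> n \<and> real n \<le> x \<and> (\<forall>h\<in>insert 0 D. prime (int n + h - m))}"
    by (rule finite_subset[of _ "{..nat \<lfloor>x\<rfloor>}"]) (auto simp: le_nat_floor)
qed

section \<open>From local densities to sums over primes\<close>

lemma residue_count_ge_2_if_not_dvd_Gcd:
  assumes "finite D" "prime p" "\<not> int p dvd Gcd D"
  shows "residue_count (insert 0 D) p \<ge> 2"
proof -
  obtain d where d: "d \<in> D" "\<not> int p dvd d" using assms(3) by (auto simp: dvd_Gcd_iff)
  have "card {0 mod int p, d mod int p} \<le> residue_count (insert 0 D) p"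
    unfolding residue_count_def using d assms(1) by (intro card_mono) auto
  moreover have "d mod int p \<noteq> 0" using d(2) by (simp add: dvd_eq_mod_eq_0)
  ultimately show ?thesis by (simp add: card_insert_if)
qed

lemma residue_count_ge_if_not_dvd_Delta0:
  assumes "finite D" "\<not> int p dvd Delta0 D"
  shows "residue_count (insert 0 D) p \<ge> Suc (card D)"
proof -
  define d where "d = (\<lambda>i. (0 # sorted_list_of_set D) ! i)"
  have dmem: "d i \<in> insert 0 D" if "i \<le> card D" for i
  proof -
    have "i < length (0 # sorted_list_of_set D)" using that assms(1) by (simp add: le_imp_less_Suc)
    hence "d i \<in> set (0 # sorted_list_of_set D)" unfolding d_def by (rule nth_mem)
    thus ?thesis using assms(1) by simp
  qed
  have ndvd: "\<not> int p dvd d i - d j" if "i \<le> card D" "j < i" for i j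
  proof
    assume dv: "int p dvd d i - d j"
    have "d i - d j dvd (\<Prod>j<i. d i - d j)" using that by (intro dvd_prodI) auto
    also have "\<dots> dvd (\<Prod>i\<le>card D. \<Prod>j<i. d i - d j)" using that by (intro dvd_prodI) auto
    also have "(\<Prod>i\<le>card D. \<Prod>j<i. d i - d j) = Delta0 D"
      unfolding Delta0_def d_def Let_def by (rule refl)
    finally have "int p dvd Delta0 D" using dv by (rule dvd_trans[rotated])
    with assms(2) show False by (rule notE)
  qed
  have "inj_on (\<lambda>i. d i mod int p) {..card D}"
  proof (rule inj_onI)
    fix i j assume ij: "i \<in> {..card D}" "j \<in> {..card D}" "d i mod int p = d j mod int p"
    have "int p dvd d i - d j" "int p dvd d j - d i"
      using ij(3) ij(3)[symmetric] unfolding mod_eq_dvd_iff by blast+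
    thus "i = j" using ndvd[of i j] ndvd[of j i] ij(1,2) by (meson atMost_iff linorder_neqE_nat)
  qed
  hence "card ((\<lambda>i. d i mod int p) ` {..card D}) = Suc (card D)" by (simp add: card_image)
  moreover have "(\<lambda>i. d i mod int p) ` {..card D} \<subseteq> (\<lambda>h. h mod int p) ` insert 0 D"
  proof -
    have "d ` {..card D} \<subseteq> insert 0 D" using dmem by blast
    from image_mono[OF this, of "\<lambda>h. h mod int p"] show ?thesis by (simp only: image_image)
  qed
  ultimately show ?thesis unfolding residue_count_def using assms(1) by (metis card_mono finite_imageI finite_insert)
qed

lemma local_factor_le:
  fixes p j v :: nat
  assumes "p \<ge> 1" "v \<ge> Suc j"
  shows "1 - real v / real p \<le> (1 - 1 / real p) * exp (- (real j / real p))"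
proof -
  have "1 - real v / real p \<le> 1 - real (Suc j) / real p" using assms by (simp add: divide_right_mono)
  also have "\<dots> \<le> 1 - real (Suc j) / real p + (1 / real p) * (real j / real p)" by simp
  also have "\<dots> = (1 - 1 / real p) * (1 + - (real j / real p))"
    by (simp add: algebra_simps add_divide_distrib)
  also have "\<dots> \<le> (1 - 1 / real p) * exp (- (real j / real p))"
    using assms by (intro mult_left_mono exp_ge_add_one_self) auto
  finally show ?thesis .
qed

text \<open>Pulling 1 - 1/p out of every local factor cancels \<open>mertens_prod y\<close>; what
  remains is at most the exponential of minus the sum. It is applied with \<open>f\<close> equal to
  1 or \<open>k\<close> at the primes of interest and 0 elsewhere.\<close>

lemma sum_le_ln_of_product_bound:
  fixes v :: "nat \<Rightarrow> nat" and f :: "nat \<Rightarrow> nat"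
  assumes v: "\<And>p. p \<in> primes_le y \<Longrightarrow> Suc (f p) \<le> v p \<and> v p \<le> p"
    and c: "c > 0" "mertens_prod y \<le> c * (\<Prod>p\<in>primes_le y. 1 - real (v p) / real p)"
  shows "(\<Sum>p\<in>primes_le y. real (f p) / real p) \<le> ln c"
proof -
  define F where "F = (\<Sum>p\<in>primes_le y. real (f p) / real p)"
  have "(\<Prod>p\<in>primes_le y. 1 - real (v p) / real p) \<le> (\<Prod>p\<in>primes_le y. (1 - 1 / real p) * exp (- (real (f p) / real p)))"
  proof (rule prod_mono, intro conjI)
    fix p assume p: "p \<in> primes_le y"
    hence "p \<ge> 1" by (auto simp: primes_le_def dest: prime_ge_1_nat)
    thus "1 - real (v p) / real p \<le> (1 - 1 / real p) * exp (- (real (f p) / real p))" "0 \<le> 1 - real (v p) / real p"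
      using v[OF p] by (auto intro!: local_factor_le)
  qed
  also have "\<dots> = mertens_prod y * exp (- F)"
    by (simp add: prod.distrib mertens_prod_def F_def exp_sum sum_negf[symmetric])
  finally have "c * (\<Prod>p\<in>primes_le y. 1 - real (v p) / real p) \<le> c * (mertens_prod y * exp (- F))"
    using c(1) by (intro mult_left_mono) auto
  with c(2) have "mertens_prod y \<le> c * (mertens_prod y * exp (- F))" by linarith
  hence "mertens_prod y * 1 \<le> mertens_prod y * (c * exp (- F))" by (simp add: mult_ac)
  hence "1 \<le> c * exp (- F)" using mertens_prod_pos[of y] by (subst (asm) mult_le_cancel_left_pos)
  hence "exp F \<le> c" by (simp add: exp_minus field_simps)
  thus ?thesis using c(1) unfolding F_def[symmetric] by (simp add: ln_ge_iff)
qed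

text \<open>For p > y = \<eta> ln x the term 1/p is at most ln p / (y ln y), and the sum of ln p up
  to 2 ln x is O(y) by Chebyshev's bound; the total is O(1 / ln y).\<close>

lemma sum_inverse_primes_tendsto_0:
  fixes \<eta> :: real
  assumes "\<eta> > 0"
  shows "((\<lambda>x. \<Sum>p\<in>primes_le (2 * ln x) - primes_le (\<eta> * ln x). 1 / real p) \<longlongrightarrow> 0) at_top"
proof (rule tendsto_sandwich)
  show "\<forall>\<^sub>F x in at_top. 0 \<le> (\<Sum>p\<in>primes_le (2 * ln x) - primes_le (\<eta> * ln x). 1 / real p)"
    by (intro always_eventually allI sum_nonneg) auto
  have "filterlim (\<lambda>x::real. \<eta> * ln x) at_top at_top" using assms by real_asymp
  hence "\<forall>\<^sub>F x::real in at_top. \<eta> * ln x \<ge> 2" unfolding filterlim_at_top by blast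
  thus "\<forall>\<^sub>F x in at_top. (\<Sum>p\<in>primes_le (2 * ln x) - primes_le (\<eta> * ln x). 1 / real p) \<le> 8 / \<eta> * (1 / ln (\<eta> * ln x))"
  proof eventually_elim
    case (elim x)
    define y where "y = \<eta> * ln x"
    have y: "y \<ge> 2" "ln y > 0" using elim by (auto simp: y_def)
    have lnx: "ln x > 0" using elim assms by (smt (verit) mult_nonneg_nonpos)
    have "(\<Sum>p\<in>primes_le (2 * ln x) - primes_le y. 1 / real p) \<le> (\<Sum>p\<in>primes_le (2 * ln x) - primes_le y. ln (real p) / (y * ln y))"
    proof (rule sum_mono)
      fix p assume "p \<in> primes_le (2 * ln x) - primes_le y"
      hence p: "real p > y" by (auto simp: primes_le_def)
      have "y * ln y \<le> real p * ln (real p)" using p y by (intro mult_mono) auto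
      thus "1 / real p \<le> ln (real p) / (y * ln y)" using p y by (simp add: field_simps)
    qed
    also have "\<dots> \<le> (\<Sum>p\<in>primes_le (2 * ln x). ln (real p) / (y * ln y))"
      using y by (intro sum_mono2 finite_primes_le) (auto simp: primes_le_def dest!: prime_ge_1_nat)
    also have "\<dots> = (\<Sum>p\<in>primes_le (2 * ln x). ln (real p)) / (y * ln y)" by (simp add: sum_divide_distrib)
    also have "\<dots> \<le> (4 * (2 * ln x)) / (y * ln y)"
      using y lnx by (intro divide_right_mono sum_ln_primes_le) auto
    also have "\<dots> = 8 / \<eta> * (1 / ln y)" using lnx assms by (simp add: y_def)
    finally show ?case by (simp add: y_def)
  qed
  have "((\<lambda>x::real. 1 / ln (\<eta> * ln x)) \<longlongrightarrow> 0) at_top" using assms by real_asymp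
  from tendsto_mult[OF tendsto_const[of "8 / \<eta>"] this]
  show "((\<lambda>x. 8 / \<eta> * (1 / ln (\<eta> * ln x))) \<longlongrightarrow> 0) at_top" by simp
qed auto

lemma champion_local_density:
  assumes k: "k \<ge> 1" and S: "S = UNIV \<or> S = {0<..}"
  shows "\<exists>\<eta>>0. \<forall>\<^sub>F x in at_top. \<forall>D. prime_difference_champion S k x D \<longrightarrow>
     mertens_prod (\<eta> * ln x) \<le> 2 * (fact (Suc k) * 2 ^ Suc k) * (\<Prod>p\<in>primes_le (\<eta> * ln x). 1 - real (residue_count (insert 0 D) p) / real p) \<and>
     (\<forall>p\<in>primes_le (\<eta> * ln x). residue_count (insert 0 D) p \<le> p)"
proof -
  define t where "t = tuple_size S k"
  have t: "t \<ge> 1" "t \<le> Suc k" using k by (auto simp: t_def tuple_size_def)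
  then obtain t0 where t0: "t = Suc t0" by (cases t) auto
  obtain \<eta> where eta: "0 < \<eta>" "\<eta> \<le> 1/8" and upper: "\<forall>\<^sub>F x in at_top. \<forall>E H m.
     E \<subseteq> H \<longrightarrow> finite H \<longrightarrow> card E = t \<longrightarrow> card H \<le> Suc k \<longrightarrow>
     (\<forall>a\<in>E. \<forall>b\<in>E. real_of_int (a - b) \<le> x) \<longrightarrow>
     real (card {n::nat. 1 \<le> n \<and> real n \<le> x \<and> (\<forall>h\<in>H. prime (int n + h - m))})
       \<le> 4/3 * fact t * 2 ^ t * (x / ln x ^ t) * (\<Prod>p\<in>primes_le (\<eta> * ln x). 1 - real (residue_count H p) / real p)
             / mertens_prod (\<eta> * ln x) ^ t + 1/12 * (x / ln x ^ t)"
    using tuple_count_upper_bound[OF t] by (elim exE conjE) (rule that)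
  have "\<forall>\<^sub>F x in at_top. \<forall>D. prime_difference_champion S k x D \<longrightarrow>
     mertens_prod (\<eta> * ln x) \<le> 2 * (fact (Suc k) * 2 ^ Suc k) * (\<Prod>p\<in>primes_le (\<eta> * ln x). 1 - real (residue_count (insert 0 D) p) / real p) \<and>
     (\<forall>p\<in>primes_le (\<eta> * ln x). residue_count (insert 0 D) p \<le> p)"
    using upper eventually_window_lower_bound[OF eta, of t0] eventually_ge_at_top[of 3]
  proof eventually_elim
    case (elim x)
    show ?case
    proof (intro allI impI)
      fix D assume D: "prime_difference_champion S k x D"
      define y where "y = \<eta> * ln x"
      define V where "V = mertens_prod y"
      define u where "u = x / ln x ^ t"
      have V: "V > 0" "V \<le> 1" unfolding V_def by (rule mertens_prod_pos mertens_prod_le_1)+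
      have u: "u > 0" using elim(3) by (simp add: u_def)
      have finD: "finite D" and cD: "card D = k" and DS: "D \<subseteq> S"
        using D by (auto simp: prime_difference_champion_def)
      have neD: "D \<noteq> {}" using cD k by auto
      define H where "H = insert 0 D"
      have finH: "finite H" using finD by (simp add: H_def)
      define PI where "PI = (\<Prod>p\<in>primes_le y. 1 - real (residue_count H p) / real p)"
      have nule: "residue_count H p \<le> p" if "p \<in> primes_le y" for p
      proof -
        have p0: "p > 0" using that by (auto simp: primes_le_def prime_gt_0_nat)
        hence "card (residues_of 0 H p) \<le> card {..<p}" by (intro card_mono residues_of_subset) auto
        thus ?thesis using card_residues_of[OF p0] by simp
      qed
      have PI0: "PI \<ge> 0" unfolding PI_def using nule by (intro prod_nonneg) (auto simp: divide_le_eq)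
      define M where "M = real (prime_tuple_count x D)"
      have q0: "\<Prod>(primes_le y) > 0" by (rule prod_pos) (auto dest!: prime_primes_le intro: prime_gt_0_nat)
      have lower: "3 / 4 * u \<le> M * V ^ t0"
      proof -
        have "real (card {s. \<forall>j\<in>J. j * \<Prod>(primes_le y) \<le> s \<and> s - j * \<Prod>(primes_le y) \<in> primes_le x - primes_le y}) \<le> M"
          if "card J = Suc t0" for J
          unfolding M_def of_nat_le_iff
          using that t0 by (intro champion_ge_window[OF S k D _ q0]) (auto simp: t_def)
        thus ?thesis using elim(2) unfolding u_def V_def y_def t0 M_def by auto
      qed
      \<comment> \<open>The lower bound provides at least one tuple, and its prime p is what
        confines the differences within \<open>E\<close> to at most x.\<close>
      have "M * V ^ t0 > 0" using lower u by linarith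
      hence "M \<noteq> 0" by auto
      hence "prime_tuple_count x D \<noteq> 0" by (simp add: M_def)
      hence "{p :: int. prime p \<and> real_of_int p \<le> x - real_of_int (Max D) \<and> (\<forall>d\<in>D. prime (p + d))} \<noteq> {}"
        unfolding prime_tuple_count_def by (metis card.empty)
      then obtain p where p: "prime p" "real_of_int p \<le> x - real_of_int (Max D)" "\<And>d. d \<in> D \<Longrightarrow> prime (p + d)"
        by auto
      have MD: "Min D \<in> D" "Max D \<in> D" "\<And>d. d \<in> D \<Longrightarrow> Min D \<le> d \<and> d \<le> Max D" using finD neD by auto
      \<comment> \<open>\<open>E\<close> needs \<open>t\<close> elements at mutual distance at most
        x. For \<open>S = UNIV\<close> the shift 0 stands for p, which may be far from the other
        primes of the tuple, so only \<open>D\<close> is taken.\<close>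
      define E where "E = (if S = UNIV then D else H)"
      define m where "m = (if S = UNIV then Min D else 0)"
      have Dpos: "D \<subseteq> {0<..}" if "S \<noteq> UNIV" using that S DS by auto
      have cH: "card H \<le> Suc k" using cD finD by (simp add: H_def card_insert_if)
      have cE: "card E = t"
      proof (cases "S = UNIV")
        case False
        hence "0 \<notin> D" using Dpos by auto
        thus ?thesis using False cD finD by (simp add: E_def t_def tuple_size_def H_def)
      qed (simp add: E_def t_def tuple_size_def cD)
      have EH: "E \<subseteq> H" by (auto simp: E_def H_def)
      have diff: "\<forall>a\<in>E. \<forall>b\<in>E. real_of_int (a - b) \<le> x"
      proof (intro ballI)
        fix a b assume ab: "a \<in> E" "b \<in> E"
        have "a - b \<le> p + Max D"
        proof (cases "S = UNIV")
          case True
          have "p + Min D \<ge> 2" using p(3)[OF MD(1)] by (rule prime_ge_2_int)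
          thus ?thesis using ab True MD(3)[of a] MD(3)[of b] by (auto simp: E_def)
        next
          case False
          have "p \<ge> 2" using p(1) by (rule prime_ge_2_int)
          moreover have "Max D > 0" using Dpos[OF False] MD(2) by auto
          moreover have "a \<le> Max D" using ab False MD(3)[of a] \<open>Max D > 0\<close> by (auto simp: E_def H_def)
          moreover have "b \<ge> 0" using ab False Dpos by (auto simp: E_def H_def)
          ultimately show ?thesis by linarith
        qed
        hence "real_of_int (a - b) \<le> real_of_int (p + Max D)" by (simp only: of_int_le_iff)
        thus "real_of_int (a - b) \<le> x" using p(2) by simp
      qed
      have "M \<le> real (card {n::nat. 1 \<le> n \<and> real n \<le> x \<and> (\<forall>h\<in>H. prime (int n + h - m))})"
        unfolding M_def of_nat_le_iff H_def
        using Dpos by (intro prime_tuple_count_le_shifted[OF finD neD]) (auto simp: m_def)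
      also have "\<dots> \<le> 4/3 * fact t * 2 ^ t * (x / ln x ^ t) * PI / V ^ t + 1/12 * (x / ln x ^ t)"
        unfolding PI_def V_def y_def
        by (rule elim(1)[THEN spec, THEN spec, THEN spec, THEN mp, OF EH, THEN mp, OF finH, THEN mp, OF cE, THEN mp, OF cH, THEN mp, OF diff])
      finally have "M \<le> 4/3 * fact t * 2 ^ t * u * PI / V ^ t + 1/12 * u" by (simp add: u_def)
      hence "M * V ^ t0 \<le> (4/3 * fact t * 2 ^ t * u * PI / V ^ t + 1/12 * u) * V ^ t0"
        using V by (intro mult_right_mono) auto
      also have "\<dots> = 4/3 * fact t * 2 ^ t * u * PI / V + 1/12 * u * V ^ t0"
        using V unfolding t0 by (simp add: field_simps)
      also have "\<dots> \<le> 4/3 * fact t * 2 ^ t * u * PI / V + 1/12 * u * 1"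
        using V u by (intro add_left_mono mult_left_mono power_le_one) auto
      \<comment> \<open>\<open>2/3 = 3/4 - 1/12\<close>; together with 4/3 this produces the leading
        factor 2 of the claim.\<close>
      finally have "u * (2/3) \<le> 4/3 * fact t * 2 ^ t * u * PI / V" using lower by linarith
      also have "\<dots> = u * (4/3 * fact t * 2 ^ t * PI / V)" by simp
      finally have "u * (2/3) \<le> u * (4/3 * fact t * 2 ^ t * PI / V)" .
      hence "2/3 \<le> 4/3 * fact t * 2 ^ t * PI / V" using u by (subst (asm) mult_le_cancel_left_pos)
      hence "V \<le> 2 * (fact t * 2 ^ t) * PI" using V by (simp add: pos_le_divide_eq mult_ac)
      \<comment> \<open>\<open>t\<close> is \<open>k\<close> or \<open>k + 1\<close>; the larger
        value serves both choices of \<open>S\<close>.\<close>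
      also have "\<dots> \<le> 2 * (fact (Suc k) * 2 ^ Suc k) * PI"
        using t PI0 by (intro mult_right_mono mult_left_mono mult_mono fact_mono power_increasing) auto
      finally show "mertens_prod (\<eta> * ln x) \<le> 2 * (fact (Suc k) * 2 ^ Suc k) * (\<Prod>p\<in>primes_le (\<eta> * ln x). 1 - real (residue_count (insert 0 D) p) / real p) \<and>
          (\<forall>p\<in>primes_le (\<eta> * ln x). residue_count (insert 0 D) p \<le> p)"
        using nule by (simp add: V_def PI_def y_def H_def)
    qed
  qed
  with eta(1) show ?thesis by (intro exI[of _ \<eta>] conjI)
qed

theorem theorem1p2:
  fixes k :: nat and S :: "int set"
  assumes "k \<ge> 1"
    and "S = UNIV \<or> S = {0<..}"
  shows "\<exists>r1 r2 :: real \<Rightarrow> real. r1 \<in> o[at_top](\<lambda>_. 1) \<and> r2 \<in> o[at_top](\<lambda>_. 1) \<and>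
    (\<forall>\<^sub>F x in at_top. \<forall>D. prime_difference_champion S k x D \<longrightarrow>
       (\<Sum>p | prime p \<and> real p \<le> 2 * ln x \<and> \<not> int p dvd Gcd D. 1 / real p)
         \<le> ln (fact k) + real k * ln 2 + ln (2 * (real k + 1)\<^sup>2) + r1 x \<and>
       (\<Sum>p | prime p \<and> real p \<le> 2 * ln x \<and> \<not> int p dvd Delta0 D. 1 / real p)
         \<le> 1 / real k * ln (fact k) + ln 2 + 1 / real k * ln (2 * (real k + 1)\<^sup>2) + r2 x)"
proof -
  obtain \<eta> where eta: "\<eta> > 0" and density: "\<forall>\<^sub>F x in at_top. \<forall>D. prime_difference_champion S k x D \<longrightarrow>
     mertens_prod (\<eta> * ln x) \<le> 2 * (fact (Suc k) * 2 ^ Suc k) * (\<Prod>p\<in>primes_le (\<eta> * ln x). 1 - real (residue_count (insert 0 D) p) / real p) \<and>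
     (\<forall>p\<in>primes_le (\<eta> * ln x). residue_count (insert 0 D) p \<le> p)"
    using champion_local_density[OF assms] by (elim exE conjE) (rule that)
  define r where "r x = (\<Sum>p\<in>primes_le (2 * ln x) - primes_le (\<eta> * ln x). 1 / real p)" for x
  have "(r \<longlongrightarrow> 0) at_top"
    unfolding r_def by (rule sum_inverse_primes_tendsto_0[OF eta])
  hence small: "r \<in> o[at_top](\<lambda>_. 1)" by (intro smalloI_tendsto) auto
  define c :: real where "c = 2 * (fact (Suc k) * 2 ^ Suc k)"
  define B where "B = ln (fact k) + real k * ln 2 + ln (2 * (real k + 1)\<^sup>2)"
  have c0: "c > 0" by (simp add: c_def)
  have cB: "ln c \<le> B"
  proof -
    \<comment> \<open>The step from 4 (k + 1) to 2 (k + 1)^2 uses k \<ge> 1 and is an equality for k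
      = 1.\<close>
    have "c = fact k * 2 ^ k * (2 * ((real k + 1) * 2))" by (simp add: c_def algebra_simps)
    also have "\<dots> \<le> fact k * 2 ^ k * (2 * ((real k + 1) * (real k + 1)))"
      using assms(1) by (intro mult_left_mono) auto
    finally have "ln c \<le> ln (fact k * 2 ^ k * (2 * (real k + 1)\<^sup>2))"
      using c0 by (subst ln_le_cancel_iff) (auto simp: power2_eq_square)
    also have "\<dots> = B" unfolding B_def by (simp add: ln_mult ln_realpow)
    finally show ?thesis .
  qed
  have "\<forall>\<^sub>F x in at_top. \<forall>D. prime_difference_champion S k x D \<longrightarrow>
       (\<Sum>p | prime p \<and> real p \<le> 2 * ln x \<and> \<not> int p dvd Gcd D. 1 / real p) \<le> B + r x \<and>
       (\<Sum>p | prime p \<and> real p \<le> 2 * ln x \<and> \<not> int p dvd Delta0 D. 1 / real p) \<le> 1 / real k * B + r x"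
    using density
  proof eventually_elim
    case (elim x)
    show ?case
    proof (intro allI impI)
      fix D assume D: "prime_difference_champion S k x D"
      define y where "y = \<eta> * ln x"
      have finD: "finite D" and cD: "card D = k" using D by (auto simp: prime_difference_champion_def)
      have dens: "mertens_prod y \<le> c * (\<Prod>p\<in>primes_le y. 1 - real (residue_count (insert 0 D) p) / real p)"
        "\<And>p. p \<in> primes_le y \<Longrightarrow> residue_count (insert 0 D) p \<le> p"
        using elim D by (auto simp: y_def c_def)
      have nu1: "residue_count (insert 0 D) p \<ge> 1" for p
        using residue_count_pos[of "insert 0 D" p] finD by (simp add: Suc_le_eq)
      \<comment> \<open>Primes between y and 2 ln x go into the o(1) term, which is the same for
        both sums.\<close>
      have split: "(\<Sum>p | prime p \<and> real p \<le> 2 * ln x \<and> \<not> Q p. 1 / real p)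
          \<le> (\<Sum>p\<in>primes_le y. (if Q p then 0 else 1) / real p) + r x" for Q :: "nat \<Rightarrow> bool"
      proof -
        have "(\<Sum>p | prime p \<and> real p \<le> 2 * ln x \<and> \<not> Q p. 1 / real p)
            \<le> (\<Sum>p\<in>{p\<in>primes_le y. \<not> Q p} \<union> (primes_le (2 * ln x) - primes_le y). 1 / real p)"
          by (intro sum_mono2) (simp, auto simp: primes_le_def[of "2 * ln x"])
        also have "\<dots> = (\<Sum>p\<in>{p\<in>primes_le y. \<not> Q p}. 1 / real p) + r x"
          unfolding r_def y_def by (intro sum.union_disjoint) auto
        also have "(\<Sum>p\<in>{p\<in>primes_le y. \<not> Q p}. 1 / real p) = (\<Sum>p\<in>primes_le y. (if Q p then 0 else 1) / real p)"
          by (intro sum.mono_neutral_cong_left) auto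
        finally show ?thesis .
      qed
      have "(\<Sum>p\<in>primes_le y. real (if int p dvd Gcd D then 0 else 1) / real p) \<le> ln c"
      proof (rule sum_le_ln_of_product_bound[OF _ c0 dens(1)])
        fix p assume p: "p \<in> primes_le y"
        show "Suc (if int p dvd Gcd D then 0 else 1) \<le> residue_count (insert 0 D) p \<and> residue_count (insert 0 D) p \<le> p"
          using dens(2)[OF p] nu1[of p] residue_count_ge_2_if_not_dvd_Gcd[OF finD prime_primes_le[OF p]] by auto
      qed
      \<comment> \<open>Modulo a prime not dividing \<open>Delta0 D\<close> the shifts occupy k + 1
        distinct classes, so it counts with weight \<open>k\<close>; division by \<open>k\<close> at
        the end gives the second bound.\<close>
      moreover have "(\<Sum>p\<in>primes_le y. real (if int p dvd Delta0 D then 0 else k) / real p) \<le> ln c"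
      proof (rule sum_le_ln_of_product_bound[OF _ c0 dens(1)])
        fix p assume p: "p \<in> primes_le y"
        show "Suc (if int p dvd Delta0 D then 0 else k) \<le> residue_count (insert 0 D) p \<and> residue_count (insert 0 D) p \<le> p"
          using dens(2)[OF p] nu1[of p] residue_count_ge_if_not_dvd_Delta0[OF finD, of p] cD by auto
      qed
      moreover have "(\<Sum>p\<in>primes_le y. real (if int p dvd Delta0 D then 0 else k) / real p)
          = real k * (\<Sum>p\<in>primes_le y. (if int p dvd Delta0 D then 0 else 1) / real p)"
        unfolding sum_distrib_left by (intro sum.cong) auto
      ultimately have 1: "(\<Sum>p\<in>primes_le y. (if int p dvd Gcd D then 0 else 1) / real p) \<le> B"
        and 2: "real k * (\<Sum>p\<in>primes_le y. (if int p dvd Delta0 D then 0 else 1) / real p) \<le> B"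
        using cB by (simp_all add: if_distrib[of real] cong: if_cong)
      have "(\<Sum>p\<in>primes_le y. (if int p dvd Delta0 D then 0 else 1) / real p) \<le> 1 / real k * B"
        using 2 assms(1) by (simp add: pos_le_divide_eq mult.commute)
      with 1 show "(\<Sum>p | prime p \<and> real p \<le> 2 * ln x \<and> \<not> int p dvd Gcd D. 1 / real p) \<le> B + r x \<and>
         (\<Sum>p | prime p \<and> real p \<le> 2 * ln x \<and> \<not> int p dvd Delta0 D. 1 / real p) \<le> 1 / real k * B + r x"
        using split[of "\<lambda>p. int p dvd Gcd D"] split[of "\<lambda>p. int p dvd Delta0 D"] by linarith
    qed
  qed
  moreover have "1 / real k * B = 1 / real k * ln (fact k) + ln 2 + 1 / real k * ln (2 * (real k + 1)\<^sup>2)"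
    using assms(1) by (simp add: B_def add_divide_distrib)
  ultimately show ?thesis
    using small unfolding B_def by (intro exI[of _ r] conjI) (simp_all add: add.assoc)
qed

end
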